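(* Let $Q$ be a connected symmetric quiver on vertices $1,\dots,k$ with symmetric adjacency matrix $A=(a_{ij})$ of nonnegative integers satisfying $a_{ii}\ge 1$ for all $i$, and let $\gamma=(\gamma_1,\dots,\gamma_k)\in\mathbb{Z}_{\ge0}^k$ be a dimension vector such that the covering graph $G_{Q,\gamma}$ is connected. Then the dimensions of the graded pieces of $\mathcal{P}(G_{Q,\gamma})^{S_\gamma}$ are the coefficients of the quantum DT invariant $\tilde\Omega_\gamma(q)$, i.e. $$\sum_{d\ge0}\dim\big(\mathcal{P}(G_{Q,\gamma})^{S_\gamma}\big)_d\,q^d=\tilde\Omega_\gamma(q).$$ In particular, the numerical DT invariant $\mathrm{DT}_{Q,\gamma}:=\tilde\Omega_\gamma(1)$ equals the number of $S_\gamma$-orbits on $\mathrm{Break}(G_{Q,\gamma})$.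
   Context: $Q$ has $a_{ij}$ arrows from $i$ to $j$. Put $S_\gamma=S_{\gamma_1}\times\cdots\times S_{\gamma_k}$. Covering graph: $G_{Q,\gamma}$ is the undirected multigraph with vertices $v_{i,\alpha}$ ($1\le i\le k$, $1\le\alpha\le\gamma_i$), with $a_{ii}-1$ edges between $v_{i,\alpha}$ and $v_{i,\beta}$ for $\alpha\neq\beta$, and $a_{ij}$ edges between $v_{i,\alpha}$ and $v_{j,\beta}$ for $i\ne j$. The group $S_\gamma$ acts on it by permuting second indices. Slim subgraph space: for a connected loopless multigraph $G$ with totally ordered vertex set, edge set $E(G)$, and a variable $x_v$ for each vertex $v$, put $p_Y=\prod_{\{u<v\}\in Y}(x_u-x_v)$ for $Y\subseteq E(G)$ (with multiplicity). $Y$ is slim if removing $Y$ from $G$ (keeping all vertices) leaves a connected graph. $\mathcal{P}(G)$ is the $\mathbb{Q}$-span of all $p_Y$, $Y$ slim, graded by degree. For $G=G_{Q,\gamma}$ order the vertices lexicographically and write $x_{i,\alpha}$ for the variable of $v_{i,\alpha}$; $S_\gamma$ acts by permuting variables. Break divisors: the genus of a connected graph $H$ is $g(H)=|E(H)|-|V(H)|+1$. $\mathrm{Break}(G)$ is the set of $D:V(G)\to\mathbb{Z}_{\ge0}$ with $\sum_vD(v)=g(G)$ and $\sum_{v\in V(H)}D(v)\ge g(H)$ for every connected subgraph $H$ of $G$; graph automorphisms act on it by permutation. Quantum DT invariants (Efimov's description; trivial potential and stability): Let $A_\gamma^{\mathrm{prim}}=\mathbb{Q}[x_{j,\alpha_2}-x_{i,\alpha_1}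 : 1\le i,j\le k,\ 1\le\alpha_1\le\gamma_i,\ 1\le\alpha_2\le\gamma_j]$, with $S_\gamma$ permuting second indices. For $\gamma=\delta+\bar\delta$ with $\delta,\bar\delta\in\mathbb{Z}_{\ge0}^k$ both nonzero, let $$f_{\delta,\bar\delta}=\prod_{i\ne j\in[k]}\prod_{\alpha_1=1}^{\delta_i}\prod_{\alpha_2=\delta_j+1}^{\gamma_j}(x_{j,\alpha_2}-x_{i,\alpha_1})^{a_{ij}}\prod_{i\in[k]}\prod_{\alpha_1=1}^{\delta_i}\prod_{\alpha_2=\delta_i+1}^{\gamma_i}(x_{i,\alpha_2}-x_{i,\alpha_1})^{a_{ii}-1}$$ (the first product is over ordered pairs). $J_\gamma$ is the smallest $S_\gamma$-stable $A_\gamma^{\mathrm{prim}}$-submodule of $A_\gamma^{\mathrm{prim}}$ containing all $f_{\delta,\bar\delta}$. Let $\mathcal{H}_\gamma^{\mathrm{prim}}=(A_\gamma^{\mathrm{prim}})^{S_\gamma}$ and let $V_\gamma^{\mathrm{prim}}$ be a graded complement: $\mathcal{H}_\gamma^{\mathrm{prim}}=V_\gamma^{\mathrm{prim}}\oplus J_\gamma^{S_\gamma}$ (its graded dimensions are those of $\mathcal{H}_\gamma^{\mathrm{prim}}/J_\gamma^{S_\gamma}$; it is finite-dimensional by Efimov). Let $\chi_Q(\gamma,\gamma)=\sum_i\gamma_i^2-\sum_{i,j}a_{ij}\gamma_i\gamma_j$. A polynomial of ordinary degree $d$ is given the grading $2d+\chi_Q(\gamma,\gamma)$; $c_{\gamma,l}$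 is the dimension of the part of $V_\gamma^{\mathrm{prim}}$ of grading $l$. Set $\Omega_\gamma(q)=\sum_{l\in\mathbb{Z}}c_{\gamma,l}q^{l/2}$ and $\tilde\Omega_\gamma(q)=q^{-\frac12\chi_Q(\gamma,\gamma)}\Omega_\gamma(q)=\sum_{d\ge0}c_{\gamma,2d+\chi_Q(\gamma,\gamma)}q^d$. *)

theory Defs
  imports
    "HOL-Library.Poly_Mapping"
    "HOL-Combinatorics.Permutations"
    "HOL-Computational_Algebra.Polynomial_FPS"
    "Graph_Theory.Digraph_Component"
begin

section \<open>Multivariate polynomials over the rationals\<close>

type_synonym 'v mpoly = "('v \<Rightarrow>\<^sub>0 nat) \<Rightarrow>\<^sub>0 rat"

definition Const :: "rat \<Rightarrow> 'v mpoly" where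
  "Const c = Poly_Mapping.single 0 c"

definition Var :: "'v \<Rightarrow> 'v mpoly" where
  "Var v = Poly_Mapping.single (Poly_Mapping.single v 1) 1"

definition mscale :: "rat \<Rightarrow> 'v mpoly \<Rightarrow> 'v mpoly" where
  "mscale c p = Const c * p"

interpretation mpoly: vector_space mscale
  by standard
    (simp_all add: mscale_def Const_def single_add distrib_left distrib_right mult_single
      flip: mult.assoc)

definition homogeneous :: "nat \<Rightarrow> 'v mpoly \<Rightarrow> bool" where
  "homogeneous d p \<longleftrightarrow>
    (\<forall>m\<in>Poly_Mapping.keys p. (\<Sum>v\<in>Poly_Mapping.keys m. Poly_Mapping.lookup m v) = d)"

definition rename :: "('v \<Rightarrow> 'v) \<Rightarrow> 'v mpoly \<Rightarrow> 'v mpoly" where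
  "rename \<pi> p =
    (\<Sum>m\<in>Poly_Mapping.keys p. Const (Poly_Mapping.lookup p m) *
      (\<Prod>v\<in>Poly_Mapping.keys m. Var (\<pi> v) ^ Poly_Mapping.lookup m v))"

definition invariants :: "('v \<Rightarrow> 'v) set \<Rightarrow> 'v mpoly set \<Rightarrow> 'v mpoly set" where
  "invariants S W = {p \<in> W. \<forall>\<pi>\<in>S. rename \<pi> p = p}"

definition hilbert_series :: "'v mpoly set \<Rightarrow> int fps" where
  "hilbert_series W = Abs_fps (\<lambda>d. int (mpoly.dim {p \<in> W. homogeneous d p}))"

inductive_set subalgebra_gen :: "'v mpoly set \<Rightarrow> 'v mpoly set" for B where
  gen: "p \<in> B \<Longrightarrow> p \<in> subalgebra_gen B"
| const: "Const c \<in> subalgebra_gen B"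
| add: "p \<in> subalgebra_gen B \<Longrightarrow> q \<in> subalgebra_gen B \<Longrightarrow> p + q \<in> subalgebra_gen B"
| mult: "p \<in> subalgebra_gen B \<Longrightarrow> q \<in> subalgebra_gen B \<Longrightarrow> p * q \<in> subalgebra_gen B"

definition graded_subspace :: "'v mpoly set \<Rightarrow> bool" where
  "graded_subspace V \<longleftrightarrow> mpoly.subspace V \<and> V = mpoly.span {p \<in> V. \<exists>d. homogeneous d p}"

definition graded_complement :: "'v mpoly set \<Rightarrow> 'v mpoly set \<Rightarrow> 'v mpoly set \<Rightarrow> bool" where
  "graded_complement V W H \<longleftrightarrow>
    graded_subspace V \<and> V \<inter> W = {0} \<and> {v + w | v w. v \<in> V \<and> w \<in> W} = H"


section \<open>Slim subgraphs and break divisors\<close>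

text \<open>
  An undirected multigraph is given by a digraph with one arc per edge; \<open>connected\<close> refers to
  the underlying undirected graph and excludes the empty graph, and \<open>subgraph\<close> is blind to the
  orientation.  The orientation records the order of the two ends: each arc goes from its smaller
  to its larger end in the chosen total order of the vertices.
\<close>

definition edge_product :: "('v, 'e) pre_digraph \<Rightarrow> 'e set \<Rightarrow> 'v mpoly" where
  "edge_product G Y = (\<Prod>e\<in>Y. Var (tail G e) - Var (head G e))"

definition slim :: "('v, 'e) pre_digraph \<Rightarrow> 'e set \<Rightarrow> bool" where
  "slim G Y \<longleftrightarrow> Y \<subseteq> arcs G \<and> connected (G\<lparr>arcs := arcs G - Y\<rparr>)"

definition slim_space :: "('v, 'e) pre_digraph \<Rightarrow> 'v mpoly set" where
  "slim_space G = mpoly.span {edge_product G Y | Y. slim G Y}"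

definition genus :: "('v, 'e) pre_digraph \<Rightarrow> int" where
  "genus H = int (card (arcs H)) - int (card (verts H)) + 1"

text \<open>Functions on the vertex set are extended by zero to the whole type.\<close>

definition break_divisors :: "('v, 'e) pre_digraph \<Rightarrow> ('v \<Rightarrow> nat) set" where
  "break_divisors G =
    {D. (\<forall>v. v \<notin> verts G \<longrightarrow> D v = 0) \<and>
        int (\<Sum>v\<in>verts G. D v) = genus G \<and>
        (\<forall>H. subgraph H G \<and> connected H \<longrightarrow> int (\<Sum>v\<in>verts H. D v) \<ge> genus H)}"

definition orbits :: "('v \<Rightarrow> 'v) set \<Rightarrow> ('v \<Rightarrow> nat) set \<Rightarrow> ('v \<Rightarrow> nat) set set" where
  "orbits S X = (\<lambda>D. (\<lambda>\<pi>. D \<circ> inv \<pi>) ` S) ` X"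


section \<open>Quivers, covering graphs and quantum DT invariants\<close>

definition arrow_count :: "('v, 'e) pre_digraph \<Rightarrow> 'v \<Rightarrow> 'v \<Rightarrow> nat" where
  "arrow_count Q i j = card {e \<in> arcs Q. tail Q e = i \<and> head Q e = j}"

text \<open>
  Below, \<open>k\<close> is the number of quiver vertices, \<open>a\<close> the adjacency matrix and \<open>\<gamma>\<close> the dimension
  vector; only the values of \<open>a\<close> and \<open>\<gamma>\<close> at indices in \<open>{1..k}\<close> matter.  The pair \<open>(i, \<alpha>)\<close> stands
  for the vertex \<open>v\<^bsub>i,\<alpha>\<^esub>\<close>.  In exponents and edge multiplicities, \<open>a i i - 1\<close> is truncated
  subtraction, so \<open>a i i \<ge> 1\<close> is presupposed.
\<close>

definition cover_verts :: "nat \<Rightarrow> (nat \<Rightarrow> nat) \<Rightarrow> (nat \<times> nat) set" where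
  "cover_verts k \<gamma> = {(i, \<alpha>). i \<in> {1..k} \<and> \<alpha> \<in> {1..\<gamma> i}}"

definition edge_mult :: "(nat \<Rightarrow> nat \<Rightarrow> nat) \<Rightarrow> nat \<times> nat \<Rightarrow> nat \<times> nat \<Rightarrow> nat" where
  "edge_mult a u v = (if fst u = fst v then a (fst u) (fst u) - 1 else a (fst u) (fst v))"

text \<open>The edge \<open>(u, v, m)\<close> is the \<open>m\<close>-th edge between \<open>u\<close> and \<open>v\<close>, where \<open>u\<close> precedes \<open>v\<close>
  lexicographically.\<close>

definition covering_graph ::
  "nat \<Rightarrow> (nat \<Rightarrow> nat \<Rightarrow> nat) \<Rightarrow> (nat \<Rightarrow> nat) \<Rightarrow> (nat \<times> nat, (nat \<times> nat) \<times> (nat \<times> nat) \<times> nat) pre_digraph"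
  where
  "covering_graph k a \<gamma> =
    \<lparr> verts = cover_verts k \<gamma>,
      arcs = {(u, v, m). u \<in> cover_verts k \<gamma> \<and> v \<in> cover_verts k \<gamma> \<and>
                (u, v) \<in> less_than <*lex*> less_than \<and> m < edge_mult a u v},
      tail = (\<lambda>(u, v, m). u),
      head = (\<lambda>(u, v, m). v) \<rparr>"

text \<open>\<open>S\<^sub>\<gamma>\<close>, as a group of permutations of the index pairs.\<close>

definition sym_group :: "nat \<Rightarrow> (nat \<Rightarrow> nat) \<Rightarrow> (nat \<times> nat \<Rightarrow> nat \<times> nat) set" where
  "sym_group k \<gamma> =
    {\<lambda>(i, \<alpha>). (i, \<sigma> i \<alpha>) | \<sigma>.
      (\<forall>i\<in>{1..k}. \<sigma> i permutes {1..\<gamma> i}) \<and> (\<forall>i. i \<notin> {1..k} \<longrightarrow> \<sigma> i = id)}"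

definition A_prim :: "nat \<Rightarrow> (nat \<Rightarrow> nat) \<Rightarrow> (nat \<times> nat) mpoly set" where
  "A_prim k \<gamma> = subalgebra_gen {Var v - Var u | u v. u \<in> cover_verts k \<gamma> \<and> v \<in> cover_verts k \<gamma>}"

definition shuffle_kernel ::
  "nat \<Rightarrow> (nat \<Rightarrow> nat \<Rightarrow> nat) \<Rightarrow> (nat \<Rightarrow> nat) \<Rightarrow> (nat \<Rightarrow> nat) \<Rightarrow> (nat \<times> nat) mpoly" where
  "shuffle_kernel k a \<gamma> \<delta> =
    (\<Prod>i\<in>{1..k}. \<Prod>j\<in>{1..k} - {i}. \<Prod>\<alpha>\<^sub>1\<in>{1..\<delta> i}. \<Prod>\<alpha>\<^sub>2\<in>{\<delta> j + 1..\<gamma> j}.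
      (Var (j, \<alpha>\<^sub>2) - Var (i, \<alpha>\<^sub>1)) ^ a i j) *
    (\<Prod>i\<in>{1..k}. \<Prod>\<alpha>\<^sub>1\<in>{1..\<delta> i}. \<Prod>\<alpha>\<^sub>2\<in>{\<delta> i + 1..\<gamma> i}.
      (Var (i, \<alpha>\<^sub>2) - Var (i, \<alpha>\<^sub>1)) ^ (a i i - 1))"

definition splittings :: "nat \<Rightarrow> (nat \<Rightarrow> nat) \<Rightarrow> ((nat \<Rightarrow> nat) \<times> (nat \<Rightarrow> nat)) set" where
  "splittings k \<gamma> =
    {(\<delta>, \<delta>'). (\<forall>i\<in>{1..k}. \<gamma> i = \<delta> i + \<delta>' i) \<and>
       (\<exists>i\<in>{1..k}. \<delta> i \<noteq> 0) \<and> (\<exists>i\<in>{1..k}. \<delta>' i \<noteq> 0)}"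

definition stable_submodule :: "nat \<Rightarrow> (nat \<Rightarrow> nat) \<Rightarrow> (nat \<times> nat) mpoly set \<Rightarrow> bool" where
  "stable_submodule k \<gamma> M \<longleftrightarrow>
    M \<subseteq> A_prim k \<gamma> \<and> 0 \<in> M \<and>
    (\<forall>p\<in>M. \<forall>q\<in>M. p + q \<in> M) \<and>
    (\<forall>r\<in>A_prim k \<gamma>. \<forall>p\<in>M. r * p \<in> M) \<and>
    (\<forall>\<pi>\<in>sym_group k \<gamma>. \<forall>p\<in>M. rename \<pi> p \<in> M)"

definition J_module ::
  "nat \<Rightarrow> (nat \<Rightarrow> nat \<Rightarrow> nat) \<Rightarrow> (nat \<Rightarrow> nat) \<Rightarrow> (nat \<times> nat) mpoly set" where
  "J_module k a \<gamma> =
    \<Inter> {M. stable_submodule k \<gamma> M \<and> (\<forall>(\<delta>, \<delta>')\<in>splittings k \<gamma>. shuffle_kernel k a \<gamma> \<delta> \<in> M)}"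

definition is_V_prim ::
  "nat \<Rightarrow> (nat \<Rightarrow> nat \<Rightarrow> nat) \<Rightarrow> (nat \<Rightarrow> nat) \<Rightarrow> (nat \<times> nat) mpoly set \<Rightarrow> bool" where
  "is_V_prim k a \<gamma> V \<longleftrightarrow>
    graded_complement V (invariants (sym_group k \<gamma>) (J_module k a \<gamma>))
      (invariants (sym_group k \<gamma>) (A_prim k \<gamma>))"

definition chi :: "nat \<Rightarrow> (nat \<Rightarrow> nat \<Rightarrow> nat) \<Rightarrow> (nat \<Rightarrow> nat) \<Rightarrow> int" where
  "chi k a \<gamma> =
    (\<Sum>i\<in>{1..k}. (int (\<gamma> i))\<^sup>2) - (\<Sum>i\<in>{1..k}. \<Sum>j\<in>{1..k}. int (a i j) * int (\<gamma> i) * int (\<gamma> j))"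

definition DT_coeff ::
  "nat \<Rightarrow> (nat \<Rightarrow> nat \<Rightarrow> nat) \<Rightarrow> (nat \<Rightarrow> nat) \<Rightarrow> (nat \<times> nat) mpoly set \<Rightarrow> int \<Rightarrow> nat" where
  "DT_coeff k a \<gamma> V l =
    mpoly.dim {p \<in> V. \<exists>d. homogeneous d p \<and> 2 * int d + chi k a \<gamma> = l}"

definition quantum_DT ::
  "nat \<Rightarrow> (nat \<Rightarrow> nat \<Rightarrow> nat) \<Rightarrow> (nat \<Rightarrow> nat) \<Rightarrow> (nat \<times> nat) mpoly set \<Rightarrow> int fps" where
  "quantum_DT k a \<gamma> V = Abs_fps (\<lambda>d. int (DT_coeff k a \<gamma> V (2 * int d + chi k a \<gamma>)))"

text \<open>Evaluation at \<open>q = 1\<close>; meaningful because the series is a polynomial, \<open>V\<close> being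
  finite-dimensional.\<close>

definition numerical_DT ::
  "nat \<Rightarrow> (nat \<Rightarrow> nat \<Rightarrow> nat) \<Rightarrow> (nat \<Rightarrow> nat) \<Rightarrow> (nat \<times> nat) mpoly set \<Rightarrow> int" where
  "numerical_DT k a \<gamma> V = poly (THE P. fps_of_poly P = quantum_DT k a \<gamma> V) 1"

end

theory Submission
  imports Defs
begin

text \<open>
  Let \<open>G\<close> be the covering graph with vertex set \<open>V\<close>. For an edge \<open>e\<close> let \<open>x\<^sub>e\<close> be the difference of
  the variables at its two ends, let \<open>A\<close> be the algebra generated by all differences of variables,
  \<open>P\<close> the span of the slim products, and \<open>J\<close> the ideal of \<open>A\<close> generated by the cut products, the
  products of the \<open>x\<^sub>e\<close> over all edges between a set \<open>S\<close> of vertices and its complement. The shuffle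
  kernels are, up to sign, cut products, and the symmetric group moves them to all the others; so \<open>J\<close>
  is Efimov's module (\<open>J_module_eq\<close>).

  The graded statement holds because \<open>A\<close> is the direct sum of \<open>P\<close> and \<open>J\<close> (\<open>diffalg_decompose\<close>,
  \<open>slims_cutideal_Int\<close>). Both summands are graded and stable under the symmetric group, so the
  invariants of \<open>P\<close> are a graded complement of the invariants of \<open>J\<close> in those of \<open>A\<close>, as is the space
  that defines the DT invariant, and two such complements have the same graded dimension
  (\<open>dim_complement\<close>).

  The key to \<open>P\<close> is that it can be described without choosing edges (\<open>slims_eq_cutker\<close>): an element \<open>f\<close>
  of \<open>A\<close> lies in \<open>P\<close> iff for every \<open>S\<close> the substitution of \<open>x\<^sub>v + T\<close> for \<open>x\<^sub>v\<close>, \<open>v \<in> S\<close>, gives a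
  polynomial in \<open>T\<close> of degree less than the number of edges that leave \<open>S\<close>. This, like most facts
  about \<open>P\<close>, is proved by deletion and contraction of an edge \<open>e\<close> from \<open>u\<close> to \<open>v\<close>: setting
  \<open>x\<^sub>v = x\<^sub>u\<close> maps \<open>P(G)\<close> to \<open>P(G/e)\<close>, and the kernel is \<open>x\<^sub>e P(G - e)\<close>. The same recursion
  gives \<open>A = P + J\<close>. For the trivial intersection the cut products are deformed, with \<open>x\<^sub>e - c\<^sub>e\<close> in
  place of \<open>x\<^sub>e\<close> for generic constants. The deformed products vanish at all points where the
  equations \<open>x\<^sub>e = c\<^sub>e\<close> that hold connect the graph, while an element of \<open>P\<close> that vanishes at all
  these points is \<open>0\<close> (\<open>cutker_vanishing\<close>). As the deformation changes only lower degrees, induction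
  on the degree transfers this to \<open>J\<close> (\<open>cutideal_reduce\<close>).

  For the count of orbits, the break divisors are the lattice points of a generic translate of the
  graphical zonotope. Their number satisfies the recursion of deletion and contraction, whence \<open>dim P\<close>
  is at most this number (\<open>slims_dim_le_lattice_points\<close>). Conversely, send a function \<open>\<phi>\<close> on the break
  divisors to its \<open>d\<close>-th power sum, the polynomial \<open>\<Sum>\<^sub>D \<phi>(D) (\<Sum>\<^sub>v D(v) x\<^sub>v)\<^sup>d\<close>. If the power sums
  of order less than \<open>d\<close> vanish, then the \<open>d\<close>-th one lies in \<open>P\<close> (\<open>psum_slims\<close>), since on break divisors
  the sum of \<open>D\<close> over \<open>S\<close> takes no more values than there are edges leaving \<open>S\<close>. The power sums together
  determine \<open>\<phi>\<close>, so they map the graded pieces of a filtration of the functions on \<open>Break(G)\<close>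
  injectively to the graded pieces of \<open>P\<close>, and the bound on \<open>dim P\<close> makes these maps bijective. They
  commute with the symmetric group. Hence the invariants of \<open>P\<close> have the dimension of the invariant
  functions on \<open>Break(G)\<close>, which is the number of orbits (\<open>dim_invariant_slims\<close>).
\<close>

section \<open>Linear algebra\<close>

text \<open>
  The rank-nullity theorem for a finite-dimensional subspace of a possibly infinite-dimensional space.
  Linearity is asked for on the subspace only, so that the theorem applies to projections along a
  complement, which have no natural extension to the whole space.
\<close>

lemma (in vector_space) dim_image_kernel:
  assumes U: "subspace U" and F: "U \<subseteq> span F" "finite F"
    and add: "\<And>x y. x \<in> U \<Longrightarrow> y \<in> U \<Longrightarrow> f (x + y) = f x + f y"
    and sc: "\<And>c x. x \<in> U \<Longrightarrow> f (scale c x) = scale c (f x)"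
  shows "dim U = dim (f ` U) + dim {x \<in> U. f x = 0}"
proof -
  interpret vp: vector_space_pair scale scale ..
  let ?Ker = "{x \<in> U. f x = 0}"
  obtain K where K: "K \<subseteq> ?Ker" "independent K" "?Ker \<subseteq> span K" "card K = dim ?Ker"
    by (rule basis_exists)
  obtain B where B: "K \<subseteq> B" "B \<subseteq> U" "independent B" "U \<subseteq> span B"
    using maximal_independent_subset_extend[of K U] K by blast
  have finB: "finite B"
    using independent_span_bound[OF F(2) B(3)] B(2) F(1) by blast
  have spB: "span B = U"
    using B U by (simp add: span_subspace)
  obtain g where g: "Vector_Spaces.linear scale scale g" "\<And>x. x \<in> B \<Longrightarrow> g x = f x"
    using vp.linear_independent_extend[OF B(3), of f] by blast
  interpret g: Vector_Spaces.linear scale scale g by (rule g)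
  have f0: "f 0 = 0"
    using sc[of 0 0] U by (simp add: subspace_0)
  have gf: "g x = f x" if "x \<in> U" for x
  proof -
    have "x \<in> span B" using that spB by simp
    then have "x \<in> U \<and> g x = f x"
    proof (induction rule: span_induct_alt)
      case base then show ?case using U by (simp add: f0 g.zero subspace_0)
    next
      case (step c b y)
      have "b \<in> U" "y \<in> U" using step spB B by auto
      moreover have "scale c b \<in> U" using \<open>b \<in> U\<close> U by (simp add: subspace_scale)
      ultimately show ?case using step g(2) U by (simp add: g.add g.scale add sc subspace_add)
    qed
    then show ?thesis ..
  qed
  define C where "C = B - K"
  have CU: "span C \<subseteq> U" using spB span_mono[of C B] by (auto simp: C_def)
  have inj: "inj_on g (span C)"
  proof (subst g.inj_on_iff_eq_0[OF subspace_span], intro ballI impI)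
    fix x assume x: "x \<in> span C" "g x = 0"
    then have "x \<in> U" using CU by auto
    then have "x \<in> ?Ker" using x gf by auto
    then have xK: "x \<in> span K" using K by auto
    have "representation B x = representation K x" "representation B x = representation C x"
      by (rule representation_extend[OF B(3) xK B(1)], rule representation_extend[OF B(3) x(1)])
        (simp add: C_def)
    then have "representation B x b = 0" for b
      using representation_ne_zero[of C x b] representation_ne_zero[of K x b] by (auto simp: C_def)
    moreover have "x = (\<Sum>b\<in>B. scale (representation B x b) b)"
      using sum_representation_eq[OF B(3) _ finB order_refl, of x] \<open>x \<in> U\<close> spB by simp
    ultimately show "x = 0" by simp
  qed
  have indC: "independent C" using B(3) by (rule independent_mono) (auto simp: C_def)
  have ind: "independent (g ` C)"
    by (rule g.independent_injective_image[OF indC inj])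
  have img: "span (g ` C) = f ` U"
  proof -
    have "g x \<in> g ` span C" if "x \<in> U" for x
    proof -
      have "x \<in> span (K \<union> C)" using that spB B(1) by (simp add: C_def Un_absorb1)
      then obtain a b where ab: "x = a + b" "a \<in> span K" "b \<in> span C"
        by (auto simp: span_Un)
      have "span K \<subseteq> ?Ker"
      proof (rule span_minimal[OF K(1)])
        show "subspace ?Ker"
          using U by (auto simp: subspace_def f0 add sc)
      qed
      then have "a \<in> U" "f a = 0" using ab by auto
      then have "g a = 0" using gf by auto
      then show ?thesis using ab by (auto simp: g.add)
    qed
    moreover have "g x \<in> g ` U" if "x \<in> span C" for x using that CU by auto
    ultimately have "g ` span C = g ` U" by blast
    also have "\<dots> = f ` U" using gf by auto
    finally show ?thesis by (simp add: g.span_image)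
  qed
  have "dim (f ` U) = card (g ` C)"
    using dim_span_eq_card_independent[OF ind] img by simp
  also have "\<dots> = card C"
    using inj by (intro card_image) (meson inj_on_subset span_superset)
  also have "card C + card K = card B"
    using finB B(1) by (simp add: C_def card_Diff_subset finite_subset card_mono)
  finally show ?thesis
    using K(4) dim_eq_card_independent[OF B(3)] spB by (metis add.commute dim_span)
qed

text \<open>
  The subspaces on which the first \<open>d\<close> maps vanish form a decreasing filtration of \<open>U\<close>, and the next
  map is injective on the \<open>d\<close>-th graded piece. It is used for homogeneous components and for power sums.
\<close>

lemma (in vector_space) dim_filtration:
  fixes f :: "nat \<Rightarrow> 'b \<Rightarrow> 'b" and N :: nat
  assumes U: "subspace U" and F: "U \<subseteq> span F" "finite F"
    and lin: "\<And>i. Vector_Spaces.linear scale scale (f i)"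
    and inj: "\<And>x. x \<in> U \<Longrightarrow> (\<And>i. i < N \<Longrightarrow> f i x = 0) \<Longrightarrow> x = 0"
  shows "dim U = (\<Sum>d<N. dim (f d ` {x \<in> U. \<forall>i<d. f i x = 0}))"
proof -
  have sub: "subspace {x \<in> U. \<forall>i<n. f i x = 0}" for n
  proof -
    have "f i 0 = 0" "f i (x + y) = f i x + f i y" "f i (scale c x) = scale c (f i x)" for i x y c
    proof -
      interpret Vector_Spaces.linear scale scale "f i" by (rule lin)
      show "f i 0 = 0" "f i (x + y) = f i x + f i y" "f i (scale c x) = scale c (f i x)"
        by (simp_all add: zero add scale)
    qed
    then show ?thesis using U by (auto simp: subspace_def)
  qed
  have step: "dim U = (\<Sum>d<n. dim (f d ` {x \<in> U. \<forall>i<d. f i x = 0})) + dim {x \<in> U. \<forall>i<n. f i x = 0}" for n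
  proof (induction n)
    case 0 then show ?case by simp
  next
    case (Suc n)
    interpret Vector_Spaces.linear scale scale "f n" by (rule lin)
    have "dim {x \<in> U. \<forall>i<n. f i x = 0} = dim (f n ` {x \<in> U. \<forall>i<n. f i x = 0})
        + dim {x \<in> {x \<in> U. \<forall>i<n. f i x = 0}. f n x = 0}"
      using F by (intro dim_image_kernel[OF sub, of _ F]) (auto simp: add scale)
    moreover have "{x \<in> {x \<in> U. \<forall>i<n. f i x = 0}. f n x = 0} = {x \<in> U. \<forall>i<Suc n. f i x = 0}"
      by (auto simp: less_Suc_eq)
    ultimately show ?case using Suc by simp
  qed
  have "{x \<in> U. \<forall>i<N. f i x = 0} \<subseteq> {0}" using inj by auto
  then have "dim {x \<in> U. \<forall>i<N. f i x = 0} \<le> card ({}::'b set)"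
    by (intro dim_le_card) auto
  then show ?thesis using step[of N] by simp
qed

lemma (in vector_space) subspace_eq_of_dim:
  assumes A: "subspace A" and AB: "A \<subseteq> B" and B: "B \<subseteq> span F" "finite F" and d: "dim B \<le> dim A"
  shows "A = B"
proof -
  obtain X where X: "X \<subseteq> A" "independent X" "A \<subseteq> span X" "card X = dim A"
    by (rule basis_exists)
  obtain Y where Y: "X \<subseteq> Y" "Y \<subseteq> B" "independent Y" "B \<subseteq> span Y"
    using maximal_independent_subset_extend[of X B] X AB by blast
  have finY: "finite Y" using independent_span_bound[OF B(2) Y(3)] Y(2) B(1) by blast
  have "card Y = dim B" by (rule basis_card_eq_dim[OF Y(2,4,3)])
  then have "X = Y" using Y(1) finY d X(4) by (intro card_seteq) auto
  then have "B \<subseteq> span X" using Y by blast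
  also have "span X \<subseteq> A" using X A by (simp add: span_minimal)
  finally show ?thesis using AB by blast
qed

text \<open>
  Projection onto \<open>U2\<close> along \<open>W\<close> is an isomorphism from \<open>U1\<close> to \<open>U2\<close>.
\<close>

lemma (in vector_space) dim_complements_eq:
  assumes U1: "subspace U1" "U1 \<subseteq> span F" "finite F" and U2: "subspace U2" and W: "subspace W"
    and int1: "\<And>x. x \<in> U1 \<Longrightarrow> x \<in> W \<Longrightarrow> x = 0" and int2: "\<And>x. x \<in> U2 \<Longrightarrow> x \<in> W \<Longrightarrow> x = 0"
    and ex1: "\<And>x. x \<in> U1 \<Longrightarrow> \<exists>y\<in>U2. x - y \<in> W" and ex2: "\<And>y. y \<in> U2 \<Longrightarrow> \<exists>x\<in>U1. x - y \<in> W"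
  shows "dim U1 = dim U2"
proof -
  define f where "f x = (SOME y. y \<in> U2 \<and> x - y \<in> W)" for x
  have f: "f x \<in> U2" "x - f x \<in> W" if "x \<in> U1" for x
  proof -
    have "\<exists>y. y \<in> U2 \<and> x - y \<in> W" using ex1[OF that] by blast
    from someI_ex[OF this] show "f x \<in> U2" "x - f x \<in> W" unfolding f_def by blast+
  qed
  have uniq: "f x = y" if "x \<in> U1" "y \<in> U2" "x - y \<in> W" for x y
  proof -
    have "(x - y) - (x - f x) \<in> W" by (rule subspace_diff[OF W that(3) f(2)[OF that(1)]])
    then have "f x - y \<in> W" by simp
    moreover have "f x - y \<in> U2" using that f U2 by (intro subspace_diff) auto
    ultimately show ?thesis using int2[of "f x - y"] by simp
  qed
  have add: "f (x + y) = f x + f y" if "x \<in> U1" "y \<in> U1" for x y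
  proof (rule uniq)
    have "(x - f x) + (y - f y) \<in> W" using that f W by (intro subspace_add) auto
    then show "x + y - (f x + f y) \<in> W" by (simp add: algebra_simps)
  qed (use that f U1 U2 in \<open>auto intro: subspace_add\<close>)
  have sc: "f (scale c x) = scale c (f x)" if "x \<in> U1" for c x
  proof (rule uniq)
    have "scale c (x - f x) \<in> W" using that f W by (intro subspace_scale) auto
    then show "scale c x - scale c (f x) \<in> W" by (simp add: scale_right_diff_distrib)
  qed (use that f U1 U2 in \<open>auto intro: subspace_scale\<close>)
  have "f ` U1 = U2"
  proof
    show "f ` U1 \<subseteq> U2" using f by auto
    show "U2 \<subseteq> f ` U1"
    proof
      fix y assume y: "y \<in> U2"
      then obtain x where "x \<in> U1" "x - y \<in> W" using ex2 by blast
      then show "y \<in> f ` U1" using uniq[of x y] y by blast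
    qed
  qed
  moreover have "{x \<in> U1. f x = 0} = {0}"
  proof -
    have "x = 0" if "x \<in> U1" "f x = 0" for x using f(2)[OF that(1)] int1 that by simp
    moreover have "f 0 = 0" using sc[of 0 0] U1 by (simp add: subspace_0)
    ultimately show ?thesis using U1 subspace_0 by blast
  qed
  moreover have "dim {0} = 0" using dim_le_card[of "{0}" "{}"] by simp
  ultimately show ?thesis using dim_image_kernel[OF U1 add sc] by simp
qed

section \<open>Substitutions into polynomials\<close>

lemma mpoly_eq_sum_single: "p = (\<Sum>m\<in>Poly_Mapping.keys p. Poly_Mapping.single m (Poly_Mapping.lookup p m))"
proof (rule poly_mapping_eqI)
  fix m
  show "Poly_Mapping.lookup p m = Poly_Mapping.lookup (\<Sum>m\<in>Poly_Mapping.keys p. Poly_Mapping.single m (Poly_Mapping.lookup p m)) m"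
  proof (cases "m \<in> Poly_Mapping.keys p")
    case True
    then show ?thesis
      by (simp add: lookup_sum lookup_single when_def sum.delta')
  next
    case False
    then show ?thesis
      by (auto simp: lookup_sum lookup_single when_def in_keys_iff)
  qed
qed

text \<open>
  All substitutions below, and the power sums, are linear extensions of functions on monomials; \<open>\<kappa>\<close>
  transports the coefficients.
\<close>

definition lext :: "(rat \<Rightarrow> 'b::comm_ring_1) \<Rightarrow> ('m \<Rightarrow> 'b) \<Rightarrow> ('m \<Rightarrow>\<^sub>0 rat) \<Rightarrow> 'b" where
  "lext \<kappa> f p = (\<Sum>m\<in>Poly_Mapping.keys p. \<kappa> (Poly_Mapping.lookup p m) * f m)"

locale coeff_hom =
  fixes \<kappa> :: "rat \<Rightarrow> 'b::comm_ring_1"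
  assumes zero: "\<kappa> 0 = 0" and one: "\<kappa> 1 = 1"
    and add: "\<kappa> (x + y) = \<kappa> x + \<kappa> y" and mult: "\<kappa> (x * y) = \<kappa> x * \<kappa> y"
begin

lemma lext_superset:
  assumes "finite X" "Poly_Mapping.keys p \<subseteq> X"
  shows "lext \<kappa> f p = (\<Sum>m\<in>X. \<kappa> (Poly_Mapping.lookup p m) * f m)"
  unfolding lext_def using assms
  by (intro sum.mono_neutral_left) (auto simp: in_keys_iff zero)

lemma lext_add: "lext \<kappa> f (p + q) = lext \<kappa> f p + lext \<kappa> f q"
proof -
  let ?X = "Poly_Mapping.keys p \<union> Poly_Mapping.keys q"
  have "lext \<kappa> f r = (\<Sum>m\<in>?X. \<kappa> (Poly_Mapping.lookup r m) * f m)" if "r \<in> {p, q, p + q}" for r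
    using that keys_add[of p q] by (intro lext_superset) auto
  then show ?thesis by (simp add: lookup_add add distrib_right sum.distrib)
qed

lemma lext_zero: "lext \<kappa> f 0 = 0" by (simp add: lext_def)

lemma lext_sum: "lext \<kappa> f (sum g X) = (\<Sum>x\<in>X. lext \<kappa> f (g x))"
  by (induction X rule: infinite_finite_induct) (simp_all add: lext_zero lext_add)

lemma lext_single: "lext \<kappa> f (Poly_Mapping.single m c) = \<kappa> c * f m"
  by (simp add: lext_def zero)

lemma lext_mult:
  assumes f: "\<And>m n. f (m + n) = f m * f n"
  shows "lext \<kappa> f (p * q) = lext \<kappa> f p * lext \<kappa> f q"
proof -
  let ?s = "\<lambda>p m. Poly_Mapping.single m (Poly_Mapping.lookup p m)"
  have "lext \<kappa> f (p * q) = lext \<kappa> f (sum (?s p) (Poly_Mapping.keys p) * sum (?s q) (Poly_Mapping.keys q))"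
    by (simp only: mpoly_eq_sum_single[symmetric])
  also have "\<dots> = (\<Sum>m\<in>Poly_Mapping.keys p. \<Sum>n\<in>Poly_Mapping.keys q.
      \<kappa> (Poly_Mapping.lookup p m * Poly_Mapping.lookup q n) * f (m + n))"
    by (simp only: sum_product lext_sum mult_single lext_single)
  also have "\<dots> = lext \<kappa> f p * lext \<kappa> f q"
    unfolding lext_def sum_product by (intro sum.cong refl) (simp only: f mult mult_ac)
  finally show ?thesis .
qed

end

definition mon :: "('v \<Rightarrow> 'b::comm_ring_1) \<Rightarrow> ('v \<Rightarrow>\<^sub>0 nat) \<Rightarrow> 'b" where
  "mon \<sigma> m = (\<Prod>v\<in>Poly_Mapping.keys m. \<sigma> v ^ Poly_Mapping.lookup m v)"

lemma mon_superset:
  assumes "finite X" "Poly_Mapping.keys m \<subseteq> X"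
  shows "mon \<sigma> m = (\<Prod>v\<in>X. \<sigma> v ^ Poly_Mapping.lookup m v)"
  unfolding mon_def using assms by (intro prod.mono_neutral_left) (auto simp: in_keys_iff)

lemma mon_add: "mon \<sigma> (m + n) = mon \<sigma> m * mon \<sigma> n"
proof -
  let ?X = "Poly_Mapping.keys m \<union> Poly_Mapping.keys n"
  have "mon \<sigma> r = (\<Prod>v\<in>?X. \<sigma> v ^ Poly_Mapping.lookup r v)" if "r \<in> {m, n, m + n}" for r
    using that keys_add[of m n] by (intro mon_superset) auto
  then show ?thesis by (simp add: lookup_add power_add prod.distrib)
qed

text \<open>
  Identities between compositions of substitutions are reduced by \<open>hom_eqI\<close> to constants and variables.
\<close>

definition is_hom :: "('v mpoly \<Rightarrow> 'b::comm_ring_1) \<Rightarrow> bool" where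
  "is_hom \<phi> \<longleftrightarrow> (\<forall>p q. \<phi> (p + q) = \<phi> p + \<phi> q) \<and> (\<forall>p q. \<phi> (p * q) = \<phi> p * \<phi> q) \<and> \<phi> 1 = 1"

context
  fixes \<phi> :: "'v mpoly \<Rightarrow> 'b::comm_ring_1"
  assumes hom: "is_hom \<phi>"
begin

lemma hom_add: "\<phi> (p + q) = \<phi> p + \<phi> q"
  and hom_mult: "\<phi> (p * q) = \<phi> p * \<phi> q"
  and hom_one: "\<phi> 1 = 1"
  using hom by (auto simp: is_hom_def)

lemma hom_zero: "\<phi> 0 = 0" using hom_add[of 0 0] by simp

lemma hom_minus: "\<phi> (- p) = - \<phi> p"
  using hom_add[of p "- p"] by (simp add: hom_zero eq_neg_iff_add_eq_0 add.commute)

lemma hom_diff: "\<phi> (p - q) = \<phi> p - \<phi> q"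
  using hom_add[of p "- q"] by (simp add: hom_minus)

lemma hom_sum: "\<phi> (sum f X) = (\<Sum>x\<in>X. \<phi> (f x))"
  by (induction X rule: infinite_finite_induct) (simp_all add: hom_zero hom_add)

lemma hom_prod: "\<phi> (prod f X) = (\<Prod>x\<in>X. \<phi> (f x))"
  by (induction X rule: infinite_finite_induct) (simp_all add: hom_one hom_mult)

lemma hom_power: "\<phi> (p ^ n) = \<phi> p ^ n"
  by (induction n) (simp_all add: hom_one hom_mult)

lemmas hom_simps = hom_add hom_mult hom_one hom_zero hom_minus hom_diff hom_sum hom_prod hom_power

end

lemma is_hom_compose: "is_hom \<phi> \<Longrightarrow> is_hom (\<lambda>p. \<psi> (\<phi> p))" if "is_hom \<psi>"
  using that by (auto simp: is_hom_def)

lemma Const_0: "Const 0 = 0" and Const_1: "Const 1 = 1"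
  and Const_add: "Const (a + b) = Const a + Const b" and Const_mult: "Const (a * b) = Const a * Const b"
  by (simp_all add: Const_def single_add mult_single)

lemma Const_minus: "Const (- a) = - Const a" and Const_diff: "Const (a - b) = Const a - Const b"
  by (simp_all add: Const_def single_uminus single_diff)

lemma Const_power: "Const (a ^ n) = Const a ^ n"
  by (induction n) (simp_all add: Const_1 Const_mult)

lemma Const_of_nat: "Const (of_nat n) = of_nat n"
  by (induction n) (simp_all add: Const_0 Const_1 Const_add)

lemma single_eq_mon: "Poly_Mapping.single m c = Const c * mon Var m"
proof -
  have Vp: "(Var v :: 'a mpoly) ^ n = Poly_Mapping.single (Poly_Mapping.single v n) 1" for v n
    by (induction n) (simp_all add: Var_def mult_single flip: single_add)
  have "(\<Prod>v\<in>X. (Var v :: 'a mpoly) ^ Poly_Mapping.lookup m v)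
      = Poly_Mapping.single (\<Sum>v\<in>X. Poly_Mapping.single v (Poly_Mapping.lookup m v)) 1" for X
    by (induction X rule: infinite_finite_induct) (simp_all add: Vp mult_single)
  moreover have "(\<Sum>v\<in>Poly_Mapping.keys m. Poly_Mapping.single v (Poly_Mapping.lookup m v)) = m"
    by (rule poly_mapping_eqI) (auto simp: lookup_sum lookup_single when_def in_keys_iff sum.delta' finite_keys)
  ultimately show ?thesis
    by (simp add: mon_def Const_def mult_single)
qed

lemma hom_eqI:
  assumes "is_hom \<phi>" "is_hom \<psi>" "\<And>c. \<phi> (Const c) = \<psi> (Const c)" "\<And>v. \<phi> (Var v) = \<psi> (Var v)"
  shows "\<phi> p = \<psi> p"
proof -
  have "\<phi> (Poly_Mapping.single m c) = \<psi> (Poly_Mapping.single m c)" for m c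
    by (simp add: single_eq_mon mon_def hom_simps[OF assms(1)] hom_simps[OF assms(2)] assms(3,4))
  then show ?thesis
    by (subst (1 2) mpoly_eq_sum_single) (simp add: hom_simps[OF assms(1)] hom_simps[OF assms(2)])
qed

definition subst_with :: "(rat \<Rightarrow> 'b::comm_ring_1) \<Rightarrow> ('v \<Rightarrow> 'b) \<Rightarrow> 'v mpoly \<Rightarrow> 'b" where
  "subst_with \<kappa> \<sigma> = lext \<kappa> (mon \<sigma>)"

lemma (in coeff_hom) subst_Const: "subst_with \<kappa> \<sigma> (Const c) = \<kappa> c"
  by (simp add: Const_def lext_single mon_def subst_with_def)

lemma (in coeff_hom) subst_Var: "subst_with \<kappa> \<sigma> (Var v) = \<sigma> v"
  by (simp add: Var_def lext_single mon_def one subst_with_def)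

lemma (in coeff_hom) is_hom_subst: "is_hom (subst_with \<kappa> \<sigma>)"
  unfolding is_hom_def
proof (intro conjI allI)
  show "subst_with \<kappa> \<sigma> 1 = 1"
    using subst_Const[of \<sigma> 1] by (simp only: Const_1 one)
next
  fix p q
  show "subst_with \<kappa> \<sigma> (p + q) = subst_with \<kappa> \<sigma> p + subst_with \<kappa> \<sigma> q"
    unfolding subst_with_def by (rule lext_add)
  show "subst_with \<kappa> \<sigma> (p * q) = subst_with \<kappa> \<sigma> p * subst_with \<kappa> \<sigma> q"
    unfolding subst_with_def using mon_add by (rule lext_mult)
qed

lemma coeff_hom_Const: "coeff_hom Const"
  by (rule coeff_hom.intro) (rule Const_0 Const_1 Const_add Const_mult)+

lemma coeff_hom_id: "coeff_hom (\<lambda>c. c)"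
  by (rule coeff_hom.intro) (rule refl)+

lemma coeff_hom_poly: "coeff_hom (\<lambda>c. [:Const c:])"
  by (rule coeff_hom.intro) (simp_all add: Const_0 Const_1 Const_add Const_mult one_pCons)

lemma lookup_mscale: "Poly_Mapping.lookup (mscale c p) m = c * Poly_Mapping.lookup p m"
proof -
  have "mscale c p = Poly_Mapping.map ((*) c) p"
    unfolding mscale_def Const_def by (rule mult_map_scale_conv_mult[symmetric])
  moreover have "Poly_Mapping.lookup (Poly_Mapping.map ((*) c) p) m = c * Poly_Mapping.lookup p m"
    unfolding Poly_Mapping.map.rep_eq by (cases "Poly_Mapping.lookup p m = 0") (simp_all only: when_simps simp_thms mult_zero_right not_True_eq_False)
  ultimately show ?thesis by (simp only:)
qed

lemma linear_lext_Const:
  fixes f :: "('a \<Rightarrow>\<^sub>0 nat) \<Rightarrow> 'b mpoly"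
  shows "Vector_Spaces.linear mscale mscale (lext Const f)"
proof -
  have "lext Const f (mscale c p) = mscale c (lext Const f p)" for c p
  proof -
    have "Poly_Mapping.keys (mscale c p) \<subseteq> Poly_Mapping.keys p"
      by (auto simp: in_keys_iff lookup_mscale)
    then have "lext Const f (mscale c p)
        = (\<Sum>m\<in>Poly_Mapping.keys p. Const (Poly_Mapping.lookup (mscale c p) m) * f m)"
      by (intro coeff_hom.lext_superset[OF coeff_hom_Const]) auto
    then show ?thesis
      by (simp only: lookup_mscale Const_mult)
        (simp only: lext_def mscale_def sum_distrib_left mult.assoc)
  qed
  note scale = this
  show ?thesis
    unfolding Vector_Spaces.linear_iff
  proof (intro conjI allI)
    show "vector_space (mscale :: rat \<Rightarrow> 'a mpoly \<Rightarrow> 'a mpoly)"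
      "vector_space (mscale :: rat \<Rightarrow> 'b mpoly \<Rightarrow> 'b mpoly)"
      by (rule mpoly.vector_space_axioms)+
    fix p q c
    show "lext Const f (p + q) = lext Const f p + lext Const f q"
      by (rule coeff_hom.lext_add[OF coeff_hom_Const])
    show "lext Const f (mscale c p) = mscale c (lext Const f p)"
      by (rule scale)
  qed
qed

lemma rename_eq: "rename \<pi> p = subst_with Const (\<lambda>v. Var (\<pi> v)) p"
  unfolding rename_def subst_with_def lext_def mon_def ..

definition eval_at :: "('v \<Rightarrow> rat) \<Rightarrow> 'v mpoly \<Rightarrow> rat" where
  "eval_at \<theta> = subst_with (\<lambda>c. c) \<theta>"

text \<open>
  The substitution of \<open>x\<^sub>v + T\<close> for the variables \<open>x\<^sub>v\<close>, \<open>v \<in> S\<close>, as a polynomial in the new variable \<open>T\<close>.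
\<close>

definition shift :: "'v set \<Rightarrow> 'v mpoly \<Rightarrow> 'v mpoly poly" where
  "shift S = subst_with (\<lambda>c. [:Const c:]) (\<lambda>v. [:Var v, if v \<in> S then 1 else 0:])"

text \<open>
  Restriction to the hyperplane \<open>x\<^sub>u - x\<^sub>v = c\<close>. For an edge from \<open>u\<close> to \<open>v\<close> it is the algebraic
  counterpart of contraction.
\<close>

definition glue :: "'v \<Rightarrow> 'v \<Rightarrow> rat \<Rightarrow> 'v mpoly \<Rightarrow> 'v mpoly" where
  "glue u v c = subst_with Const (\<lambda>w. if w = v then Var u - Const c else Var w)"

lemma is_hom_eval_at: "is_hom (eval_at \<theta>)"
  unfolding eval_at_def by (rule coeff_hom.is_hom_subst[OF coeff_hom_id])

lemma is_hom_shift: "is_hom (shift S)"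
  unfolding shift_def by (rule coeff_hom.is_hom_subst[OF coeff_hom_poly])

lemma is_hom_glue: "is_hom (glue u v c)"
  unfolding glue_def by (rule coeff_hom.is_hom_subst[OF coeff_hom_Const])

lemma is_hom_rename: "is_hom (rename \<pi>)"
proof -
  have "rename \<pi> = subst_with Const (\<lambda>v. Var (\<pi> v))" by (rule ext) (rule rename_eq)
  then show ?thesis by (simp only: coeff_hom.is_hom_subst[OF coeff_hom_Const])
qed

lemma eval_at_Const: "eval_at \<theta> (Const c) = c" and eval_at_Var: "eval_at \<theta> (Var v) = \<theta> v"
  unfolding eval_at_def by (rule coeff_hom.subst_Const[OF coeff_hom_id] coeff_hom.subst_Var[OF coeff_hom_id])+

lemma shift_Const: "shift S (Const c) = [:Const c:]"
  and shift_Var: "shift S (Var v) = [:Var v, if v \<in> S then 1 else 0:]"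
  unfolding shift_def by (rule coeff_hom.subst_Const[OF coeff_hom_poly] coeff_hom.subst_Var[OF coeff_hom_poly])+

lemma glue_Const: "glue u v c (Const d) = Const d"
  and glue_Var: "glue u v c (Var w) = (if w = v then Var u - Const c else Var w)"
  unfolding glue_def by (rule coeff_hom.subst_Const[OF coeff_hom_Const] coeff_hom.subst_Var[OF coeff_hom_Const])+

lemma rename_Const: "rename \<pi> (Const d) = Const d"
  and rename_Var: "rename \<pi> (Var w) = Var (\<pi> w)"
  unfolding rename_eq by (rule coeff_hom.subst_Const[OF coeff_hom_Const] coeff_hom.subst_Var[OF coeff_hom_Const])+

lemmas eval_at_simps = hom_simps[OF is_hom_eval_at] eval_at_Const eval_at_Var
lemmas shift_simps = hom_simps[OF is_hom_shift] shift_Const shift_Var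
lemmas glue_simps = hom_simps[OF is_hom_glue] glue_Const glue_Var
lemmas rename_simps = hom_simps[OF is_hom_rename] rename_Const rename_Var

lemma linear_of_hom:
  fixes \<phi> :: "'a mpoly \<Rightarrow> 'b mpoly"
  assumes "is_hom \<phi>" "\<And>c. \<phi> (Const c) = Const c"
  shows "Vector_Spaces.linear mscale mscale \<phi>"
  unfolding Vector_Spaces.linear_iff
  by (intro conjI allI mpoly.vector_space_axioms) (simp_all add: mscale_def hom_simps[OF assms(1)] assms(2))

lemma linear_glue: "Vector_Spaces.linear mscale mscale (glue u v c)"
  by (rule linear_of_hom[OF is_hom_glue glue_Const])

lemma linear_rename: "Vector_Spaces.linear mscale mscale (rename \<pi>)"
  by (rule linear_of_hom[OF is_hom_rename rename_Const])

lemma linear_times: "Vector_Spaces.linear mscale mscale (\<lambda>p. q * p)"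
  unfolding Vector_Spaces.linear_iff
  by (intro conjI allI mpoly.vector_space_axioms) (simp_all add: mscale_def algebra_simps)

lemma coeff_shift_0: "coeff (shift S p) 0 = p"
proof -
  have "is_hom (\<lambda>p. coeff (shift S p) 0)"
    by (simp add: is_hom_def shift_simps coeff_mult_0)
  then show ?thesis
  proof (rule hom_eqI)
    show "is_hom (\<lambda>p. p :: 'a mpoly)" by (simp add: is_hom_def)
    show "coeff (shift S (Const c)) 0 = Const c" for c by (simp only: shift_Const coeff_pCons_0)
    show "coeff (shift S (Var v)) 0 = Var v" for v by (simp only: shift_Var coeff_pCons_0)
  qed
qed

lemma map_poly_is_hom:
  assumes "is_hom \<phi>"
  shows "map_poly \<phi> (p + q) = map_poly \<phi> p + map_poly \<phi> q"
    and "map_poly \<phi> (p * q) = map_poly \<phi> p * map_poly \<phi> q"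
    and "map_poly \<phi> 1 = 1"
  by (rule poly_eqI; simp add: coeff_map_poly hom_simps[OF assms] coeff_mult)+

lemma shift_glue:
  assumes "v \<notin> S"
  shows "shift S (glue u v c p) = map_poly (glue u v c) (shift (S \<union> (if u \<in> S then {v} else {})) p)"
    (is "_ = map_poly _ (shift ?S p)")
proof (rule hom_eqI)
  show "is_hom (\<lambda>p. shift S (glue u v c p))"
    by (rule is_hom_compose[OF is_hom_shift is_hom_glue])
  show "is_hom (\<lambda>p. map_poly (glue u v c) (shift ?S p))"
    by (simp add: is_hom_def shift_simps map_poly_is_hom[OF is_hom_glue])
  show "shift S (glue u v c (Const d)) = map_poly (glue u v c) (shift ?S (Const d))" for d
    by (rule poly_eqI) (simp add: shift_simps glue_simps coeff_map_poly coeff_pCons split: nat.split)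
  show "shift S (glue u v c (Var w)) = map_poly (glue u v c) (shift ?S (Var w))" for w
    using assms by (intro poly_eqI) (auto simp add: shift_simps glue_simps coeff_map_poly coeff_pCons split: nat.split)
qed

text \<open>
  The factor \<open>a \<plusminus> T\<close> is monic up to sign, so it raises the degree in \<open>T\<close> by exactly one, whatever the
  coefficient ring.
\<close>

lemma coeff_linear_times_zeroD:
  fixes q :: "'a::comm_ring_1 poly"
  assumes e: "e = 1 \<or> e = - 1" and z: "\<And>i. m \<le> i \<Longrightarrow> coeff ([:a, e:] * q) i = 0" and i: "m \<le> Suc i"
  shows "coeff q i = 0"
proof (cases "q = 0")
  case False
  have "coeff ([:a, e:] * q) (Suc (degree q)) = e * lead_coeff q"
    by (simp add: coeff_pCons coeff_eq_0)
  then have "coeff ([:a, e:] * q) (Suc (degree q)) \<noteq> 0"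
    using e False by auto
  then have "Suc (degree q) < m" using z by (meson not_le)
  then show ?thesis using i by (simp add: coeff_eq_0)
qed simp

lemma shift_linear_times:
  "shift S ((Var u - Var v - Const c) * q)
    = [:Var u - Var v - Const c, (if u \<in> S then 1 else 0) - (if v \<in> S then 1 else 0):] * shift S q"
  by (simp add: shift_simps)

text \<open>
  Shifting \<open>x\<^sub>u\<close> turns \<open>x\<^sub>u - x\<^sub>v - c\<close> into a monic polynomial in \<open>T\<close>, hence into a nonzerodivisor.
\<close>

lemma linear_form_cancel:
  assumes "u \<noteq> v" "(Var u - Var v - Const c) * q = 0"
  shows "q = 0"
proof -
  have "[:Var u - Var v - Const c, (if u \<in> {u} then 1 else 0) - (if v \<in> {u} then 1 else 0):] * shift {u} q = 0"
    unfolding shift_linear_times[symmetric] assms(2) by (rule hom_zero[OF is_hom_shift])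
  moreover have "v \<notin> {u}" using assms(1) by blast
  ultimately have "[:Var u - Var v - Const c, 1:] * shift {u} q = 0"
    by (simp only: singletonI if_True if_False diff_zero)
  note z = this
  have "coeff (shift {u} q) 0 = 0"
  proof (rule coeff_linear_times_zeroD)
    show "coeff ([:Var u - Var v - Const c, 1:] * shift {u} q) i = 0" for i
      unfolding z by (rule coeff_0)
  qed auto
  then show ?thesis by (simp only: coeff_shift_0)
qed

section \<open>Polynomials in the differences of the variables\<close>

abbreviation diffalg :: "'v set \<Rightarrow> 'v mpoly set" where
  "diffalg V \<equiv> subalgebra_gen {Var v - Var u | u v. u \<in> V \<and> v \<in> V}"

lemma diffalg_Var_diff: "u \<in> V \<Longrightarrow> v \<in> V \<Longrightarrow> Var v - Var u \<in> diffalg V"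
  by (rule subalgebra_gen.gen) blast

lemma diffalg_0: "0 \<in> diffalg V" and diffalg_1: "1 \<in> diffalg V"
  using subalgebra_gen.const[of 0] subalgebra_gen.const[of 1] by (simp_all add: Const_0 Const_1)

lemma diffalg_scale: "p \<in> diffalg V \<Longrightarrow> mscale c p \<in> diffalg V"
  by (simp add: mscale_def subalgebra_gen.const subalgebra_gen.mult)

lemma diffalg_subspace: "mpoly.subspace (diffalg V)"
  by (simp add: mpoly.subspace_def diffalg_0 diffalg_scale subalgebra_gen.add)

lemma diffalg_prod: "(\<And>x. x \<in> X \<Longrightarrow> f x \<in> diffalg V) \<Longrightarrow> prod f X \<in> diffalg V"
  by (induction X rule: infinite_finite_induct) (simp_all add: diffalg_1 subalgebra_gen.mult)

lemma diffalg_power: "p \<in> diffalg V \<Longrightarrow> p ^ n \<in> diffalg V"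
  by (induction n) (simp_all add: diffalg_1 subalgebra_gen.mult)

lemma diffalg_diff: "p \<in> diffalg V \<Longrightarrow> q \<in> diffalg V \<Longrightarrow> p - q \<in> diffalg V"
  by (rule mpoly.subspace_diff[OF diffalg_subspace])

lemma diffalg_glue:
  assumes "f \<in> diffalg V" "u \<in> V" "u \<noteq> v"
  shows "glue u v c f \<in> diffalg (V - {v})"
  using assms(1)
proof (induction rule: subalgebra_gen.induct)
  case (gen p)
  then obtain a b where ab: "p = Var b - Var a" "a \<in> V" "b \<in> V" by blast
  have D: "Var y - Var x \<in> diffalg (V - {v})" if "x \<in> V - {v}" "y \<in> V - {v}" for x y
    using that by (rule diffalg_Var_diff)
  have g: "glue u v c p = (if b = v then Var u - Const c else Var b) - (if a = v then Var u - Const c else Var a)"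
    unfolding ab(1) by (simp only: glue_simps)
  consider "a = v" "b = v" | "a = v" "b \<noteq> v" | "a \<noteq> v" "b = v" | "a \<noteq> v" "b \<noteq> v" by blast
  then show ?case
  proof cases
    case 1
    then have "glue u v c p = 0" by (simp add: g)
    then show ?thesis by (simp only: diffalg_0)
  next
    case 2
    then have "glue u v c p = (Var b - Var u) + Const c" by (simp add: g)
    then show ?thesis
      using ab 2 assms by (simp only:) (intro subalgebra_gen.add subalgebra_gen.const D; simp)
  next
    case 3
    then have "glue u v c p = (Var u - Var a) + Const (- c)" by (simp add: g Const_minus)
    then show ?thesis
      using ab 3 assms by (simp only:) (intro subalgebra_gen.add subalgebra_gen.const D; simp)
  next
    case 4
    then have "glue u v c p = Var b - Var a" by (simp add: g)
    then show ?thesis using ab 4 by (simp only:) (intro D; simp)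
  qed
next
  case (const d)
  show ?case by (simp only: glue_simps subalgebra_gen.const)
next
  case (add p q)
  then show ?case by (simp only: glue_simps subalgebra_gen.add)
next
  case (mult p q)
  then show ?case by (simp only: glue_simps subalgebra_gen.mult)
qed

lemma diffalg_mono: "V \<subseteq> W \<Longrightarrow> diffalg V \<subseteq> diffalg W"
proof
  fix p assume "V \<subseteq> W" "p \<in> diffalg V"
  from this(2) show "p \<in> diffalg W"
    by (induction rule: subalgebra_gen.induct)
      (use \<open>V \<subseteq> W\<close> in \<open>auto intro: subalgebra_gen.intros\<close>)
qed

text \<open>
  The factor theorem for the hyperplane \<open>x\<^sub>u - x\<^sub>v = c\<close>; the quotient is again a polynomial in
  differences.
\<close>

lemma diffalg_factor:
  assumes "f \<in> diffalg V" "u \<in> V" "v \<in> V" "u \<noteq> v"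
  shows "\<exists>q\<in>diffalg V. f - glue u v c f = (Var u - Var v - Const c) * q"
  using assms(1)
proof (induction rule: subalgebra_gen.induct)
  case (gen p)
  then obtain a b where ab: "p = Var b - Var a" "a \<in> V" "b \<in> V" by blast
  have "p - glue u v c p = (Var u - Var v - Const c) * ((if a = v then 1 else 0) - (if b = v then 1 else 0))"
    unfolding ab(1) by (simp add: glue_simps algebra_simps)
  moreover have "(if a = v then 1 else 0) - (if b = v then 1 else 0) \<in> diffalg V"
    by (intro diffalg_diff) (simp_all add: diffalg_0 diffalg_1)
  ultimately show ?case by blast
next
  case (const d)
  then show ?case by (intro bexI[of _ 0]) (simp_all add: glue_simps diffalg_0)
next
  case (add p q)
  then obtain a b where ab: "a \<in> diffalg V" "b \<in> diffalg V"
    "p - glue u v c p = (Var u - Var v - Const c) * a" "q - glue u v c q = (Var u - Var v - Const c) * b" by blast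
  have "p + q - glue u v c (p + q) = (p - glue u v c p) + (q - glue u v c q)"
    by (simp add: glue_simps)
  also have "\<dots> = (Var u - Var v - Const c) * (a + b)"
    by (simp only: ab distrib_left)
  finally show ?case using ab by (intro bexI[of _ "a + b"] subalgebra_gen.add)
next
  case (mult p q)
  then obtain a b where ab: "a \<in> diffalg V" "b \<in> diffalg V"
    "p - glue u v c p = (Var u - Var v - Const c) * a" "q - glue u v c q = (Var u - Var v - Const c) * b" by blast
  have "p * q - glue u v c (p * q) = (p - glue u v c p) * q + glue u v c p * (q - glue u v c q)"
    by (simp add: glue_simps algebra_simps)
  also have "\<dots> = (Var u - Var v - Const c) * (a * q + glue u v c p * b)"
    by (simp only: ab) (simp add: algebra_simps)
  finally have "p * q - glue u v c (p * q) = (Var u - Var v - Const c) * (a * q + glue u v c p * b)" .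
  moreover have "glue u v c p \<in> diffalg V"
    using diffalg_glue[OF mult(1) assms(2,4)] diffalg_mono[of "V - {v}" V] by blast
  ultimately show ?case
    using ab mult by (intro bexI[of _ "a * q + glue u v c p * b"]) (auto intro: subalgebra_gen.intros)
qed

lemma diffalg_singleton: "p \<in> diffalg {r} \<Longrightarrow> \<exists>c. p = Const c"
proof (induction rule: subalgebra_gen.induct)
  case (gen p) then show ?case by (intro exI[of _ 0]) (auto simp: Const_0)
qed (auto simp flip: Const_add Const_mult)

text \<open>
  The products of differences are homogeneous and span the algebra, which gives \<open>diffalg\<close> and the cut
  ideal their gradings.
\<close>

inductive_set dprods :: "'v set \<Rightarrow> 'v mpoly set" for V where
  one: "1 \<in> dprods V"
| times: "q \<in> dprods V \<Longrightarrow> u \<in> V \<Longrightarrow> v \<in> V \<Longrightarrow> (Var v - Var u) * q \<in> dprods V"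

lemma dprods_mult: "p \<in> dprods V \<Longrightarrow> q \<in> dprods V \<Longrightarrow> p * q \<in> dprods V"
  by (induction rule: dprods.induct) (simp_all add: mult.assoc dprods.times)

lemma dprods_mono: "p \<in> dprods V \<Longrightarrow> V \<subseteq> W \<Longrightarrow> p \<in> dprods W"
  by (induction rule: dprods.induct) (auto intro: dprods.intros)

lemma dprods_subset_diffalg: "dprods V \<subseteq> diffalg V"
proof
  fix p assume "p \<in> dprods V"
  then show "p \<in> diffalg V"
    by (induction rule: dprods.induct) (auto intro: diffalg_1 diffalg_Var_diff subalgebra_gen.mult)
qed

text \<open>
  Bilinearity reduces a product of spans to products of generators.
\<close>

lemma span_mult_closed:
  assumes "\<And>a b. a \<in> A \<Longrightarrow> b \<in> B \<Longrightarrow> a * b \<in> C" "p \<in> mpoly.span A" "q \<in> mpoly.span B"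
  shows "p * q \<in> mpoly.span C"
proof -
  have 1: "a * q \<in> mpoly.span C" if "a \<in> A" for a
    using assms(3)
  proof (induction rule: mpoly.span_induct_alt)
    case base then show ?case by (simp add: mpoly.span_zero)
  next
    case (step c b y)
    have "a * (mscale c b + y) = mscale c (a * b) + a * y"
      by (simp add: mscale_def algebra_simps)
    moreover have "a * b \<in> mpoly.span C" using assms(1)[OF that step(1)] by (rule mpoly.span_base)
    ultimately show ?case using step by (simp add: mpoly.span_add mpoly.span_scale)
  qed
  have "q * p \<in> mpoly.span C"
    using assms(2)
  proof (induction rule: mpoly.span_induct_alt)
    case base then show ?case by (simp add: mpoly.span_zero)
  next
    case (step c a y)
    have "q * (mscale c a + y) = mscale c (a * q) + q * y"
      by (simp add: mscale_def algebra_simps)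
    then show ?case using step 1[of a] by (simp add: mpoly.span_add mpoly.span_scale)
  qed
  then show ?thesis by (simp add: mult.commute)
qed

lemma diffalg_eq_span: "diffalg V = mpoly.span (dprods V)"
proof
  show "mpoly.span (dprods V) \<subseteq> diffalg V"
    by (rule mpoly.span_minimal[OF dprods_subset_diffalg diffalg_subspace])
  show "diffalg V \<subseteq> mpoly.span (dprods V)"
  proof
    fix p assume "p \<in> diffalg V"
    then show "p \<in> mpoly.span (dprods V)"
    proof (induction rule: subalgebra_gen.induct)
      case (gen p)
      then obtain u v where "p = (Var v - Var u) * 1" "u \<in> V" "v \<in> V" by auto
      then show ?case using dprods.times[OF dprods.one] by (metis mpoly.span_base)
    next
      case (const c)
      have "Const c = mscale c 1" by (simp add: mscale_def)
      then show ?case by (metis dprods.one mpoly.span_base mpoly.span_scale)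
    next
      case (add p q) then show ?case by (simp add: mpoly.span_add)
    next
      case (mult p q) then show ?case using span_mult_closed[OF dprods_mult] by blast
    qed
  qed
qed

section \<open>Cuts, deletion and contraction\<close>

definition crosses :: "('e \<Rightarrow> 'v) \<Rightarrow> ('e \<Rightarrow> 'v) \<Rightarrow> 'v set \<Rightarrow> 'e \<Rightarrow> bool" where
  "crosses t h S e \<longleftrightarrow> (t e \<in> S) \<noteq> (h e \<in> S)"

definition cut_edges :: "'e set \<Rightarrow> ('e \<Rightarrow> 'v) \<Rightarrow> ('e \<Rightarrow> 'v) \<Rightarrow> 'v set \<Rightarrow> 'e set" where
  "cut_edges E t h S = {e \<in> E. crosses t h S e}"

definition proper :: "'v set \<Rightarrow> 'v set \<Rightarrow> bool" where
  "proper V S \<longleftrightarrow> S \<subseteq> V \<and> S \<noteq> {} \<and> S \<noteq> V"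

text \<open>
  Connectedness is expressed by cuts: this form passes to contractions at once, and it is what slim
  sets, cut products and generic points have in common. Only the set \<open>V\<close> of vertices and the set \<open>E\<close> of
  edges change under deletion, and contraction changes in addition the two end maps.
\<close>

definition conn :: "'v set \<Rightarrow> 'e set \<Rightarrow> ('e \<Rightarrow> 'v) \<Rightarrow> ('e \<Rightarrow> 'v) \<Rightarrow> bool" where
  "conn V E t h \<longleftrightarrow> V \<noteq> {} \<and> (\<forall>S. proper V S \<longrightarrow> cut_edges E t h S \<noteq> {})"

definition multigraph :: "'v set \<Rightarrow> 'e set \<Rightarrow> ('e \<Rightarrow> 'v) \<Rightarrow> ('e \<Rightarrow> 'v) \<Rightarrow> bool" where
  "multigraph V E t h \<longleftrightarrow> finite V \<and> finite E \<and> (\<forall>e\<in>E. t e \<in> V \<and> h e \<in> V)"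

definition merge_ends :: "'v \<Rightarrow> 'v \<Rightarrow> ('e \<Rightarrow> 'v) \<Rightarrow> 'e \<Rightarrow> 'v" where
  "merge_ends u v f e = (if f e = v then u else f e)"

lemma conn_mono: "conn V E t h \<Longrightarrow> E \<subseteq> F \<Longrightarrow> conn V F t h"
  by (fastforce simp: conn_def cut_edges_def)

text \<open>
  A set of vertices of the contracted graph corresponds to a set that contains both ends of the
  contracted edge or neither, and the same edges cross it.
\<close>

lemma crosses_merge:
  assumes "u \<noteq> v" "v \<notin> S"
  shows "crosses (merge_ends u v t) (merge_ends u v h) S e
    \<longleftrightarrow> crosses t h (S \<union> (if u \<in> S then {v} else {})) e"
  using assms by (auto simp: crosses_def merge_ends_def)

lemma cut_merge:
  assumes "u \<noteq> v" "v \<notin> S"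
  shows "cut_edges E (merge_ends u v t) (merge_ends u v h) S = cut_edges E t h (S \<union> (if u \<in> S then {v} else {}))"
  unfolding cut_edges_def crosses_merge[OF assms] ..

lemma proper_merge:
  assumes "u \<in> V" "v \<in> V" "u \<noteq> v" "proper (V - {v}) S"
  shows "proper V (S \<union> (if u \<in> S then {v} else {}))"
  using assms by (auto simp: proper_def split: if_splits)

lemma conn_contract:
  assumes e: "t e \<in> V" "h e \<in> V" "t e \<noteq> h e"
  shows "conn (V - {h e}) F (merge_ends (t e) (h e) t) (merge_ends (t e) (h e) h) \<longleftrightarrow> conn V (insert e F) t h"
proof
  assume c: "conn (V - {h e}) F (merge_ends (t e) (h e) t) (merge_ends (t e) (h e) h)"
  have "cut_edges (insert e F) t h T \<noteq> {}" if T: "proper V T" for T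
  proof (cases "crosses t h T e")
    case True then show ?thesis by (auto simp: cut_edges_def)
  next
    case False
    let ?S = "T - {h e}"
    have "proper (V - {h e}) ?S"
      using T False e by (auto simp: proper_def crosses_def)
    then have "cut_edges F (merge_ends (t e) (h e) t) (merge_ends (t e) (h e) h) ?S \<noteq> {}"
      using c by (auto simp: conn_def)
    moreover have "?S \<union> (if t e \<in> ?S then {h e} else {}) = T"
      using False e by (auto simp: crosses_def)
    ultimately show ?thesis using cut_merge[OF e(3), of ?S F t h] by (auto simp: cut_edges_def)
  qed
  then show "conn V (insert e F) t h" using e by (auto simp: conn_def)
next
  assume c: "conn V (insert e F) t h"
  have "cut_edges F (merge_ends (t e) (h e) t) (merge_ends (t e) (h e) h) S \<noteq> {}" if S: "proper (V - {h e}) S" for S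
  proof -
    let ?S = "S \<union> (if t e \<in> S then {h e} else {})"
    have "cut_edges (insert e F) t h ?S \<noteq> {}"
      using c proper_merge[OF e S] by (auto simp: conn_def)
    moreover have "\<not> crosses t h ?S e" using S e by (auto simp: crosses_def proper_def)
    ultimately show ?thesis
      using cut_merge[OF e(3), of S F t h] S by (auto simp: cut_edges_def proper_def)
  qed
  then show "conn (V - {h e}) F (merge_ends (t e) (h e) t) (merge_ends (t e) (h e) h)"
    using e by (auto simp: conn_def)
qed

lemma multigraph_contract:
  assumes "multigraph V E t h" "e \<in> E" "t e \<noteq> h e"
  shows "multigraph (V - {h e}) (E - {e}) (merge_ends (t e) (h e) t) (merge_ends (t e) (h e) h)"
  using assms by (auto simp: multigraph_def merge_ends_def)

lemma multigraph_delete: "multigraph V E t h \<Longrightarrow> multigraph V (E - F) t h"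
  by (auto simp: multigraph_def)

text \<open>
  The induction that drives most of the proof. If \<open>V\<close> has more than one vertex, connectedness yields an
  edge \<open>e\<close> that is not a loop. Contracting it preserves connectedness, deleting it need not. Loops may
  arise, but they never have to be removed, as the induction ends at graphs with one vertex.
\<close>

lemma deletion_contraction_induct [consumes 2, case_names single edge]:
  assumes "multigraph V E t h" "conn V E t h"
    and base: "\<And>r E t h. multigraph {r} E t h \<Longrightarrow> P {r} E t h"
    and step: "\<And>V E t h e. multigraph V E t h \<Longrightarrow> conn V E t h \<Longrightarrow> e \<in> E
      \<Longrightarrow> t e \<in> V \<Longrightarrow> h e \<in> V \<Longrightarrow> t e \<noteq> h e
      \<Longrightarrow> multigraph (V - {h e}) (E - {e}) (merge_ends (t e) (h e) t) (merge_ends (t e) (h e) h)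
      \<Longrightarrow> conn (V - {h e}) (E - {e}) (merge_ends (t e) (h e) t) (merge_ends (t e) (h e) h)
      \<Longrightarrow> (conn V (E - {e}) t h \<Longrightarrow> P V (E - {e}) t h)
      \<Longrightarrow> P (V - {h e}) (E - {e}) (merge_ends (t e) (h e) t) (merge_ends (t e) (h e) h)
      \<Longrightarrow> P V E t h"
  shows "P V E t h"
  using assms(1,2)
proof (induction "card E" arbitrary: V E t h rule: less_induct)
  case less
  obtain r where r: "r \<in> V" using less.prems by (auto simp: conn_def)
  show ?case
  proof (cases "V = {r}")
    case True then show ?thesis using base less.prems by simp
  next
    case False
    then have "proper V {r}" using r by (auto simp: proper_def)
    then obtain e where e: "e \<in> E" "crosses t h {r} e"
      using less.prems by (auto simp: conn_def cut_edges_def)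
    then have ne: "t e \<noteq> h e" by (auto simp: crosses_def)
    have ends: "t e \<in> V" "h e \<in> V" using less.prems e by (auto simp: multigraph_def)
    have fin: "finite E" using less.prems by (simp add: multigraph_def)
    have card: "card (E - {e}) < card E" by (rule card_Diff1_less[OF fin e(1)])
    have mc: "multigraph (V - {h e}) (E - {e}) (merge_ends (t e) (h e) t) (merge_ends (t e) (h e) h)"
      by (rule multigraph_contract[where t = t and h = h and e = e, OF less.prems(1) e(1) ne])
    have cc: "conn (V - {h e}) (E - {e}) (merge_ends (t e) (h e) t) (merge_ends (t e) (h e) h)"
      using conn_contract[where t = t and h = h and e = e, OF ends ne, of "E - {e}"] less.prems e by (simp add: insert_absorb)
    show ?thesis
      using less.hyps[OF card] less.prems mc cc e(1)
      by (intro step[OF less.prems e(1) ends ne mc cc]) (auto intro: multigraph_delete)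
  qed
qed

section \<open>The slim space and the cut ideal\<close>

abbreviation edge_form :: "('e \<Rightarrow> 'v) \<Rightarrow> ('e \<Rightarrow> 'v) \<Rightarrow> 'e \<Rightarrow> 'v mpoly" where
  "edge_form t h e \<equiv> Var (t e) - Var (h e)"

definition eprod :: "('e \<Rightarrow> 'v) \<Rightarrow> ('e \<Rightarrow> 'v) \<Rightarrow> 'e set \<Rightarrow> 'v mpoly" where
  "eprod t h Y = (\<Prod>e\<in>Y. edge_form t h e)"

definition slims :: "'v set \<Rightarrow> 'e set \<Rightarrow> ('e \<Rightarrow> 'v) \<Rightarrow> ('e \<Rightarrow> 'v) \<Rightarrow> 'v mpoly set" where
  "slims V E t h = mpoly.span {eprod t h Y | Y. Y \<subseteq> E \<and> conn V (E - Y) t h}"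

definition cutgens :: "'v set \<Rightarrow> 'e set \<Rightarrow> ('e \<Rightarrow> 'v) \<Rightarrow> ('e \<Rightarrow> 'v) \<Rightarrow> 'v mpoly set" where
  "cutgens V E t h = {q * eprod t h (cut_edges E t h S) | q S. q \<in> dprods V \<and> proper V S}"

definition cutideal :: "'v set \<Rightarrow> 'e set \<Rightarrow> ('e \<Rightarrow> 'v) \<Rightarrow> ('e \<Rightarrow> 'v) \<Rightarrow> 'v mpoly set" where
  "cutideal V E t h = mpoly.span (cutgens V E t h)"

text \<open>
  The coefficients of \<open>shift S p\<close> are, up to factorials, the iterated derivatives of \<open>p\<close> in direction
  \<open>S\<close>. So this is the space of polynomials killed by the power ideal of Postnikov and Shapiro, read as
  an ideal of differential operators.
\<close>

definition cutker :: "'v set \<Rightarrow> 'e set \<Rightarrow> ('e \<Rightarrow> 'v) \<Rightarrow> ('e \<Rightarrow> 'v) \<Rightarrow> 'v mpoly set" where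
  "cutker V E t h = {p \<in> diffalg V. \<forall>S. proper V S \<longrightarrow> (\<forall>i\<ge>card (cut_edges E t h S). coeff (shift S p) i = 0)}"

lemma cutker_subspace: "mpoly.subspace (cutker V E t h)"
  using diffalg_subspace[of V]
  by (auto simp: cutker_def mpoly.subspace_def shift_simps mscale_def)

lemma eprod_glue:
  "glue u v 0 (eprod t h Y) = eprod (merge_ends u v t) (merge_ends u v h) Y"
  by (simp add: eprod_def glue_simps merge_ends_def Const_0 if_distrib cong: if_cong)

lemma eprod_diffalg: "\<forall>e\<in>Y. t e \<in> V \<and> h e \<in> V \<Longrightarrow> eprod t h Y \<in> diffalg V"
  unfolding eprod_def by (intro diffalg_prod diffalg_Var_diff) auto

text \<open>
  Only edges that leave \<open>S\<close> contribute to the degree in direction \<open>S\<close>, and a slim set misses at least one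
  of them.
\<close>

lemma slims_subset_cutker:
  assumes "multigraph V E t h"
  shows "slims V E t h \<subseteq> cutker V E t h"
  unfolding slims_def
proof (rule mpoly.span_minimal[OF _ cutker_subspace], clarify)
  fix Y assume Y: "Y \<subseteq> E" "conn V (E - Y) t h"
  have fin: "finite Y" using assms Y by (auto simp: multigraph_def intro: finite_subset)
  have "coeff (shift S (eprod t h Y)) i = 0" if S: "proper V S" and i: "card (cut_edges E t h S) \<le> i" for S i
  proof -
    have "degree (shift S (eprod t h Y)) \<le> (\<Sum>e\<in>Y. degree (shift S (edge_form t h e)))"
      unfolding eprod_def shift_simps(8) using degree_prod_sum_le[OF fin, of "\<lambda>e. shift S (edge_form t h e)"]
      by (simp add: o_def)
    also have "\<dots> \<le> (\<Sum>e\<in>Y. if crosses t h S e then 1 else 0)"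
      by (intro sum_mono) (auto simp: shift_simps crosses_def)
    also have "\<dots> = card (cut_edges Y t h S)"
      using fin by (simp add: cut_edges_def sum.If_cases Int_def)
    also have "\<dots> < card (cut_edges E t h S)"
    proof (rule psubset_card_mono)
      show "finite (cut_edges E t h S)" using assms by (simp add: multigraph_def cut_edges_def)
      have "cut_edges (E - Y) t h S \<noteq> {}" using Y S by (auto simp: conn_def)
      then show "cut_edges Y t h S \<subset> cut_edges E t h S" using Y by (auto simp: cut_edges_def)
    qed
    finally show ?thesis using i by (simp add: coeff_eq_0)
  qed
  moreover have "eprod t h Y \<in> diffalg V" using assms Y by (intro eprod_diffalg) (auto simp: multigraph_def)
  ultimately show "eprod t h Y \<in> cutker V E t h" by (simp add: cutker_def)
qed

lemma glue_cutker:
  assumes "p \<in> cutker V E t h" "e \<in> E" and e: "t e \<in> V" "h e \<in> V" "t e \<noteq> h e"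
  shows "glue (t e) (h e) c p \<in> cutker (V - {h e}) (E - {e}) (merge_ends (t e) (h e) t) (merge_ends (t e) (h e) h)"
proof -
  have "coeff (shift S (glue (t e) (h e) c p)) i = 0"
    if S: "proper (V - {h e}) S" and i: "card (cut_edges (E - {e}) (merge_ends (t e) (h e) t) (merge_ends (t e) (h e) h) S) \<le> i" for S i
  proof -
    let ?S = "S \<union> (if t e \<in> S then {h e} else {})"
    have nS: "h e \<notin> S" using S by (auto simp: proper_def)
    have "cut_edges (E - {e}) (merge_ends (t e) (h e) t) (merge_ends (t e) (h e) h) S = cut_edges E t h ?S"
      using cut_merge[OF e(3) nS, of "E - {e}" t h] nS by (auto simp: cut_edges_def crosses_def)
    then have "coeff (shift ?S p) i = 0"
      using assms(1) proper_merge[OF e S] i by (simp add: cutker_def)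
    then show ?thesis
      by (simp add: shift_glue[OF nS] coeff_map_poly glue_simps)
  qed
  moreover have "glue (t e) (h e) c p \<in> diffalg (V - {h e})"
    using assms by (intro diffalg_glue) (auto simp: cutker_def)
  ultimately show ?thesis by (simp add: cutker_def)
qed

text \<open>
  The kernel of the restriction to \<open>x\<^sub>u - x\<^sub>v = c\<close>. Dividing by the linear form lowers the degree in
  direction \<open>S\<close> by one if \<open>e\<close> leaves \<open>S\<close>, and not at all otherwise; the size of the cut behaves in the
  same way when \<open>e\<close> is deleted.
\<close>

lemma cutker_factor:
  assumes p: "p \<in> cutker V E t h" and g0: "glue (t e) (h e) c p = 0"
    and E: "finite E" "e \<in> E" and e: "t e \<in> V" "h e \<in> V" "t e \<noteq> h e"
  obtains q where "p = (edge_form t h e - Const c) * q" "q \<in> cutker V (E - {e}) t h"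
proof -
  obtain q where q: "q \<in> diffalg V" "p = (edge_form t h e - Const c) * q"
    using diffalg_factor[of p V "t e" "h e" c] p e g0 by (auto simp: cutker_def)
  have "coeff (shift S q) i = 0" if S: "proper V S" and i: "card (cut_edges (E - {e}) t h S) \<le> i" for S i
  proof -
    have z: "coeff (shift S p) j = 0" if "card (cut_edges E t h S) \<le> j" for j
      using p S that by (simp add: cutker_def)
    show ?thesis
    proof (cases "crosses t h S e")
      case True
      have "cut_edges E t h S = insert e (cut_edges (E - {e}) t h S)" using True E by (auto simp: cut_edges_def)
      then have card: "card (cut_edges E t h S) = Suc (card (cut_edges (E - {e}) t h S))"
        using E by (simp add: cut_edges_def)
      let ?d = "(if t e \<in> S then 1 else 0) - (if h e \<in> S then 1 else 0) :: 'a mpoly"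
      show ?thesis
      proof (rule coeff_linear_times_zeroD[of ?d "card (cut_edges E t h S)" "edge_form t h e - Const c"])
        show "?d = 1 \<or> ?d = - 1" using True by (auto simp: crosses_def)
        show "coeff ([:edge_form t h e - Const c, ?d:] * shift S q) j = 0" if "card (cut_edges E t h S) \<le> j" for j
          using z[OF that] unfolding q(2) shift_linear_times .
      qed (use i card in simp)
    next
      case False
      have "cut_edges E t h S = cut_edges (E - {e}) t h S" using False by (auto simp: cut_edges_def)
      then have "coeff (shift S p) i = 0" using z i by simp
      moreover have "shift S p = [:edge_form t h e - Const c:] * shift S q"
        unfolding q(2) shift_linear_times using False by (simp add: crosses_def)
      ultimately have "(edge_form t h e - Const c) * coeff (shift S q) i = 0" by simp
      then show ?thesis using linear_form_cancel[OF e(3)] by blast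
    qed
  qed
  then show ?thesis using q that by (simp add: cutker_def)
qed

text \<open>
  An empty cut bounds the degree by a negative number. Applied to the graph without \<open>e\<close>, this settles
  the case in which \<open>e\<close> is a bridge.
\<close>

lemma cutker_disconnected:
  assumes "\<not> conn V E t h" "V \<noteq> {}" "q \<in> cutker V E t h"
  shows "q = 0"
proof -
  obtain S where S: "proper V S" "cut_edges E t h S = {}" using assms by (auto simp: conn_def)
  then have "coeff (shift S q) 0 = 0" using assms(3) by (simp add: cutker_def)
  then show ?thesis by (simp add: coeff_shift_0)
qed

lemma slims_contract:
  assumes "e \<in> E" and e: "t e \<in> V" "h e \<in> V" "t e \<noteq> h e"
  shows "slims (V - {h e}) (E - {e}) (merge_ends (t e) (h e) t) (merge_ends (t e) (h e) h)
    \<subseteq> glue (t e) (h e) 0 ` slims V E t h"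
proof -
  interpret g: Vector_Spaces.linear mscale mscale "glue (t e) (h e) 0" by (rule linear_glue)
  show ?thesis
    unfolding slims_def g.span_image[symmetric]
  proof (rule mpoly.span_mono, clarify)
    fix Y assume Y: "Y \<subseteq> E - {e}" "conn (V - {h e}) (E - {e} - Y) (merge_ends (t e) (h e) t) (merge_ends (t e) (h e) h)"
    have "insert e (E - {e} - Y) = E - Y" using Y assms by auto
    then have "conn V (E - Y) t h" using Y conn_contract[where t = t and h = h and e = e, OF e, of "E - {e} - Y"] by simp
    then show "eprod (merge_ends (t e) (h e) t) (merge_ends (t e) (h e) h) Y
      \<in> glue (t e) (h e) 0 ` {eprod t h Y | Y. Y \<subseteq> E \<and> conn V (E - Y) t h}"
      unfolding eprod_glue[symmetric] using Y by (intro imageI) auto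
  qed
qed

lemma slims_delete:
  assumes "finite E" "e \<in> E" "q \<in> slims V (E - {e}) t h"
  shows "edge_form t h e * q \<in> slims V E t h"
proof -
  interpret g: Vector_Spaces.linear mscale mscale "\<lambda>p. edge_form t h e * p" by (rule linear_times)
  have "(\<lambda>p. edge_form t h e * p) ` slims V (E - {e}) t h \<subseteq> slims V E t h"
    unfolding slims_def g.span_image[symmetric]
  proof (rule mpoly.span_mono, clarify)
    fix Y assume Y: "Y \<subseteq> E - {e}" "conn V (E - {e} - Y) t h"
    then have "finite Y" "e \<notin> Y" using assms finite_subset by auto
    then have "edge_form t h e * eprod t h Y = eprod t h (insert e Y)" by (simp add: eprod_def)
    moreover have "E - {e} - Y = E - insert e Y" by auto
    ultimately show "\<exists>Y'. edge_form t h e * eprod t h Y = eprod t h Y' \<and> Y' \<subseteq> E \<and> conn V (E - Y') t h"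
      using Y assms by (intro exI[of _ "insert e Y"]) auto
  qed
  then show ?thesis using assms by auto
qed

text \<open>
  For \<open>f\<close> in \<open>cutker\<close> the restriction to \<open>x\<^sub>u = x\<^sub>v\<close> is in the slim space of the contraction, hence
  lifts to some \<open>p\<close> in the slim space of the graph. By \<open>cutker_factor\<close> the difference \<open>f - p\<close> is
  \<open>x\<^sub>e\<close> times an element that belongs to the graph without \<open>e\<close>.
\<close>

theorem slims_eq_cutker:
  assumes "multigraph V E t h" "conn V E t h"
  shows "slims V E t h = cutker V E t h"
proof (rule antisym[OF slims_subset_cutker[OF assms(1)]])
  show "cutker V E t h \<subseteq> slims V E t h"
    using assms
  proof (induction rule: deletion_contraction_induct)
    case (single r E t h)
    show ?case
    proof
      fix p assume "p \<in> cutker {r} E t h"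
      then have "p \<in> diffalg {r}" by (simp only: cutker_def mem_Collect_eq)
      from diffalg_singleton[OF this] obtain c where c: "p = Const c" ..
      have "conn {r} (E - {}) t h" by (auto simp: conn_def proper_def)
      then have "eprod t h {} \<in> slims {r} E t h"
        unfolding slims_def by (intro mpoly.span_base) blast
      then have "mscale c (eprod t h {}) \<in> slims {r} E t h"
        unfolding slims_def by (rule mpoly.span_scale)
      moreover have "mscale c (eprod t h {}) = p"
        by (simp only: c mscale_def eprod_def prod.empty mult_1_right)
      ultimately show "p \<in> slims {r} E t h" by (simp only:)
    qed
  next
    case (edge V E t h e)
    note e = edge(4-6)
    have finE: "finite E" using edge by (simp add: multigraph_def)
    show ?case
    proof
      fix f assume f: "f \<in> cutker V E t h"
      have "glue (t e) (h e) 0 f \<in> glue (t e) (h e) 0 ` slims V E t h"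
        using glue_cutker[where t = t and h = h and e = e, OF f edge(3) e] edge(10) slims_contract[where t = t and h = h and e = e, OF edge(3) e] by blast
      then obtain p where p: "p \<in> slims V E t h" "glue (t e) (h e) 0 f = glue (t e) (h e) 0 p" by auto
      have "f - p \<in> cutker V E t h"
        using f p slims_subset_cutker[OF edge(1)] by (intro mpoly.subspace_diff[OF cutker_subspace]) auto
      moreover have "glue (t e) (h e) 0 (f - p) = 0" using p by (simp add: glue_simps)
      ultimately obtain q where q: "f - p = (edge_form t h e - Const 0) * q" "q \<in> cutker V (E - {e}) t h"
        using cutker_factor[where t = t and h = h and e = e, OF _ _ finE edge(3) e] by blast
      have "q \<in> slims V (E - {e}) t h"
      proof (cases "conn V (E - {e}) t h")
        case True then show ?thesis using edge q by blast
      next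
        case False
        then have "q = 0" using cutker_disconnected[OF False _ q(2)] e by blast
        then show ?thesis by (simp add: slims_def mpoly.span_zero)
      qed
      then have "edge_form t h e * q \<in> slims V E t h" by (rule slims_delete[where t = t and h = h and e = e, OF finE edge(3)])
      moreover have "f = p + edge_form t h e * q" using q(1) by (simp add: Const_0 algebra_simps)
      ultimately show "f \<in> slims V E t h" using p unfolding slims_def by (simp add: mpoly.span_add)
    qed
  qed
qed

lemma cutideal_times:
  assumes "f \<in> diffalg V" "j \<in> cutideal V E t h"
  shows "f * j \<in> cutideal V E t h"
  using assms unfolding diffalg_eq_span cutideal_def
proof (rule span_mult_closed[rotated])
  fix a b assume "a \<in> dprods V" "b \<in> cutgens V E t h"
  then show "a * b \<in> cutgens V E t h"
    unfolding cutgens_def by clarify (metis dprods_mult mult.assoc)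
qed

lemma cutideal_gen: "proper V S \<Longrightarrow> eprod t h (cut_edges E t h S) \<in> cutideal V E t h"
  unfolding cutideal_def cutgens_def
  by (rule mpoly.span_base) (metis (mono_tags, lifting) dprods.one mem_Collect_eq mult_1)

lemma glue_dprods: "q \<in> dprods V \<Longrightarrow> v \<notin> V \<Longrightarrow> glue u v c q = q"
  by (induction rule: dprods.induct) (auto simp: glue_simps)

lemma cutideal_contract:
  assumes e: "t e \<in> V" "h e \<in> V" "t e \<noteq> h e" and "e \<in> E"
  shows "cutideal (V - {h e}) (E - {e}) (merge_ends (t e) (h e) t) (merge_ends (t e) (h e) h)
    \<subseteq> glue (t e) (h e) 0 ` cutideal V E t h"
proof -
  interpret g: Vector_Spaces.linear mscale mscale "glue (t e) (h e) 0" by (rule linear_glue)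
  show ?thesis
    unfolding cutideal_def g.span_image[symmetric]
  proof (rule mpoly.span_mono, rule subsetI)
    fix x assume "x \<in> cutgens (V - {h e}) (E - {e}) (merge_ends (t e) (h e) t) (merge_ends (t e) (h e) h)"
    then obtain q S where q: "q \<in> dprods (V - {h e})" and S: "proper (V - {h e}) S"
      and x: "x = q * eprod (merge_ends (t e) (h e) t) (merge_ends (t e) (h e) h)
        (cut_edges (E - {e}) (merge_ends (t e) (h e) t) (merge_ends (t e) (h e) h) S)"
      unfolding cutgens_def by blast
    let ?S = "S \<union> (if t e \<in> S then {h e} else {})"
    have nS: "h e \<notin> S" using S by (auto simp: proper_def)
    have "cut_edges (E - {e}) (merge_ends (t e) (h e) t) (merge_ends (t e) (h e) h) S = cut_edges E t h ?S"
      using cut_merge[OF e(3) nS, of "E - {e}" t h] nS by (auto simp: cut_edges_def crosses_def)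
    then have "x = glue (t e) (h e) 0 (q * eprod t h (cut_edges E t h ?S))"
      using glue_dprods[OF q] by (simp add: x glue_simps(2) eprod_glue)
    moreover have "q * eprod t h (cut_edges E t h ?S) \<in> cutgens V E t h"
      unfolding cutgens_def using proper_merge[OF e S] dprods_mono[OF q] by blast
    ultimately show "x \<in> glue (t e) (h e) 0 ` cutgens V E t h" by blast
  qed
qed

lemma cutideal_delete:
  assumes "finite E" "e \<in> E" and e: "t e \<in> V" "h e \<in> V" and "j \<in> cutideal V (E - {e}) t h"
  shows "edge_form t h e * j \<in> cutideal V E t h"
proof -
  interpret g: Vector_Spaces.linear mscale mscale "\<lambda>p. edge_form t h e * p" by (rule linear_times)
  have "(\<lambda>p. edge_form t h e * p) ` cutideal V (E - {e}) t h \<subseteq> cutideal V E t h"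
    unfolding cutideal_def g.span_image[symmetric]
  proof (rule mpoly.span_mono, rule subsetI)
    fix x assume "x \<in> (\<lambda>p. edge_form t h e * p) ` cutgens V (E - {e}) t h"
    then obtain q S where q: "q \<in> dprods V" and S: "proper V S"
      and x: "x = edge_form t h e * (q * eprod t h (cut_edges (E - {e}) t h S))"
      unfolding cutgens_def by blast
    show "x \<in> cutgens V E t h"
    proof (cases "crosses t h S e")
      case True
      then have "cut_edges E t h S = insert e (cut_edges (E - {e}) t h S)" using assms by (auto simp: cut_edges_def)
      then have "eprod t h (cut_edges E t h S) = edge_form t h e * eprod t h (cut_edges (E - {e}) t h S)"
        using assms(1) by (simp add: eprod_def cut_edges_def)
      then have "x = q * eprod t h (cut_edges E t h S)" by (simp only: x mult.left_commute)
      then show ?thesis using q S unfolding cutgens_def by blast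
    next
      case False
      then have "cut_edges E t h S = cut_edges (E - {e}) t h S" by (auto simp: cut_edges_def)
      then have "x = (edge_form t h e * q) * eprod t h (cut_edges E t h S)" by (simp only: x mult.assoc)
      then show ?thesis using dprods.times[OF q e(2,1)] S unfolding cutgens_def by blast
    qed
  qed
  then show ?thesis using assms by auto
qed

text \<open>
  As for \<open>slims_eq_cutker\<close>, a decomposition over the contraction is lifted, and the remainder is
  \<open>x\<^sub>e q\<close>. If \<open>e\<close> is no bridge, \<open>q\<close> is decomposed over the graph without \<open>e\<close>, and multiplication by
  \<open>x\<^sub>e\<close> respects both summands. If \<open>e\<close> is a bridge, \<open>x\<^sub>e\<close> itself is a cut product.
\<close>

theorem diffalg_decompose:
  assumes "multigraph V E t h" "conn V E t h"
  shows "\<forall>f\<in>diffalg V. \<exists>p\<in>slims V E t h. \<exists>j\<in>cutideal V E t h. f = p + j"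
  using assms
proof (induction rule: deletion_contraction_induct)
  case (single r E t h)
  show ?case
  proof
    fix f :: "'a mpoly" assume "f \<in> diffalg {r}"
    then have "f \<in> cutker {r} E t h" by (auto simp: cutker_def proper_def)
    moreover have "conn {r} E t h" by (auto simp: conn_def proper_def)
    ultimately have "f \<in> slims {r} E t h" using slims_eq_cutker[OF single] by simp
    then show "\<exists>p\<in>slims {r} E t h. \<exists>j\<in>cutideal {r} E t h. f = p + j"
      by (intro bexI[of _ f] bexI[of _ 0]) (simp_all add: cutideal_def mpoly.span_zero)
  qed
next
  case (edge V E t h e)
  note e = edge(4-6)
  have finE: "finite E" using edge by (simp add: multigraph_def)
  show ?case
  proof
    fix f assume f: "f \<in> diffalg V"
    obtain p' j' where pj': "glue (t e) (h e) 0 f = p' + j'"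
      "p' \<in> slims (V - {h e}) (E - {e}) (merge_ends (t e) (h e) t) (merge_ends (t e) (h e) h)"
      "j' \<in> cutideal (V - {h e}) (E - {e}) (merge_ends (t e) (h e) t) (merge_ends (t e) (h e) h)"
      using edge(10) diffalg_glue[OF f e(1,3)] by blast
    obtain p j where p: "p \<in> slims V E t h" "p' = glue (t e) (h e) 0 p"
      and j: "j \<in> cutideal V E t h" "j' = glue (t e) (h e) 0 j"
      using slims_contract[where t = t and h = h and e = e, OF edge(3) e] cutideal_contract[where t = t and h = h and e = e, OF e edge(3)] pj' by blast
    have sub: "slims V E t h \<subseteq> diffalg V"
      using slims_subset_cutker[OF edge(1)] by (auto simp: cutker_def)
    have "cutideal V E t h \<subseteq> diffalg V"
      unfolding cutideal_def
    proof (rule mpoly.span_minimal[OF _ diffalg_subspace], rule subsetI)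
      fix x assume "x \<in> cutgens V E t h"
      then show "x \<in> diffalg V"
        unfolding cutgens_def using dprods_subset_diffalg[of V] edge(1)
        by (auto intro!: subalgebra_gen.mult eprod_diffalg simp: cut_edges_def multigraph_def)
    qed
    then have "f - (p + j) \<in> diffalg V"
      using f p j sub by (intro diffalg_diff subalgebra_gen.add) auto
    then obtain q where q: "q \<in> diffalg V" "f - (p + j) = edge_form t h e * q"
      using diffalg_factor[of "f - (p + j)" V "t e" "h e" 0] e pj' p j by (auto simp: glue_simps Const_0)
    obtain p2 j2 where pj2: "edge_form t h e * q = p2 + j2" "p2 \<in> slims V E t h" "j2 \<in> cutideal V E t h"
    proof (cases "conn V (E - {e}) t h")
      case True
      then obtain a b where ab: "q = a + b" "a \<in> slims V (E - {e}) t h" "b \<in> cutideal V (E - {e}) t h"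
        using edge(9) q by blast
      show ?thesis
      proof (rule that)
        show "edge_form t h e * q = edge_form t h e * a + edge_form t h e * b"
          by (simp only: ab distrib_left)
        show "edge_form t h e * a \<in> slims V E t h" by (rule slims_delete[OF finE edge(3) ab(2)])
        show "edge_form t h e * b \<in> cutideal V E t h" by (rule cutideal_delete[OF finE edge(3) e(1,2) ab(3)])
      qed
    next
      case False
      then obtain S where S: "proper V S" "cut_edges (E - {e}) t h S = {}" using e by (auto simp: conn_def)
      then have "cut_edges E t h S = {e}" using edge(2) by (auto simp: conn_def cut_edges_def)
      then have "edge_form t h e \<in> cutideal V E t h"
        using cutideal_gen[OF S(1), of t h E] by (simp add: eprod_def)
      from cutideal_times[OF q(1) this] have "edge_form t h e * q \<in> cutideal V E t h"
        by (simp add: mult.commute)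
      then show ?thesis
        by (intro that[of 0 "edge_form t h e * q"]) (simp_all add: slims_def mpoly.span_zero)
    qed
    have "f = (p + p2) + (j + j2)" using q(2) pj2(1) by (simp add: algebra_simps)
    moreover have "p + p2 \<in> slims V E t h" "j + j2 \<in> cutideal V E t h"
      using p j pj2 by (simp_all add: slims_def cutideal_def mpoly.span_add)
    ultimately show "\<exists>p\<in>slims V E t h. \<exists>j\<in>cutideal V E t h. f = p + j" by blast
  qed
qed

section \<open>Homogeneous components\<close>

definition mdeg :: "('v \<Rightarrow>\<^sub>0 nat) \<Rightarrow> nat" where
  "mdeg m = (\<Sum>v\<in>Poly_Mapping.keys m. Poly_Mapping.lookup m v)"

lemma homogeneous_iff: "homogeneous d p \<longleftrightarrow> (\<forall>m\<in>Poly_Mapping.keys p. mdeg m = d)"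
  by (simp add: homogeneous_def mdeg_def)

lemma mdeg_add: "mdeg (m + n) = mdeg m + mdeg n"
proof -
  let ?X = "Poly_Mapping.keys m \<union> Poly_Mapping.keys n"
  have "mdeg r = (\<Sum>v\<in>?X. Poly_Mapping.lookup r v)" if "r \<in> {m, n, m + n}" for r
    unfolding mdeg_def using that by (intro sum.mono_neutral_left) (auto simp: in_keys_iff lookup_add)
  then show ?thesis by (simp add: lookup_add sum.distrib)
qed

definition hcomp :: "nat \<Rightarrow> 'v mpoly \<Rightarrow> 'v mpoly" where
  "hcomp d p = Abs_poly_mapping (\<lambda>m. if mdeg m = d then Poly_Mapping.lookup p m else 0)"

lemma lookup_hcomp:
  "Poly_Mapping.lookup (hcomp d p) m = (if mdeg m = d then Poly_Mapping.lookup p m else 0)"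
proof -
  have "finite {m. (if mdeg m = d then Poly_Mapping.lookup p m else 0) \<noteq> 0}"
    by (rule finite_subset[of _ "Poly_Mapping.keys p"]) (auto simp: in_keys_iff split: if_splits)
  then show ?thesis unfolding hcomp_def by (subst lookup_Abs_poly_mapping) auto
qed

lemma linear_hcomp: "Vector_Spaces.linear mscale mscale (hcomp d)"
  unfolding Vector_Spaces.linear_iff
  by (intro conjI allI mpoly.vector_space_axioms; intro poly_mapping_eqI)
    (simp_all add: lookup_hcomp lookup_add lookup_mscale)

interpretation hcomp: Vector_Spaces.linear mscale mscale "hcomp d" for d
  by (rule linear_hcomp)

lemma homogeneous_hcomp: "homogeneous d (hcomp d p)"
  by (auto simp: homogeneous_iff in_keys_iff lookup_hcomp split: if_splits)

lemma hcomp_homogeneous: "homogeneous e p \<Longrightarrow> hcomp d p = (if d = e then p else 0)"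
  by (intro poly_mapping_eqI) (auto simp: homogeneous_iff in_keys_iff lookup_hcomp)

lemma homogeneous_mult: "homogeneous d p \<Longrightarrow> homogeneous e q \<Longrightarrow> homogeneous (d + e) (p * q)"
  using keys_mult[of p q] by (fastforce simp: homogeneous_iff mdeg_add)

lemma homogeneous_1: "homogeneous 0 1"
  by (simp add: homogeneous_iff mdeg_def)

lemma homogeneous_Var: "homogeneous 1 (Var v)"
  by (simp add: homogeneous_iff Var_def mdeg_def)

lemma homogeneous_iff_hcomp: "homogeneous d p \<longleftrightarrow> hcomp d p = p"
  using hcomp_homogeneous[of d p d] homogeneous_hcomp[of d p] by auto

lemma homogeneous_subspace: "mpoly.subspace {p. homogeneous d p}"
  by (simp add: mpoly.subspace_def homogeneous_iff_hcomp hcomp.zero hcomp.add hcomp.scale)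

lemma homogeneous_Var_diff: "homogeneous 1 (Var u - Var v)"
  using mpoly.subspace_diff[OF homogeneous_subspace[of 1], of "Var u" "Var v"]
  unfolding mem_Collect_eq by (simp only: homogeneous_Var simp_thms)

lemma homogeneous_dprods: "q \<in> dprods V \<Longrightarrow> \<exists>d. homogeneous d q"
proof (induction rule: dprods.induct)
  case one
  show ?case by (rule exI[of _ 0]) (rule homogeneous_1)
next
  case (times q u v)
  then obtain d where "homogeneous d q" by (elim exE)
  from homogeneous_mult[OF homogeneous_Var_diff this] show ?case by (rule exI)
qed

lemma homogeneous_eprod: "finite Y \<Longrightarrow> homogeneous (card Y) (eprod t h Y)"
proof (induction Y rule: finite_induct)
  case empty then show ?case by (simp add: eprod_def homogeneous_1)
next
  case (insert e Y)
  then show ?case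
    using homogeneous_mult[OF homogeneous_Var_diff insert(3), of "t e" "h e"] by (simp add: eprod_def)
qed

lemma mpoly_eq_sum_hcomp: "\<exists>N. \<forall>n\<ge>N. p = (\<Sum>d<n. hcomp d p)"
proof (intro exI allI impI)
  fix n assume n: "Suc (Max (mdeg ` Poly_Mapping.keys p)) \<le> n"
  show "p = (\<Sum>d<n. hcomp d p)"
  proof (rule poly_mapping_eqI)
    fix m
    show "Poly_Mapping.lookup p m = Poly_Mapping.lookup (\<Sum>d<n. hcomp d p) m"
    proof (cases "m \<in> Poly_Mapping.keys p")
      case True
      then have "mdeg m \<le> Max (mdeg ` Poly_Mapping.keys p)" by (intro Max_ge) auto
      then have "mdeg m < n" using n by simp
      then show ?thesis by (simp add: lookup_sum lookup_hcomp sum.delta')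
    next
      case False
      then have "Poly_Mapping.lookup p m = 0" by (simp add: in_keys_iff)
      then show ?thesis by (simp add: lookup_sum lookup_hcomp)
    qed
  qed
qed

lemma hcomp_all_zero: "(\<And>d. hcomp d p = 0) \<Longrightarrow> p = 0"
  using mpoly_eq_sum_hcomp[of p] by auto

definition graded :: "'v mpoly set \<Rightarrow> bool" where
  "graded W \<longleftrightarrow> mpoly.subspace W \<and> (\<forall>p\<in>W. \<forall>d. hcomp d p \<in> W)"

lemma graded_span:
  assumes "\<And>b. b \<in> B \<Longrightarrow> \<exists>d. homogeneous d b"
  shows "graded (mpoly.span B)"
  unfolding graded_def
proof (intro conjI ballI allI mpoly.subspace_span)
  fix p d assume "p \<in> mpoly.span B"
  then show "hcomp d p \<in> mpoly.span B"
  proof (induction rule: mpoly.span_induct_alt)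
    case base then show ?case by (simp add: hcomp.zero mpoly.span_zero)
  next
    case (step c b y)
    obtain e where "homogeneous e b" using assms step by blast
    then have "hcomp d b \<in> mpoly.span B"
      using step by (simp add: hcomp_homogeneous mpoly.span_base mpoly.span_zero)
    then show ?case using step by (simp add: hcomp.add hcomp.scale mpoly.span_add mpoly.span_scale)
  qed
qed

lemma graded_diffalg: "graded (diffalg V)"
  unfolding diffalg_eq_span by (intro graded_span homogeneous_dprods)

lemma graded_slims: "finite E \<Longrightarrow> graded (slims V E t h)"
  unfolding slims_def by (intro graded_span) (auto intro: homogeneous_eprod finite_subset)

lemma homogeneous_cutgens: "finite E \<Longrightarrow> x \<in> cutgens V E t h \<Longrightarrow> \<exists>d. homogeneous d x"
proof -
  assume "finite E" "x \<in> cutgens V E t h"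
  then obtain q S where q: "q \<in> dprods V" and x: "x = q * eprod t h (cut_edges E t h S)"
    unfolding cutgens_def by blast
  have "finite (cut_edges E t h S)" using \<open>finite E\<close> by (simp add: cut_edges_def)
  then show ?thesis
    using homogeneous_dprods[OF q] homogeneous_mult homogeneous_eprod unfolding x by blast
qed

lemma graded_cutideal: "finite E \<Longrightarrow> graded (cutideal V E t h)"
  unfolding cutideal_def by (intro graded_span homogeneous_cutgens)

lemma cutideal_subset_diffalg:
  assumes "multigraph V E t h"
  shows "cutideal V E t h \<subseteq> diffalg V"
  unfolding cutideal_def
proof (rule mpoly.span_minimal[OF _ diffalg_subspace], rule subsetI)
  fix x assume "x \<in> cutgens V E t h"
  then obtain q S where q: "q \<in> dprods V" and x: "x = q * eprod t h (cut_edges E t h S)"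
    unfolding cutgens_def by blast
  have "eprod t h (cut_edges E t h S) \<in> diffalg V"
    using assms by (intro eprod_diffalg) (auto simp: cut_edges_def multigraph_def)
  then show "x \<in> diffalg V" unfolding x using q dprods_subset_diffalg by (blast intro: subalgebra_gen.mult)
qed

lemma slims_subset_diffalg: "multigraph V E t h \<Longrightarrow> slims V E t h \<subseteq> diffalg V"
  using slims_subset_cutker by (force simp: cutker_def)

section \<open>Generic points\<close>

definition tight_edges :: "('v \<Rightarrow> rat) \<Rightarrow> ('e \<Rightarrow> rat) \<Rightarrow> 'e set \<Rightarrow> ('e \<Rightarrow> 'v) \<Rightarrow> ('e \<Rightarrow> 'v) \<Rightarrow> 'e set" where
  "tight_edges \<theta> c E t h = {e \<in> E. \<theta> (t e) - \<theta> (h e) = c e}"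

text \<open>
  No equation that holds at a point is implied by others that hold there and already connect the graph.
  So at the points where the equations that hold connect the graph, they form a spanning tree.
\<close>

definition generic :: "'v set \<Rightarrow> 'e set \<Rightarrow> ('e \<Rightarrow> 'v) \<Rightarrow> ('e \<Rightarrow> 'v) \<Rightarrow> ('e \<Rightarrow> rat) \<Rightarrow> bool" where
  "generic V E t h c \<longleftrightarrow> (\<forall>\<theta>. \<forall>e\<in>E. conn V (tight_edges \<theta> c E t h - {e}) t h \<longrightarrow> \<theta> (t e) - \<theta> (h e) \<noteq> c e)"

lemma eval_at_glue: "eval_at \<theta> (glue u v c p) = eval_at (\<theta>(v := \<theta> u - c)) p"
proof (rule hom_eqI)
  show "is_hom (\<lambda>p. eval_at \<theta> (glue u v c p))" by (rule is_hom_compose[OF is_hom_eval_at is_hom_glue])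
  show "is_hom (eval_at (\<theta>(v := \<theta> u - c)))" by (rule is_hom_eval_at)
  show "eval_at \<theta> (glue u v c (Const d)) = eval_at (\<theta>(v := \<theta> u - c)) (Const d)" for d
    by (simp add: glue_simps eval_at_simps)
  show "eval_at \<theta> (glue u v c (Var w)) = eval_at (\<theta>(v := \<theta> u - c)) (Var w)" for w
    by (simp add: glue_simps eval_at_simps)
qed

text \<open>
  Points for the contraction, with constants translated to account for the value \<open>c\<^sub>e\<close>, lift to points
  on the hyperplane \<open>x\<^sub>e = c\<^sub>e\<close>. So an element that vanishes at all points restricts to \<open>0\<close> on this
  hyperplane and is divisible by \<open>x\<^sub>e - c\<^sub>e\<close>. The quotient vanishes at the points for the graph without
  \<open>e\<close>, because there genericity forces \<open>x\<^sub>e \<noteq> c\<^sub>e\<close>.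
\<close>

theorem cutker_vanishing:
  assumes "multigraph V E t h" "conn V E t h"
  shows "\<forall>c. generic V E t h c \<longrightarrow> (\<forall>p\<in>cutker V E t h.
    (\<forall>\<theta>. conn V (tight_edges \<theta> c E t h) t h \<longrightarrow> eval_at \<theta> p = 0) \<longrightarrow> p = 0)"
  using assms
proof (induction rule: deletion_contraction_induct)
  case (single r E t h)
  show ?case
  proof (intro allI impI ballI)
    fix c p assume "p \<in> cutker {r} E t h" and v: "\<forall>\<theta>. conn {r} (tight_edges \<theta> c E t h) t h \<longrightarrow> eval_at \<theta> p = 0"
    then have "p \<in> diffalg {r}" by (simp only: cutker_def mem_Collect_eq)
    from diffalg_singleton[OF this] obtain d where d: "p = Const d" ..
    have "conn {r} (tight_edges (\<lambda>_. 0) c E t h) t h" by (auto simp: conn_def proper_def)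
    then show "p = 0" using v by (auto simp: d eval_at_simps Const_0)
  qed
next
  case (edge V E t h e)
  note ends = edge(4-6)
  let ?u = "t e" and ?v = "h e"
  let ?t = "merge_ends (t e) (h e) t" and ?h = "merge_ends (t e) (h e) h"
  have finE: "finite E" using edge by (simp add: multigraph_def)
  show ?case
  proof (intro allI impI ballI)
    fix c p
    assume gen: "generic V E t h c" and p: "p \<in> cutker V E t h"
      and van: "\<forall>\<theta>. conn V (tight_edges \<theta> c E t h) t h \<longrightarrow> eval_at \<theta> p = 0"
    \<comment> \<open>An edge at \<open>v\<close> is moved to \<open>u\<close>, where the potential is larger by \<open>c e\<close>.\<close>
    define c' where "c' f = c f + (if t f = ?v then c e else 0) - (if h f = ?v then c e else 0)" for f
    define lift where "lift \<theta> = \<theta>(?v := \<theta> ?u - c e)" for \<theta> :: "'a \<Rightarrow> rat"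
    have sat_iff: "lift \<theta> (t f) - lift \<theta> (h f) = c f \<longleftrightarrow> \<theta> (?t f) - \<theta> (?h f) = c' f" for f \<theta>
    proof -
      have L: "lift \<theta> w = \<theta> (if w = ?v then ?u else w) - (if w = ?v then c e else 0)" for w
        by (simp only: lift_def fun_upd_apply) simp
      have A: "(a - x) - (b - y) = k \<longleftrightarrow> a - b = k + x - y" for a x b y k :: rat
        by (rule iffI; linarith)
      show ?thesis unfolding L merge_ends_def c'_def by (rule A)
    qed
    have tight_edges: "tight_edges (lift \<theta>) c E t h = insert e (tight_edges \<theta> c' (E - {e}) ?t ?h)" for \<theta>
    proof -
      have "lift \<theta> (t e) - lift \<theta> (h e) = c e" using ends(3) by (simp add: lift_def)
      then show ?thesis
        unfolding tight_edges_def sat_iff[symmetric] using edge(3) by blast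
    qed
    have "generic (V - {?v}) (E - {e}) ?t ?h c'"
      unfolding generic_def
    proof (intro allI ballI impI)
      fix \<theta> f assume f: "f \<in> E - {e}" and c: "conn (V - {?v}) (tight_edges \<theta> c' (E - {e}) ?t ?h - {f}) ?t ?h"
      have "conn V (insert e (tight_edges \<theta> c' (E - {e}) ?t ?h - {f})) t h"
        using c unfolding conn_contract[where t = t and h = h and e = e, OF ends] .
      moreover have "insert e (tight_edges \<theta> c' (E - {e}) ?t ?h - {f}) = tight_edges (lift \<theta>) c E t h - {f}"
        using f unfolding tight_edges by auto
      ultimately have "lift \<theta> (t f) - lift \<theta> (h f) \<noteq> c f"
        using gen f unfolding generic_def by auto
      then show "\<theta> (?t f) - \<theta> (?h f) \<noteq> c' f" using sat_iff by blast
    qed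
    moreover have "eval_at \<theta> (glue ?u ?v (c e) p) = 0" if "conn (V - {?v}) (tight_edges \<theta> c' (E - {e}) ?t ?h) ?t ?h" for \<theta>
    proof -
      have "conn V (tight_edges (lift \<theta>) c E t h) t h"
        using that unfolding tight_edges conn_contract[where t = t and h = h and e = e, OF ends] .
      then show ?thesis unfolding eval_at_glue using van by (simp add: lift_def)
    qed
    ultimately have g0: "glue ?u ?v (c e) p = 0"
      using edge(10) glue_cutker[where t = t and h = h and e = e, OF p edge(3) ends, of "c e"] by blast
    obtain q where q: "p = (edge_form t h e - Const (c e)) * q" "q \<in> cutker V (E - {e}) t h"
      using cutker_factor[where t = t and h = h and e = e, OF p g0 finE edge(3) ends] by blast
    have "q = 0"
    proof (cases "conn V (E - {e}) t h")
      case True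
      have sub: "tight_edges \<theta> c (E - {e}) t h = tight_edges \<theta> c E t h - {e}" for \<theta> by (auto simp: tight_edges_def)
      have "generic V (E - {e}) t h c"
        unfolding generic_def
      proof (intro allI ballI impI)
        fix \<theta> f assume f: "f \<in> E - {e}" and c: "conn V (tight_edges \<theta> c (E - {e}) t h - {f}) t h"
        have "conn V (tight_edges \<theta> c E t h - {f}) t h"
          by (rule conn_mono[OF c]) (auto simp: sub)
        then show "\<theta> (t f) - \<theta> (h f) \<noteq> c f" using gen f unfolding generic_def by blast
      qed
      moreover have "eval_at \<theta> q = 0" if th: "conn V (tight_edges \<theta> c (E - {e}) t h) t h" for \<theta>
      proof -
        have "\<theta> ?u - \<theta> ?v \<noteq> c e" using gen edge(3) th unfolding generic_def sub by blast
        moreover have "conn V (tight_edges \<theta> c E t h) t h"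
          by (rule conn_mono[OF th]) (auto simp: sub)
        then have "eval_at \<theta> p = 0" using van by blast
        then have "(\<theta> ?u - \<theta> ?v - c e) * eval_at \<theta> q = 0" unfolding q(1) by (simp add: eval_at_simps)
        ultimately show ?thesis by simp
      qed
      ultimately show ?thesis using edge(9)[OF True] q(2) by blast
    next
      case False
      then show ?thesis using cutker_disconnected[OF False _ q(2)] ends by blast
    qed
    then show "p = 0" using q by simp
  qed
qed

lemma crosses_sym_diff:
  "crosses t h ((S - T) \<union> (T - S)) e \<longleftrightarrow> (crosses t h S e \<noteq> crosses t h T e)"
  by (auto simp: crosses_def)

text \<open>
  Edges are added one at a time. The values of \<open>x\<^sub>e\<close> to be avoided are those forced by the equations of
  edges already present; each set of edges forces at most one value, so they are finite in number. The
  form of the statement, that some cut contains the edge and none of the other tight edges, is stronger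
  than \<open>generic\<close>; it is carried to the next step by symmetric differences of cuts.
\<close>

lemma generic_strong_exists:
  assumes "finite E"
  shows "\<exists>c. \<forall>\<theta>. \<forall>f\<in>tight_edges \<theta> c E t h. \<exists>S. crosses t h S f \<and> cut_edges (tight_edges \<theta> c E t h - {f}) t h S = {}"
  using assms
proof (induction E rule: finite_induct)
  case empty then show ?case by (simp add: tight_edges_def)
next
  case (insert e E)
  then obtain c where c: "\<And>\<theta> f. f \<in> tight_edges \<theta> c E t h
    \<Longrightarrow> \<exists>S. crosses t h S f \<and> cut_edges (tight_edges \<theta> c E t h - {f}) t h S = {}" by blast
  define bad where "bad \<theta> \<longleftrightarrow> \<not> (\<exists>S. crosses t h S e \<and> cut_edges (tight_edges \<theta> c E t h) t h S = {})" for \<theta>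
  define val where "val \<theta> = \<theta> (t e) - \<theta> (h e)" for \<theta> :: "'b \<Rightarrow> rat"
  have uniq: "val \<theta> = val \<theta>'" if "bad \<theta>" "tight_edges \<theta> c E t h = tight_edges \<theta>' c E t h" for \<theta> \<theta>'
  proof -
    \<comment> \<open>No tight edge leaves this set, as \<open>\<theta> - \<theta>'\<close> is constant along tight edges.\<close>
    let ?S = "{w. \<theta> w - \<theta>' w = \<theta> (t e) - \<theta>' (t e)}"
    have "\<theta> (t f) - \<theta>' (t f) = \<theta> (h f) - \<theta>' (h f)" if "f \<in> tight_edges \<theta> c E t h" for f
    proof -
      have "\<theta> (t f) - \<theta> (h f) = c f" using that by (simp add: tight_edges_def)
      moreover have "\<theta>' (t f) - \<theta>' (h f) = c f"
        using that unfolding \<open>tight_edges \<theta> c E t h = tight_edges \<theta>' c E t h\<close> by (simp add: tight_edges_def)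
      ultimately show ?thesis by linarith
    qed
    then have "cut_edges (tight_edges \<theta> c E t h) t h ?S = {}" by (auto simp: cut_edges_def crosses_def)
    then have "\<not> crosses t h ?S e" using \<open>bad \<theta>\<close> by (auto simp: bad_def)
    then show ?thesis by (auto simp: crosses_def val_def)
  qed
  define G where "G F = (SOME x. \<exists>\<theta>. bad \<theta> \<and> tight_edges \<theta> c E t h = F \<and> x = val \<theta>)" for F
  have "val ` {\<theta>. bad \<theta>} \<subseteq> G ` Pow E"
  proof clarify
    fix \<theta> assume b: "bad \<theta>"
    have "\<exists>\<theta>'. bad \<theta>' \<and> tight_edges \<theta>' c E t h = tight_edges \<theta> c E t h \<and> G (tight_edges \<theta> c E t h) = val \<theta>'"
      unfolding G_def by (rule someI[of _ "val \<theta>"]) (use b in blast)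
    then have "val \<theta> = G (tight_edges \<theta> c E t h)" using uniq by metis
    then show "val \<theta> \<in> G ` Pow E" by (auto simp: tight_edges_def)
  qed
  then have "finite (val ` {\<theta>. bad \<theta>})" using insert(1) finite_subset by blast
  then obtain x where x: "x \<notin> val ` {\<theta>. bad \<theta>}" using ex_new_if_finite[OF infinite_UNIV_char_0] by blast
  have "\<exists>S. crosses t h S f \<and> cut_edges (tight_edges \<theta> (c(e := x)) (insert e E) t h - {f}) t h S = {}"
    if f: "f \<in> tight_edges \<theta> (c(e := x)) (insert e E) t h" for \<theta> f
  proof -
    let ?F = "tight_edges \<theta> (c(e := x)) (insert e E) t h" and ?F' = "tight_edges \<theta> c E t h"
    have F': "?F' = ?F - {e}" using insert(2) by (auto simp: tight_edges_def)
    have ee: "\<exists>S. crosses t h S e \<and> cut_edges ?F' t h S = {}" if "e \<in> ?F"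
    proof -
      have "val \<theta> = x" using that insert(2) by (auto simp: tight_edges_def val_def)
      then have "\<not> bad \<theta>" using x by blast
      then show ?thesis by (simp add: bad_def)
    qed
    show ?thesis
    proof (cases "f = e")
      case True then show ?thesis using ee f unfolding F' by blast
    next
      case False
      then have f': "f \<in> ?F'" using f F' by blast
      then obtain S where S: "crosses t h S f" "cut_edges (?F' - {f}) t h S = {}" using c by blast
      show ?thesis
      proof (cases "e \<in> ?F \<and> crosses t h S e")
        case False
        then have "cut_edges (?F - {f}) t h S = {}" using S(2) F' by (auto simp: cut_edges_def)
        then show ?thesis using S by blast
      next
        case True
        then obtain T where T: "crosses t h T e" "cut_edges ?F' t h T = {}" using ee by blast
        \<comment> \<open>Both cuts contain \<open>e\<close>, so their symmetric difference does not.\<close>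
        let ?R = "(S - T) \<union> (T - S)"
        have "crosses t h ?R f" using S T f' by (simp add: crosses_sym_diff cut_edges_def)
        moreover have "cut_edges (?F - {f}) t h ?R = {}"
          unfolding cut_edges_def crosses_sym_diff using S(2) T True F' by (auto simp: cut_edges_def)
        ultimately show ?thesis by blast
      qed
    qed
  qed
  then show ?case by blast
qed

lemma generic_exists:
  assumes "multigraph V E t h"
  shows "\<exists>c. generic V E t h c"
proof -
  obtain c where c: "\<And>\<theta> f. f \<in> tight_edges \<theta> c E t h
    \<Longrightarrow> \<exists>S. crosses t h S f \<and> cut_edges (tight_edges \<theta> c E t h - {f}) t h S = {}"
    using generic_strong_exists[of E t h] assms unfolding multigraph_def by blast
  have "generic V E t h c"
    unfolding generic_def
  proof (intro allI ballI impI notI)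
    fix \<theta> e assume e: "e \<in> E" "conn V (tight_edges \<theta> c E t h - {e}) t h" "\<theta> (t e) - \<theta> (h e) = c e"
    then have "e \<in> tight_edges \<theta> c E t h" by (simp add: tight_edges_def)
    then obtain S where S: "crosses t h S e" "cut_edges (tight_edges \<theta> c E t h - {e}) t h S = {}" using c by blast
    have ends: "t f \<in> V" "h f \<in> V" if "f \<in> E" for f using assms that by (auto simp: multigraph_def)
    have "proper V (S \<inter> V)" using S(1) ends[OF e(1)] by (auto simp: proper_def crosses_def)
    then have "cut_edges (tight_edges \<theta> c E t h - {e}) t h (S \<inter> V) \<noteq> {}" using e(2) by (auto simp: conn_def)
    then obtain f where f: "f \<in> tight_edges \<theta> c E t h - {e}" "crosses t h (S \<inter> V) f" by (auto simp: cut_edges_def)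
    then have "crosses t h S f" using ends[of f] by (auto simp: crosses_def tight_edges_def)
    then show False using S f by (auto simp: cut_edges_def)
  qed
  then show ?thesis by (intro exI[of _ c])
qed

section \<open>Independence of the slim space and the cut ideal\<close>

definition low_degree :: "'v set \<Rightarrow> nat \<Rightarrow> 'v mpoly set" where
  "low_degree V n = {p \<in> diffalg V. \<forall>d\<ge>n. hcomp d p = 0}"

lemma low_subspace: "mpoly.subspace (low_degree V n)"
  using diffalg_subspace[of V]
  by (auto simp: low_degree_def mpoly.subspace_def hcomp.zero hcomp.add hcomp.scale)

lemma low_sum_hcomp:
  assumes "\<forall>d\<ge>n. hcomp d p = 0"
  shows "p = (\<Sum>d<n. hcomp d p)"
proof -
  obtain N where "\<forall>k\<ge>N. p = (\<Sum>d<k. hcomp d p)" using mpoly_eq_sum_hcomp by blast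
  then have "p = (\<Sum>d<max n N. hcomp d p)" by (rule allE[of _ "max n N"]) simp
  also have "\<dots> = (\<Sum>d<n. hcomp d p)"
    using assms by (intro sum.mono_neutral_right) auto
  finally show ?thesis .
qed

lemma low_mult:
  assumes p: "p \<in> low_degree V n" and q: "q \<in> diffalg V" "homogeneous m q"
  shows "q * p \<in> low_degree V (m + n)"
proof -
  have "hcomp d (q * p) = 0" if "m + n \<le> d" for d
  proof -
    have "p = (\<Sum>i<n. hcomp i p)" using p by (intro low_sum_hcomp) (simp add: low_degree_def)
    then have "q * p = (\<Sum>i<n. q * hcomp i p)" by (metis sum_distrib_left)
    then have "hcomp d (q * p) = (\<Sum>i<n. hcomp d (q * hcomp i p))" by (simp add: hcomp.sum)
    also have "\<dots> = 0"
    proof (rule sum.neutral, rule ballI)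
      fix i assume "i \<in> {..<n}"
      then show "hcomp d (q * hcomp i p) = 0"
        using hcomp_homogeneous[OF homogeneous_mult[OF q(2) homogeneous_hcomp], of d i p] that by simp
    qed
    finally show ?thesis .
  qed
  moreover have "q * p \<in> diffalg V" using p q by (auto simp: low_degree_def intro: subalgebra_gen.mult)
  ultimately show ?thesis by (simp add: low_degree_def)
qed

lemma homogeneous_low: "p \<in> diffalg V \<Longrightarrow> homogeneous n p \<Longrightarrow> p \<in> low_degree V (Suc n)"
  by (simp add: low_degree_def hcomp_homogeneous)

lemma low_mono: "m \<le> n \<Longrightarrow> low_degree V m \<subseteq> low_degree V n"
  by (auto simp: low_degree_def)

definition eprod_at :: "('e \<Rightarrow> rat) \<Rightarrow> ('e \<Rightarrow> 'v) \<Rightarrow> ('e \<Rightarrow> 'v) \<Rightarrow> 'e set \<Rightarrow> 'v mpoly" where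
  "eprod_at c t h Y = (\<Prod>e\<in>Y. edge_form t h e - Const (c e))"

text \<open>
  In the expansion of the deformed product all terms with at least one constant have lower degree.
\<close>

lemma eprod_deform:
  assumes "finite Y" "\<forall>e\<in>Y. t e \<in> V \<and> h e \<in> V"
  shows "eprod t h Y - eprod_at c t h Y \<in> low_degree V (card Y)"
  using assms
proof (induction Y rule: finite_induct)
  case empty
  then show ?case by (simp add: eprod_def eprod_at_def low_degree_def diffalg_0 hcomp.zero)
next
  case (insert e Y)
  let ?x = "edge_form t h e" and ?p = "eprod t h Y" and ?q = "eprod_at c t h Y"
  have IH: "?p - ?q \<in> low_degree V (card Y)" using insert by simp
  have x: "?x \<in> diffalg V" using insert by (simp add: diffalg_Var_diff)
  have p: "?p \<in> low_degree V (Suc (card Y))"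
    using insert by (intro homogeneous_low homogeneous_eprod eprod_diffalg) auto
  have 1: "?x * (?p - ?q) \<in> low_degree V (Suc (card Y))"
    using low_mult[OF IH x homogeneous_Var_diff] by simp
  have "?p - ?q \<in> low_degree V (Suc (card Y))"
    using IH low_mono[of "card Y" "Suc (card Y)" V] by auto
  from mpoly.subspace_diff[OF low_subspace p this] have "?q \<in> low_degree V (Suc (card Y))"
    by simp
  then have 2: "mscale (c e) ?q \<in> low_degree V (Suc (card Y))"
    by (rule mpoly.subspace_scale[OF low_subspace])
  have "eprod t h (insert e Y) - eprod_at c t h (insert e Y) = ?x * ?p - (?x - Const (c e)) * ?q"
    unfolding eprod_def eprod_at_def prod.insert[OF insert(1,2)] by (rule refl)
  also have "\<dots> = ?x * (?p - ?q) + mscale (c e) ?q"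
    by (simp add: mscale_def algebra_simps)
  finally show ?case
    using insert(1,2) mpoly.subspace_add[OF low_subspace 1 2] by simp
qed

text \<open>
  A multiple of a cut product differs from the same multiple of the deformed product, which vanishes at
  the points in question, by terms of lower degree. These decompose by \<open>diffalg_decompose\<close>, and
  induction applies to the part in the cut ideal.
\<close>

lemma cutideal_reduce:
  assumes G: "multigraph V E t h" "conn V E t h"
  shows "j \<in> cutideal V E t h \<Longrightarrow> homogeneous d j \<Longrightarrow> \<exists>p. p \<in> slims V E t h \<and> p \<in> low_degree V d
    \<and> (\<forall>\<theta>. conn V (tight_edges \<theta> c E t h) t h \<longrightarrow> eval_at \<theta> (j - p) = 0)"
proof (induction d arbitrary: j rule: less_induct)
  case (less d)
  have finE: "finite E" using G by (simp add: multigraph_def)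
  define W where "W = {x. \<exists>p. p \<in> slims V E t h \<and> p \<in> low_degree V d
    \<and> (\<forall>\<theta>. conn V (tight_edges \<theta> c E t h) t h \<longrightarrow> eval_at \<theta> (x - p) = 0)}"
  have W0: "0 \<in> W"
    unfolding W_def slims_def using mpoly.span_zero mpoly.subspace_0[OF low_subspace]
    by (auto intro!: exI[of _ 0] simp: eval_at_simps)
  have Wadd: "x + y \<in> W" if "x \<in> W" "y \<in> W" for x y
  proof -
    obtain p q where "p \<in> slims V E t h" "p \<in> low_degree V d" "q \<in> slims V E t h" "q \<in> low_degree V d"
      and v: "\<forall>\<theta>. conn V (tight_edges \<theta> c E t h) t h \<longrightarrow> eval_at \<theta> (x - p) = 0"
      "\<forall>\<theta>. conn V (tight_edges \<theta> c E t h) t h \<longrightarrow> eval_at \<theta> (y - q) = 0"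
      using \<open>x \<in> W\<close> \<open>y \<in> W\<close> unfolding W_def by blast
    moreover have "(x + y) - (p + q) = (x - p) + (y - q)" by simp
    then have "eval_at \<theta> ((x + y) - (p + q)) = eval_at \<theta> (x - p) + eval_at \<theta> (y - q)" for \<theta>
      by (simp only: hom_add[OF is_hom_eval_at])
    ultimately show ?thesis
      unfolding W_def slims_def by (auto intro!: exI[of _ "p + q"] mpoly.span_add mpoly.subspace_add[OF low_subspace])
  qed
  have Wscale: "mscale a x \<in> W" if "x \<in> W" for a x
  proof -
    obtain p where "p \<in> slims V E t h" "p \<in> low_degree V d"
      and v: "\<forall>\<theta>. conn V (tight_edges \<theta> c E t h) t h \<longrightarrow> eval_at \<theta> (x - p) = 0"
      using \<open>x \<in> W\<close> unfolding W_def by blast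
    moreover have "mscale a x - mscale a p = Const a * (x - p)" by (simp add: mscale_def algebra_simps)
    then have "eval_at \<theta> (mscale a x - mscale a p) = a * eval_at \<theta> (x - p)" for \<theta>
      by (simp only: hom_mult[OF is_hom_eval_at] eval_at_Const)
    ultimately show ?thesis
      unfolding W_def slims_def by (auto intro!: exI[of _ "mscale a p"] mpoly.span_scale mpoly.subspace_scale[OF low_subspace])
  qed
  have subW: "mpoly.subspace W" by (simp add: mpoly.subspace_def W0 Wadd Wscale)
  have lowW: "y \<in> W" if y: "y \<in> low_degree V d" for y
  proof -
    have "hcomp i y \<in> W" if i: "i < d" for i
    proof -
      have yA: "hcomp i y \<in> diffalg V" using y graded_diffalg[of V] by (auto simp: low_degree_def graded_def)
      obtain p j where pj: "p \<in> slims V E t h" "j \<in> cutideal V E t h" "hcomp i y = p + j"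
        using diffalg_decompose[OF G] yA by blast
      have "hcomp i (hcomp i y) = hcomp i y"
        using hcomp_homogeneous[OF homogeneous_hcomp, of i i y] by simp
      then have eq: "hcomp i y = hcomp i p + hcomp i j" unfolding pj(3) by (simp add: hcomp.add)
      have p: "hcomp i p \<in> slims V E t h" and j: "hcomp i j \<in> cutideal V E t h"
        using pj graded_slims[OF finE] graded_cutideal[OF finE] unfolding graded_def by blast+
      have lowi: "low_degree V (Suc i) \<subseteq> low_degree V d" "low_degree V i \<subseteq> low_degree V d" using i by (auto intro!: low_mono)
      have "hcomp i p \<in> low_degree V d"
        using homogeneous_low[OF _ homogeneous_hcomp, of i p V] p slims_subset_diffalg[OF G(1)] lowi by blast
      then have "hcomp i p \<in> W" using p unfolding W_def by (auto intro!: exI[of _ "hcomp i p"] simp: eval_at_simps)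
      moreover have "hcomp i j \<in> W"
        using less.IH[OF i j homogeneous_hcomp] lowi unfolding W_def by blast
      ultimately show ?thesis unfolding eq by (rule Wadd)
    qed
    then have "(\<Sum>i<d. hcomp i y) \<in> W" by (intro mpoly.subspace_sum[OF subW]) auto
    then show ?thesis using low_sum_hcomp[of d y] y by (simp add: low_degree_def)
  qed
  have "hcomp d x \<in> W" if x: "x \<in> cutgens V E t h" for x
  proof -
    obtain q S where q: "q \<in> dprods V" "proper V S" "x = q * eprod t h (cut_edges E t h S)"
      using x unfolding cutgens_def by blast
    have fc: "finite (cut_edges E t h S)" using finE by (simp add: cut_edges_def)
    obtain m where m: "homogeneous m q" using homogeneous_dprods q by blast
    have hx: "homogeneous (m + card (cut_edges E t h S)) x"
      unfolding q(3) by (rule homogeneous_mult[OF m homogeneous_eprod[OF fc]])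
    show ?thesis
    proof (cases "d = m + card (cut_edges E t h S)")
      case False then show ?thesis using hcomp_homogeneous[OF hx, of d] W0 by simp
    next
      case True
      have "q * (eprod t h (cut_edges E t h S) - eprod_at c t h (cut_edges E t h S)) \<in> low_degree V d"
        unfolding True using q dprods_subset_diffalg G(1)
        by (intro low_mult eprod_deform fc m) (auto simp: cut_edges_def multigraph_def)
      then have "q * (eprod t h (cut_edges E t h S) - eprod_at c t h (cut_edges E t h S)) \<in> W" by (rule lowW)
      moreover have "q * eprod_at c t h (cut_edges E t h S) \<in> W"
      proof -
        have "eval_at \<theta> (q * eprod_at c t h (cut_edges E t h S)) = 0" if "conn V (tight_edges \<theta> c E t h) t h" for \<theta>
        proof -
          have "cut_edges (tight_edges \<theta> c E t h) t h S \<noteq> {}" using that q by (auto simp: conn_def)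
          then obtain e where e: "e \<in> cut_edges E t h S" "\<theta> (t e) - \<theta> (h e) = c e"
            by (auto simp: cut_edges_def tight_edges_def)
          then have "eval_at \<theta> (eprod_at c t h (cut_edges E t h S)) = 0"
            unfolding eprod_at_def using fc by (auto simp: eval_at_simps intro!: prod_zero)
          then show ?thesis by (simp add: eval_at_simps)
        qed
        then show ?thesis
          unfolding W_def slims_def using mpoly.span_zero mpoly.subspace_0[OF low_subspace]
          by (auto intro!: exI[of _ 0])
      qed
      ultimately have "q * (eprod t h (cut_edges E t h S) - eprod_at c t h (cut_edges E t h S))
          + q * eprod_at c t h (cut_edges E t h S) \<in> W" by (rule Wadd)
      moreover have "q * (eprod t h (cut_edges E t h S) - eprod_at c t h (cut_edges E t h S))
          + q * eprod_at c t h (cut_edges E t h S) = x"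
        unfolding q(3) by (simp add: algebra_simps)
      ultimately show ?thesis using hcomp_homogeneous[OF hx, of d] True by simp
    qed
  qed
  then have "hcomp d ` cutideal V E t h \<subseteq> W"
    unfolding cutideal_def hcomp.span_image[symmetric] by (intro mpoly.span_minimal[OF _ subW]) auto
  then have "j \<in> W" using less.prems hcomp_homogeneous[OF less.prems(2), of d] by force
  then show ?case unfolding W_def by blast
qed

text \<open>
  A homogeneous component \<open>x\<close> of an element of the intersection agrees on the generic points with a slim
  polynomial \<open>p\<close> of lower degree. By \<open>cutker_vanishing\<close> it is equal to \<open>p\<close>, and comparing degrees it
  vanishes.
\<close>

theorem slims_cutideal_Int:
  assumes G: "multigraph V E t h" "conn V E t h"
    and x: "x \<in> slims V E t h" "x \<in> cutideal V E t h"
  shows "x = 0"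
proof (rule hcomp_all_zero)
  fix d
  have finE: "finite E" using G by (simp add: multigraph_def)
  obtain c where c: "generic V E t h c" using generic_exists[OF G(1)] by blast
  have xd: "hcomp d x \<in> slims V E t h" "hcomp d x \<in> cutideal V E t h"
    using x graded_slims[OF finE] graded_cutideal[OF finE] unfolding graded_def by blast+
  obtain p where p: "p \<in> slims V E t h" "p \<in> low_degree V d"
    "\<forall>\<theta>. conn V (tight_edges \<theta> c E t h) t h \<longrightarrow> eval_at \<theta> (hcomp d x - p) = 0"
    using cutideal_reduce[OF G xd(2) homogeneous_hcomp] by blast
  have "hcomp d x - p \<in> cutker V E t h"
    using slims_subset_cutker[OF G(1)] xd p by (intro mpoly.subspace_diff[OF cutker_subspace]) auto
  then have "hcomp d x - p = 0" using cutker_vanishing[OF G] c p by blast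
  then have "hcomp d x = p" by simp
  moreover have "hcomp d p = 0" using p(2) by (simp add: low_degree_def)
  moreover have "hcomp d (hcomp d x) = hcomp d x"
    using hcomp_homogeneous[OF homogeneous_hcomp, of d d x] by simp
  ultimately show "hcomp d x = 0" by simp
qed

section \<open>Counting lattice points\<close>

definition inside :: "'e set \<Rightarrow> ('e \<Rightarrow> 'v) \<Rightarrow> ('e \<Rightarrow> 'v) \<Rightarrow> 'v set \<Rightarrow> 'e set" where
  "inside E t h S = {e \<in> E. t e \<in> S \<and> h e \<in> S}"

text \<open>
  For \<open>\<tau> = 0\<close> these are the lattice points of the graphical zonotope in its description by inequalities;
  \<open>\<tau>\<close> is a translation. Translations have to be arbitrary for the recursion, since contraction adds up
  the values of \<open>\<tau>\<close> at the two ends.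
\<close>

definition lattice_points ::
  "'v set \<Rightarrow> 'e set \<Rightarrow> ('e \<Rightarrow> 'v) \<Rightarrow> ('e \<Rightarrow> 'v) \<Rightarrow> ('v \<Rightarrow> rat) \<Rightarrow> ('v \<Rightarrow> int) set" where
  "lattice_points V E t h \<tau> = {z. (\<forall>v. v \<notin> V \<longrightarrow> z v = 0) \<and>
    (\<forall>S\<subseteq>V. of_nat (card (inside E t h S)) + sum \<tau> S \<le> of_int (sum z S)) \<and>
    of_int (sum z V) = of_nat (card (inside E t h V)) + sum \<tau> V}"

lemma inside_merge_neither:
  assumes "e \<in> E" "t e \<noteq> h e" "t e \<notin> S" "h e \<notin> S"
  shows "inside (E - {e}) (merge_ends (t e) (h e) t) (merge_ends (t e) (h e) h) S = inside E t h S"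
  using assms by (auto simp: inside_def merge_ends_def)

lemma inside_merge_both:
  assumes "e \<in> E" "t e \<noteq> h e" "t e \<in> S" "h e \<in> S"
  shows "inside E t h S = insert e (inside (E - {e}) (merge_ends (t e) (h e) t) (merge_ends (t e) (h e) h) (S - {h e}))"
  using assms by (auto simp: inside_def merge_ends_def)

text \<open>
  The lattice points over a point of the contraction form a segment in direction \<open>u - v\<close>. The lift \<open>z\<close>
  is its end with the least value at \<open>u\<close>, so one of the constraints on sets \<open>S\<close> that contain \<open>u\<close> but not
  \<open>v\<close> is almost tight. For the sets that contain \<open>v\<close> but not \<open>u\<close> the constraint then follows from the
  supermodularity of the number of inner edges, which is strict by one because \<open>e\<close> joins the difference
  sets.
\<close>

lemma lattice_points_lift:
  fixes \<tau> :: "'v \<Rightarrow> rat" and t h :: "'e \<Rightarrow> 'v"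
  assumes G: "multigraph V E t h" and e: "e \<in> E" "t e \<noteq> h e"
    and z': "z' \<in> lattice_points (V - {h e}) (E - {e}) (merge_ends (t e) (h e) t) (merge_ends (t e) (h e) h)
      (\<tau>(t e := \<tau> (t e) + \<tau> (h e)))"
  shows "\<exists>z\<in>lattice_points V E t h \<tau>. (\<forall>w. w \<noteq> t e \<longrightarrow> w \<noteq> h e \<longrightarrow> z w = z' w)
    \<and> z (t e) + z (h e) = z' (t e) + 1
    \<and> (\<exists>S\<subseteq>V. t e \<in> S \<and> h e \<notin> S \<and> of_int (sum z S) < of_nat (card (inside E t h S)) + sum \<tau> S + 1)"
proof -
  let ?u = "t e" and ?v = "h e" and ?E' = "E - {e}"
  let ?t = "merge_ends (t e) (h e) t" and ?h = "merge_ends (t e) (h e) h" and ?\<tau> = "\<tau>(t e := \<tau> (t e) + \<tau> (h e))"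
  have fin: "finite V" "finite E" and uv: "?u \<in> V" "?v \<in> V"
    using G e by (auto simp: multigraph_def)
  have finS: "finite S" if "S \<subseteq> V" for S using fin that finite_subset by blast
  have finI: "finite (inside X a b S)" if "X \<subseteq> E" for X S and a b :: "'e \<Rightarrow> 'v"
    using fin that by (auto simp: inside_def intro: finite_subset)
  have z'0: "z' ?v = 0" "\<And>v. v \<notin> V \<Longrightarrow> z' v = 0"
    and z'S: "\<And>S. S \<subseteq> V - {?v} \<Longrightarrow> of_nat (card (inside ?E' ?t ?h S)) + sum ?\<tau> S \<le> of_int (sum z' S)"
    and z'V: "of_int (sum z' (V - {?v})) = of_nat (card (inside ?E' ?t ?h (V - {?v}))) + sum ?\<tau> (V - {?v})"
    using z' by (auto simp: lattice_points_def)
  define a where "a S = of_nat (card (inside E t h S)) + sum \<tau> S - of_int (sum z' (S - {?u}))" for S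
  \<comment> \<open>The lower bounds on the value at \<open>u\<close>; \<open>m\<close> is the least integer that satisfies all of them.\<close>
  define M where "M = {S. S \<subseteq> V \<and> ?u \<in> S \<and> ?v \<notin> S}"
  have finM: "finite M" using fin by (simp add: M_def)
  have neM: "M \<noteq> {}" using uv e by (auto simp: M_def intro!: exI[of _ "{?u}"])
  define m where "m = Max ((\<lambda>S. \<lceil>a S\<rceil>) ` M)"
  have m_ge: "a S \<le> of_int m" if "S \<in> M" for S
  proof -
    have "\<lceil>a S\<rceil> \<le> m" unfolding m_def using finM that by (intro Max_ge) auto
    then show ?thesis by (simp add: ceiling_le_iff)
  qed
  have "m \<in> (\<lambda>S. \<lceil>a S\<rceil>) ` M" unfolding m_def using finM neM by (intro Max_in) auto
  then obtain S0 where S0: "S0 \<in> M" "m = \<lceil>a S0\<rceil>" by blast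
  have m_less: "of_int m < a S0 + 1" unfolding S0(2) by linarith
  define z where "z = z'(?u := m, ?v := z' ?u + 1 - m)"
  have zu: "z ?u = m" and zv: "z ?v = z' ?u + 1 - m" and zo: "\<And>w. w \<noteq> ?u \<Longrightarrow> w \<noteq> ?v \<Longrightarrow> z w = z' w"
    using e by (simp_all add: z_def)
  have z_left: "sum z S = m + sum z' (S - {?u})" if "S \<in> M" for S
  proof -
    have "finite S" "?u \<in> S" using that finS by (auto simp: M_def)
    then have "sum z S = z ?u + sum z (S - {?u})" by (simp add: sum.remove)
    also have "sum z (S - {?u}) = sum z' (S - {?u})"
      using that by (intro sum.cong) (auto simp: M_def intro!: zo)
    finally show ?thesis by (simp add: zu)
  qed
  have left: "of_nat (card (inside E t h S)) + sum \<tau> S \<le> of_int (sum z S)" if "S \<in> M" for S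
    using m_ge[OF that] by (simp add: z_left[OF that] a_def)
  have tight: "of_int (sum z S0) < of_nat (card (inside E t h S0)) + sum \<tau> S0 + 1"
    using m_less by (simp add: z_left[OF S0(1)] a_def)
  have neither: "of_nat (card (inside E t h S)) + sum \<tau> S \<le> of_int (sum z S)"
    if "S \<subseteq> V" "?u \<notin> S" "?v \<notin> S" for S
  proof -
    have "sum z S = sum z' S" using that by (intro sum.cong) (auto intro!: zo)
    moreover have "sum ?\<tau> S = sum \<tau> S" using that by (intro sum.cong) auto
    ultimately show ?thesis
      using z'S[of S] that inside_merge_neither[where t = t and h = h, OF e that(2,3)] by auto
  qed
  have both_eq: "of_int (sum z S) - (of_nat (card (inside E t h S)) + sum \<tau> S)
      = of_int (sum z' (S - {?v})) - (of_nat (card (inside ?E' ?t ?h (S - {?v}))) + sum ?\<tau> (S - {?v}))"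
    if "S \<subseteq> V" "?u \<in> S" "?v \<in> S" for S
  proof -
    let ?R = "S - {?v} - {?u}"
    have fS: "finite S" "finite (S - {?v})" using that finS by auto
    have "sum z S = z ?v + (z ?u + sum z ?R)"
      using that fS e by (simp add: sum.remove[of S ?v] sum.remove[of "S - {?v}" ?u])
    also have "sum z ?R = sum z' ?R" by (intro sum.cong) (auto intro!: zo)
    finally have 1: "sum z S = 1 + (z' ?u + sum z' ?R)" by (simp add: zu zv)
    have 2: "sum z' (S - {?v}) = z' ?u + sum z' ?R"
      using that fS e by (simp add: sum.remove[of "S - {?v}" ?u])
    have "sum ?\<tau> (S - {?v}) = ?\<tau> ?u + sum ?\<tau> ?R"
      using that fS e by (intro sum.remove) auto
    also have "sum ?\<tau> ?R = sum \<tau> ?R" by (intro sum.cong) auto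
    finally have 3: "sum ?\<tau> (S - {?v}) = \<tau> ?u + \<tau> ?v + sum \<tau> ?R" by simp
    have 4: "sum \<tau> S = \<tau> ?v + (\<tau> ?u + sum \<tau> ?R)"
      using that fS e by (simp add: sum.remove[of S ?v] sum.remove[of "S - {?v}" ?u])
    have "e \<notin> inside ?E' ?t ?h (S - {?v})" by (simp add: inside_def)
    then have 5: "card (inside E t h S) = Suc (card (inside ?E' ?t ?h (S - {?v})))"
      unfolding inside_merge_both[where t = t and h = h, OF e that(2,3)] using finI[of ?E'] by simp
    show ?thesis unfolding 1 2 3 4 5 by simp
  qed
  have both: "of_nat (card (inside E t h S)) + sum \<tau> S \<le> of_int (sum z S)"
    if "S \<subseteq> V" "?u \<in> S" "?v \<in> S" for S
  proof -
    have "S - {?v} \<subseteq> V - {?v}" using that by blast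
    from z'S[OF this] both_eq[OF that] show ?thesis by linarith
  qed
  have right: "of_nat (card (inside E t h S)) + sum \<tau> S \<le> of_int (sum z S)"
    if S: "S \<subseteq> V" "?u \<notin> S" "?v \<in> S" for S
  proof -
    have S0': "S0 \<subseteq> V" "?u \<in> S0" "?v \<notin> S0" using S0 by (auto simp: M_def)
    have f: "finite S" "finite S0" using finS S S0' by auto
    let ?I = "inside E t h"
    have "insert e (?I S0 \<union> ?I S) \<subseteq> ?I (S0 \<union> S)" using e S S0' by (auto simp: inside_def)
    then have "card (insert e (?I S0 \<union> ?I S)) \<le> card (?I (S0 \<union> S))"
      by (intro card_mono finI) auto
    moreover have "e \<notin> ?I S0 \<union> ?I S" using S S0' by (auto simp: inside_def)
    ultimately have "card (?I S0 \<union> ?I S) + 1 \<le> card (?I (S0 \<union> S))" using finI by simp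
    moreover have "card (?I S0) + card (?I S) = card (?I S0 \<union> ?I S) + card (?I S0 \<inter> ?I S)"
      using finI by (intro card_Un_Int) auto
    moreover have "?I S0 \<inter> ?I S = ?I (S0 \<inter> S)" by (auto simp: inside_def)
    ultimately have c: "card (?I S0) + card (?I S) + 1 \<le> card (?I (S0 \<union> S)) + card (?I (S0 \<inter> S))" by simp
    have s: "sum z (S0 \<union> S) + sum z (S0 \<inter> S) = sum z S0 + sum z S"
      "sum \<tau> (S0 \<union> S) + sum \<tau> (S0 \<inter> S) = sum \<tau> S0 + sum \<tau> S"
      using f by (simp_all add: sum.union_inter)
    have "of_nat (card (?I (S0 \<union> S))) + sum \<tau> (S0 \<union> S) \<le> of_int (sum z (S0 \<union> S))"
      using S S0' by (intro both) auto
    moreover have "of_nat (card (?I (S0 \<inter> S))) + sum \<tau> (S0 \<inter> S) \<le> of_int (sum z (S0 \<inter> S))"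
      using S S0' by (intro neither) auto
    moreover have "(of_nat (card (?I S0)) + of_nat (card (?I S)) + 1 :: rat)
        \<le> of_nat (card (?I (S0 \<union> S))) + of_nat (card (?I (S0 \<inter> S)))"
      using c by (metis of_nat_1 of_nat_add of_nat_le_iff)
    moreover have "(of_int (sum z (S0 \<union> S)) + of_int (sum z (S0 \<inter> S)) :: rat) = of_int (sum z S0) + of_int (sum z S)"
      using s(1) by (metis of_int_add)
    ultimately show ?thesis using tight s(2) by linarith
  qed
  have "z \<in> lattice_points V E t h \<tau>"
    unfolding lattice_points_def
  proof (intro CollectI conjI allI impI)
    show "z v = 0" if "v \<notin> V" for v using that uv z'0 zo[of v] by auto
    show "of_nat (card (inside E t h S)) + sum \<tau> S \<le> of_int (sum z S)" if "S \<subseteq> V" for S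
      using left[of S] right[OF that] both[OF that] neither[OF that] that by (auto simp: M_def)
    show "of_int (sum z V) = of_nat (card (inside E t h V)) + sum \<tau> V"
      using both_eq[OF subset_refl uv] z'V by linarith
  qed
  moreover have "\<exists>S\<subseteq>V. t e \<in> S \<and> h e \<notin> S \<and> of_int (sum z S) < of_nat (card (inside E t h S)) + sum \<tau> S + 1"
    using tight S0 by (auto simp: M_def)
  ultimately show ?thesis
    using zu zv zo by (intro bexI[of _ z]) auto
qed

text \<open>
  The second part separates these points from the lifts of \<open>lattice_points_lift\<close>.
\<close>

lemma lattice_points_delete:
  assumes G: "multigraph V E t h" and e: "e \<in> E" "t e \<noteq> h e"
    and z: "z \<in> lattice_points V (E - {e}) t h \<tau>"
  shows "z(t e := z (t e) + 1) \<in> lattice_points V E t h \<tau>"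
    and "S \<subseteq> V \<Longrightarrow> t e \<in> S \<Longrightarrow> h e \<notin> S \<Longrightarrow>
      of_nat (card (inside E t h S)) + sum \<tau> S + 1 \<le> of_int (sum (z(t e := z (t e) + 1)) S)"
proof -
  let ?z = "z(t e := z (t e) + 1)"
  have fin: "finite V" "finite E" and uv: "t e \<in> V" "h e \<in> V"
    using G e by (auto simp: multigraph_def)
  have zS: "\<And>S. S \<subseteq> V \<Longrightarrow> of_nat (card (inside (E - {e}) t h S)) + sum \<tau> S \<le> of_int (sum z S)"
    and zV: "of_int (sum z V) = of_nat (card (inside (E - {e}) t h V)) + sum \<tau> V"
    and z0: "\<And>v. v \<notin> V \<Longrightarrow> z v = 0"
    using z by (auto simp: lattice_points_def)
  have sum: "sum ?z S = sum z S + (if t e \<in> S then 1 else 0)" if "S \<subseteq> V" for S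
  proof -
    have "finite S" using that fin finite_subset by blast
    moreover have "?z = (\<lambda>v. z v + (if v = t e then 1 else 0))" by auto
    ultimately show ?thesis by (simp add: sum.distrib)
  qed
  have fI: "finite (inside (E - {e}) t h S)" for S using fin by (simp add: inside_def)
  have card: "card (inside E t h S) = card (inside (E - {e}) t h S) + (if t e \<in> S \<and> h e \<in> S then 1 else 0)" for S
  proof (cases "t e \<in> S \<and> h e \<in> S")
    case True
    then have "inside E t h S = insert e (inside (E - {e}) t h S)" using e by (auto simp: inside_def)
    moreover have "e \<notin> inside (E - {e}) t h S" by (simp add: inside_def)
    ultimately show ?thesis using True fI by simp
  next
    case False
    then have "inside E t h S = inside (E - {e}) t h S" by (auto simp: inside_def)
    then show ?thesis using False by auto
  qed
  show "?z \<in> lattice_points V E t h \<tau>"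
    unfolding lattice_points_def
  proof (intro CollectI conjI allI impI)
    show "?z v = 0" if "v \<notin> V" for v using that uv z0 by auto
    show "of_nat (card (inside E t h S)) + sum \<tau> S \<le> of_int (sum ?z S)" if "S \<subseteq> V" for S
      unfolding sum[OF that] card using zS[OF that] by auto
    show "of_int (sum ?z V) = of_nat (card (inside E t h V)) + sum \<tau> V"
      unfolding sum[OF subset_refl] card using zV uv by simp
  qed
  show "of_nat (card (inside E t h S)) + sum \<tau> S + 1 \<le> of_int (sum ?z S)"
    if "S \<subseteq> V" "t e \<in> S" "h e \<notin> S"
    unfolding sum[OF that(1)] card using zS[OF that(1)] that by auto
qed

text \<open>
  A spanning set of the slim space consists of lifts from the contraction and of \<open>x\<^sub>e\<close>-multiples from
  the deletion, and the lattice points contain the corresponding two disjoint families. Explicit finite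
  families \<open>B\<close> and \<open>C\<close> are carried along instead of dimensions and cardinalities, as they can be
  combined directly.
\<close>

theorem slims_dim_le_lattice_points:
  assumes "multigraph V E t h" "conn V E t h"
  shows "\<forall>\<tau>. (\<exists>n::int. sum \<tau> V = of_int n) \<longrightarrow> (\<exists>B C. finite B \<and> finite C \<and> card B \<le> card C \<and>
    B \<subseteq> slims V E t h \<and> slims V E t h \<subseteq> mpoly.span B \<and> C \<subseteq> lattice_points V E t h \<tau>)"
  using assms
proof (induction rule: deletion_contraction_induct)
  case (single r E t h)
  show ?case
  proof (intro allI impI)
    fix \<tau> :: "'a \<Rightarrow> rat" assume "\<exists>n::int. sum \<tau> {r} = of_int n"
    then obtain n :: int where n: "\<tau> r = of_int n" by auto
    let ?z = "\<lambda>v. if v = r then int (card (inside E t h {r})) + n else 0"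
    have "conn {r} (E - {}) t h" by (auto simp: conn_def proper_def)
    then have "eprod t h {} \<in> slims {r} E t h"
      unfolding slims_def by (intro mpoly.span_base) blast
    then have "{1} \<subseteq> slims {r} E t h" by (simp add: eprod_def)
    moreover have "slims {r} E t h \<subseteq> mpoly.span {1}"
    proof
      fix p assume "p \<in> slims {r} E t h"
      then have "p \<in> diffalg {r}" using slims_subset_diffalg[OF single] by blast
      from diffalg_singleton[OF this] obtain c where c: "p = Const c" ..
      have "mscale c 1 \<in> mpoly.span {1}" by (intro mpoly.span_scale mpoly.span_base) simp
      then show "p \<in> mpoly.span {1}" by (simp add: c mscale_def)
    qed
    moreover have "{?z} \<subseteq> lattice_points {r} E t h \<tau>"
    proof -
      have "?z \<in> lattice_points {r} E t h \<tau>"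
        unfolding lattice_points_def
      proof (intro CollectI conjI allI impI)
        fix S assume "S \<subseteq> {r}"
        then consider "S = {}" | "S = {r}" by blast
        then show "of_nat (card (inside E t h S)) + sum \<tau> S \<le> of_int (sum ?z S)"
        proof cases
          case 1 then show ?thesis by (simp add: inside_def)
        next
          case 2 then show ?thesis by (simp add: n)
        qed
      qed (simp_all add: n)
      then show ?thesis by simp
    qed
    ultimately show "\<exists>B C. finite B \<and> finite C \<and> card B \<le> card C \<and>
        B \<subseteq> slims {r} E t h \<and> slims {r} E t h \<subseteq> mpoly.span B \<and> C \<subseteq> lattice_points {r} E t h \<tau>"
      by (intro exI[of _ "{1}"] exI[of _ "{?z}"]) simp
  qed
next
  case (edge V E t h e)
  note ends = edge(4-6)
  let ?u = "t e" and ?v = "h e"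
  let ?t = "merge_ends (t e) (h e) t" and ?h = "merge_ends (t e) (h e) h"
  let ?\<rho> = "glue (t e) (h e) 0"
  have fin: "finite E" "finite V" using edge by (simp_all add: multigraph_def)
  interpret g: Vector_Spaces.linear mscale mscale ?\<rho> by (rule linear_glue)
  interpret x: Vector_Spaces.linear mscale mscale "\<lambda>p. edge_form t h e * p" by (rule linear_times)
  show ?case
  proof (intro allI impI)
    fix \<tau> :: "'a \<Rightarrow> rat" assume \<tau>: "\<exists>n::int. sum \<tau> V = of_int n"
    let ?\<tau> = "\<tau>(?u := \<tau> ?u + \<tau> ?v)"
    have "sum ?\<tau> (V - {?v}) = ?\<tau> ?u + sum ?\<tau> (V - {?v} - {?u})"
      using fin ends by (intro sum.remove) auto
    also have "sum ?\<tau> (V - {?v} - {?u}) = sum \<tau> (V - {?v} - {?u})" by (intro sum.cong) auto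
    also have "?\<tau> ?u + \<dots> = sum \<tau> V"
      using fin ends by (simp add: sum.remove[of V ?v] sum.remove[of "V - {?v}" ?u])
    finally have "\<exists>n::int. sum ?\<tau> (V - {?v}) = of_int n" using \<tau> by simp
    then obtain B' C' where B': "finite B'" "finite C'" "card B' \<le> card C'"
      "B' \<subseteq> slims (V - {?v}) (E - {e}) ?t ?h" "slims (V - {?v}) (E - {e}) ?t ?h \<subseteq> mpoly.span B'"
      "C' \<subseteq> lattice_points (V - {?v}) (E - {e}) ?t ?h ?\<tau>"
      using edge(10)[rule_format, of ?\<tau>] by blast
    obtain Bd Cd where Bd: "finite Bd" "finite Cd" "card Bd \<le> card Cd"
      "(\<lambda>p. edge_form t h e * p) ` Bd \<subseteq> slims V E t h" "cutker V (E - {e}) t h \<subseteq> mpoly.span Bd"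
      "Cd \<subseteq> lattice_points V (E - {e}) t h \<tau>"
    proof (cases "conn V (E - {e}) t h")
      case True
      note IH = mp[OF spec[where x = \<tau>, OF edge(9)[OF True]] \<tau>]
      from IH obtain B C where B: "finite B" "finite C" "card B \<le> card C"
        "B \<subseteq> slims V (E - {e}) t h" "slims V (E - {e}) t h \<subseteq> mpoly.span B"
        "C \<subseteq> lattice_points V (E - {e}) t h \<tau>" by (elim exE conjE) (rule that)
      show ?thesis
      proof (rule that[OF B(1-3) _ _ B(6)])
        show "(\<lambda>p. edge_form t h e * p) ` B \<subseteq> slims V E t h"
        proof (rule image_subsetI)
          fix p assume "p \<in> B"
          then have "p \<in> slims V (E - {e}) t h" using B(4) by (rule rev_subsetD)
          then show "edge_form t h e * p \<in> slims V E t h"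
            by (rule slims_delete[where t = t and h = h and e = e, OF fin(1) edge(3)])
        qed
        show "cutker V (E - {e}) t h \<subseteq> mpoly.span B"
          using B(5) unfolding slims_eq_cutker[OF multigraph_delete[OF edge(1)] True] .
      qed
    next
      case False
      have "V \<noteq> {}" using ends by blast
      then have "cutker V (E - {e}) t h \<subseteq> mpoly.span {}"
        using cutker_disconnected[OF False] by (simp only: mpoly.span_empty) blast
      then show ?thesis by (intro that[of "{}" "{}"]) simp_all
    qed
    have "B' \<subseteq> ?\<rho> ` slims V E t h"
      using B'(4) slims_contract[where t = t and h = h and e = e, OF edge(3) ends] by (rule subset_trans)
    then have pre: "\<exists>p. p \<in> slims V E t h \<and> ?\<rho> p = b" if "b \<in> B'" for b
      using that by blast
    define l where "l b = (SOME p. p \<in> slims V E t h \<and> ?\<rho> p = b)" for b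
    have l: "l b \<in> slims V E t h" "?\<rho> (l b) = b" if "b \<in> B'" for b
      using someI_ex[OF pre[OF that]] unfolding l_def by (rule conjunct1, rule conjunct2)
    define B where "B = l ` B' \<union> (\<lambda>p. edge_form t h e * p) ` Bd"
    have Bsub: "B \<subseteq> slims V E t h" using l Bd unfolding B_def by auto
    have "slims V E t h \<subseteq> mpoly.span B"
    proof
      fix p assume p: "p \<in> slims V E t h"
      have pk: "p \<in> cutker V E t h" using slims_subset_cutker[OF edge(1)] p by blast
      have "?\<rho> p \<in> slims (V - {?v}) (E - {e}) ?t ?h"
        using glue_cutker[where t = t and h = h and e = e, OF pk edge(3) ends]
          slims_eq_cutker[OF edge(7,8)] by blast
      then have "?\<rho> p \<in> mpoly.span B'" using B' by blast
      moreover have "B' = ?\<rho> ` l ` B'" using l by (simp add: image_image)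
      ultimately have "?\<rho> p \<in> ?\<rho> ` mpoly.span (l ` B')"
        unfolding g.span_image[symmetric] by (simp only:)
      then obtain p1 where p1: "p1 \<in> mpoly.span (l ` B')" "?\<rho> p = ?\<rho> p1" by blast
      have "mpoly.span (l ` B') \<subseteq> slims V E t h"
        using l unfolding slims_def by (intro mpoly.span_minimal mpoly.subspace_span) auto
      then have "p1 \<in> cutker V E t h" using p1 slims_subset_cutker[OF edge(1)] by blast
      then have "p - p1 \<in> cutker V E t h" using pk by (intro mpoly.subspace_diff[OF cutker_subspace])
      moreover have "?\<rho> (p - p1) = 0" using p1 by (simp add: glue_simps)
      ultimately obtain q where q: "p - p1 = (edge_form t h e - Const 0) * q" "q \<in> cutker V (E - {e}) t h"
        using cutker_factor[where t = t and h = h and e = e, OF _ _ fin(1) edge(3) ends] by blast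
      have "edge_form t h e * q \<in> (\<lambda>p. edge_form t h e * p) ` mpoly.span Bd"
        using q Bd by blast
      then have "edge_form t h e * q \<in> mpoly.span ((\<lambda>p. edge_form t h e * p) ` Bd)"
        unfolding x.span_image .
      then have "edge_form t h e * q \<in> mpoly.span B"
        unfolding B_def by (rule subsetD[OF mpoly.span_mono, rotated]) (rule Un_upper2)
      moreover have "p1 \<in> mpoly.span B"
        using p1 mpoly.span_mono[of "l ` B'" B] unfolding B_def by auto
      moreover have "p = p1 + edge_form t h e * q" using q(1) by (simp add: Const_0 algebra_simps)
      ultimately show "p \<in> mpoly.span B" by (simp add: mpoly.span_add)
    qed
    moreover have "finite B" using B' Bd unfolding B_def by simp
    moreover have "card B \<le> card B' + card Bd"
      unfolding B_def using card_Un_le[of "l ` B'"] card_image_le[OF B'(1), of l]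
        card_image_le[OF Bd(1), of "\<lambda>p. edge_form t h e * p"] by (meson add_mono order_trans)
    moreover
    define Q where "Q z' z \<longleftrightarrow> z \<in> lattice_points V E t h \<tau> \<and> (\<forall>w. w \<noteq> t e \<longrightarrow> w \<noteq> h e \<longrightarrow> z w = z' w)
      \<and> z (t e) + z (h e) = z' (t e) + 1
      \<and> (\<exists>S\<subseteq>V. t e \<in> S \<and> h e \<notin> S \<and> of_int (sum z S) < of_nat (card (inside E t h S)) + sum \<tau> S + 1)" for z' z
    define k where "k z' = (SOME z. Q z' z)" for z'
    have "Q z' (k z')" if "z' \<in> C'" for z'
      unfolding k_def
    proof (rule someI_ex[where P = "Q z'"])
      have "z' \<in> lattice_points (V - {?v}) (E - {e}) ?t ?h ?\<tau>" using B'(6) that by (rule subsetD)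
      from lattice_points_lift[where t = t and h = h and e = e, OF edge(1,3) ends(3) this]
      show "\<exists>z. Q z' z" unfolding Q_def by blast
    qed
    then have k: "\<And>z'. z' \<in> C' \<Longrightarrow> k z' \<in> lattice_points V E t h \<tau>"
      "\<And>z' w. z' \<in> C' \<Longrightarrow> w \<noteq> t e \<Longrightarrow> w \<noteq> h e \<Longrightarrow> k z' w = z' w"
      "\<And>z'. z' \<in> C' \<Longrightarrow> k z' (t e) + k z' (h e) = z' (t e) + 1"
      "\<And>z'. z' \<in> C' \<Longrightarrow> \<exists>S\<subseteq>V. t e \<in> S \<and> h e \<notin> S \<and> of_int (sum (k z') S) < of_nat (card (inside E t h S)) + sum \<tau> S + 1"
      unfolding Q_def by blast+
    define d where "d z = z(t e := z (t e) + 1)" for z :: "'a \<Rightarrow> int"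
    have "inj_on k C'"
    proof (rule inj_onI, rule ext)
      fix z1 z2 w assume z: "z1 \<in> C'" "z2 \<in> C'" "k z1 = k z2"
      have "z1 ?v = 0" "z2 ?v = 0" using z B'(6) by (auto simp: lattice_points_def)
      then show "z1 w = z2 w"
        using k(2)[OF z(1), of w] k(2)[OF z(2), of w] k(3)[OF z(1)] k(3)[OF z(2)] z(3)
        by (cases "w = ?u"; cases "w = ?v") auto
    qed
    moreover have "inj_on d Cd"
    proof (rule inj_onI, rule ext)
      fix z1 z2 w assume "d z1 = d z2"
      then have "d z1 w = d z2 w" by simp
      then show "z1 w = z2 w" by (simp add: d_def split: if_splits)
    qed
    moreover have "k ` C' \<inter> d ` Cd = {}"
    proof (rule ccontr)
      assume "k ` C' \<inter> d ` Cd \<noteq> {}"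
      then obtain z' z where z: "z' \<in> C'" "z \<in> Cd" "k z' = d z" by blast
      obtain S where S: "S \<subseteq> V" "t e \<in> S" "h e \<notin> S"
        "of_int (sum (k z') S) < of_nat (card (inside E t h S)) + sum \<tau> S + 1" using k(4)[OF z(1)] by blast
      have "of_nat (card (inside E t h S)) + sum \<tau> S + 1 \<le> of_int (sum (d z) S)"
        unfolding d_def using z Bd(6) S
        by (intro lattice_points_delete(2)[where t = t and h = h and e = e, OF edge(1,3) ends(3)]) auto
      then show False using S z by simp
    qed
    moreover have "d ` Cd \<subseteq> lattice_points V E t h \<tau>"
      unfolding d_def using Bd(6) lattice_points_delete(1)[where t = t and h = h and e = e, OF edge(1,3) ends(3)]
      by blast
    ultimately show "\<exists>B C. finite B \<and> finite C \<and> card B \<le> card C \<and>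
        B \<subseteq> slims V E t h \<and> slims V E t h \<subseteq> mpoly.span B \<and> C \<subseteq> lattice_points V E t h \<tau>"
      using Bsub k(1) B'(2,3) Bd(2,3)
      by (intro exI[of _ B] exI[of _ "k ` C' \<union> d ` Cd"]) (auto simp: card_Un_disjoint card_image)
  qed
qed

section \<open>Power sums of linear forms\<close>

definition lin_form :: "'v set \<Rightarrow> ('v \<Rightarrow>\<^sub>0 nat) \<Rightarrow> 'v mpoly" where
  "lin_form V m = (\<Sum>v\<in>V. mscale (of_nat (Poly_Mapping.lookup m v)) (Var v))"

text \<open>
  A polynomial serves here as a function \<open>\<phi>\<close> on the exponents \<open>m\<close> of its monomials. Its \<open>d\<close>-th power sum
  is \<open>d!\<close> times the part of degree \<open>d\<close> in the exponential sum with frequencies \<open>m\<close> and coefficients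
  \<open>\<phi>(m)\<close>.
\<close>

definition psum :: "'v set \<Rightarrow> nat \<Rightarrow> 'v mpoly \<Rightarrow> 'v mpoly" where
  "psum V d p = lext Const (\<lambda>m. lin_form V m ^ d) p"

definition supported :: "('v \<Rightarrow>\<^sub>0 nat) set \<Rightarrow> 'v mpoly set" where
  "supported M = {p. Poly_Mapping.keys p \<subseteq> M}"

lemma linear_psum: "Vector_Spaces.linear mscale mscale (psum V d)"
proof -
  have "psum V d = lext Const (\<lambda>m. lin_form V m ^ d)" by (rule ext) (rule psum_def)
  then show ?thesis by (simp only: linear_lext_Const)
qed

interpretation psum: Vector_Spaces.linear mscale mscale "psum V d" for V d
  by (rule linear_psum)

lemma psum_supported:
  assumes "finite M" "p \<in> supported M"
  shows "psum V d p = (\<Sum>m\<in>M. Const (Poly_Mapping.lookup p m) * lin_form V m ^ d)"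
  unfolding psum_def using assms
  by (intro coeff_hom.lext_superset[OF coeff_hom_Const]) (simp_all add: supported_def)

lemma supported_subspace: "mpoly.subspace (supported M)"
proof -
  have "keys_sub": "Poly_Mapping.keys (mscale c p) \<subseteq> Poly_Mapping.keys p" for c and p :: "'a mpoly"
    by (auto simp: in_keys_iff lookup_mscale)
  show ?thesis
    unfolding mpoly.subspace_def supported_def
  proof (intro conjI ballI allI; unfold mem_Collect_eq)
    show "Poly_Mapping.keys (0 :: 'a mpoly) \<subseteq> M" by simp
    show "Poly_Mapping.keys (x + y) \<subseteq> M" if "Poly_Mapping.keys x \<subseteq> M" "Poly_Mapping.keys y \<subseteq> M" for x y :: "'a mpoly"
      using that keys_add[of x y] by blast
    show "Poly_Mapping.keys (mscale c x) \<subseteq> M" if "Poly_Mapping.keys x \<subseteq> M" for c and x :: "'a mpoly"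
      using that keys_sub[of c x] by blast
  qed
qed

lemma mscale_single_1: "mscale c (Poly_Mapping.single m 1) = Poly_Mapping.single m c"
  by (simp add: mscale_def Const_def mult_single)

lemma supported_span: "supported M \<subseteq> mpoly.span ((\<lambda>m. Poly_Mapping.single m 1) ` M)"
proof
  fix p assume "p \<in> supported M"
  then have "mscale (Poly_Mapping.lookup p m) (Poly_Mapping.single m 1) \<in> mpoly.span ((\<lambda>m. Poly_Mapping.single m 1) ` M)"
    if "m \<in> Poly_Mapping.keys p" for m
    using that by (intro mpoly.span_scale mpoly.span_base imageI) (auto simp: supported_def)
  then have "Poly_Mapping.single m (Poly_Mapping.lookup p m) \<in> mpoly.span ((\<lambda>m. Poly_Mapping.single m 1) ` M)"
    if "m \<in> Poly_Mapping.keys p" for m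
    using that by (simp only: mscale_single_1)
  then show "p \<in> mpoly.span ((\<lambda>m. Poly_Mapping.single m 1) ` M)"
    by (subst mpoly_eq_sum_single) (rule mpoly.span_sum)
qed

lemma dim_supported:
  assumes "finite M"
  shows "mpoly.dim (supported M) = card M"
proof -
  let ?s = "\<lambda>m. Poly_Mapping.single m (1 :: rat)"
  have inj: "inj_on ?s M"
  proof (rule inj_onI)
    fix x y assume "?s x = ?s y"
    then have "Poly_Mapping.keys (?s x) = Poly_Mapping.keys (?s y)" by (rule arg_cong)
    then show "x = y" by simp
  qed
  have lk: "Poly_Mapping.lookup (\<Sum>x\<in>M. mscale (f (?s x)) (?s x)) m = f (?s m)" if "m \<in> M" for f m
    using assms that
    by (simp add: mscale_single_1 lookup_sum lookup_single when_def sum.delta')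
  have "mpoly.independent (?s ` M)"
  proof (rule mpoly.independent_if_scalars_zero)
    show "finite (?s ` M)" using assms by simp
    fix f x assume "(\<Sum>x\<in>?s ` M. mscale (f x) x) = 0" and x: "x \<in> ?s ` M"
    then have "(\<Sum>x\<in>M. mscale (f (?s x)) (?s x)) = 0" by (simp add: sum.reindex[OF inj])
    moreover obtain m where "m \<in> M" "x = ?s m" using x by blast
    ultimately show "f x = 0" using lk[of m f] by simp
  qed
  then show ?thesis
    using card_image[OF inj] supported_span
    by (intro mpoly.dim_unique[of "?s ` M"]) (auto simp: supported_def)
qed

lemma rat_poly_vanishing:
  fixes X :: "rat set"
  assumes "finite X"
  shows "degree (\<Prod>x\<in>X. [:- x, 1:]) = card X" "lead_coeff (\<Prod>x\<in>X. [:- x, 1:]) = 1"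
    "y \<in> X \<Longrightarrow> poly (\<Prod>x\<in>X. [:- x, 1:]) y = 0" "y \<notin> X \<Longrightarrow> poly (\<Prod>x\<in>X. [:- x, 1:]) y \<noteq> 0"
proof -
  show "degree (\<Prod>x\<in>X. [:- x, 1:]) = card X"
    by (subst degree_prod_eq_sum_degree) simp_all
  show "lead_coeff (\<Prod>x\<in>X. [:- x, 1:]) = 1" by (subst lead_coeff_prod) simp
  show "poly (\<Prod>x\<in>X. [:- x, 1:]) y = 0" if "y \<in> X"
    unfolding poly_prod using assms that by (intro prod_zero) auto
  show "poly (\<Prod>x\<in>X. [:- x, 1:]) y \<noteq> 0" if "y \<notin> X"
    unfolding poly_prod using assms that by (subst prod_zero_iff) auto
qed

text \<open>
  The point has the form \<open>\<theta>\<^sub>v = x ^ idx v\<close>; then the values to be separated are values at \<open>x\<close> of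
  distinct univariate polynomials.
\<close>

lemma separating_point:
  assumes "finite V" "finite M" and keys: "\<And>m. m \<in> M \<Longrightarrow> Poly_Mapping.keys m \<subseteq> V"
  shows "\<exists>\<theta> :: 'v \<Rightarrow> rat. inj_on (\<lambda>m. \<Sum>v\<in>V. of_nat (Poly_Mapping.lookup m v) * \<theta> v) M"
proof -
  obtain idx :: "'v \<Rightarrow> nat" where idx: "inj_on idx V"
    using finite_imp_inj_to_nat_seg[OF assms(1)] by blast
  define f :: "('v \<Rightarrow>\<^sub>0 nat) \<Rightarrow> rat poly" where
    "f m = (\<Sum>v\<in>V. monom (of_nat (Poly_Mapping.lookup m v)) (idx v))" for m
  have coeff: "coeff (f m) (idx w) = of_nat (Poly_Mapping.lookup m w)" if "w \<in> V" for m w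
  proof -
    have "coeff (f m) (idx w) = (\<Sum>v\<in>V. if v = w then of_nat (Poly_Mapping.lookup m v) else 0)"
      unfolding f_def coeff_sum using that idx by (intro sum.cong) (auto simp: inj_on_def)
    then show ?thesis using that assms(1) by simp
  qed
  have f_inj: "f m \<noteq> f n" if "m \<in> M" "n \<in> M" "m \<noteq> n" for m n
  proof
    assume eq: "f m = f n"
    have "m = n"
    proof (rule poly_mapping_eqI)
      fix w
      show "Poly_Mapping.lookup m w = Poly_Mapping.lookup n w"
      proof (cases "w \<in> V")
        case True then show ?thesis using coeff[of w m] coeff[of w n] eq by simp
      next
        case False
        then have "w \<notin> Poly_Mapping.keys m" "w \<notin> Poly_Mapping.keys n" using keys that by blast+
        then show ?thesis by (simp add: in_keys_iff)
      qed
    qed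
    then show False using that by simp
  qed
  have "finite (\<Union>(m, n)\<in>{(m, n). m \<in> M \<and> n \<in> M \<and> m \<noteq> n}. {x. poly (f m - f n) x = 0})"
  proof (rule finite_UN_I)
    show "finite {(m, n). m \<in> M \<and> n \<in> M \<and> m \<noteq> n}"
      by (rule finite_subset[of _ "M \<times> M"]) (use assms(2) in auto)
  next
    fix q assume "q \<in> {(m, n). m \<in> M \<and> n \<in> M \<and> m \<noteq> n}"
    then obtain m n where q: "q = (m, n)" "f m \<noteq> f n" using f_inj by auto
    then have "finite {x. poly (f m - f n) x = 0}" by (intro poly_roots_finite) simp
    then show "finite (case q of (m, n) \<Rightarrow> {x. poly (f m - f n) x = 0})" by (simp only: q prod.case)
  qed
  then obtain x where x: "x \<notin> (\<Union>(m, n)\<in>{(m, n). m \<in> M \<and> n \<in> M \<and> m \<noteq> n}. {x. poly (f m - f n) x = 0})"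
    using ex_new_if_finite[OF infinite_UNIV_char_0] by blast
  have pf: "poly (f m) x = (\<Sum>v\<in>V. of_nat (Poly_Mapping.lookup m v) * x ^ idx v)" for m
    by (simp add: f_def poly_sum poly_monom)
  have "inj_on (\<lambda>m. poly (f m) x) M"
    by (rule inj_onI, rule ccontr) (use x in auto)
  then have "inj_on (\<lambda>m. \<Sum>v\<in>V. of_nat (Poly_Mapping.lookup m v) * x ^ idx v) M" by (simp only: pf)
  then show ?thesis by (rule exI[where x = "\<lambda>v. x ^ idx v"])
qed

text \<open>
  At a separating point the power sums become power moments of the coefficients, and a polynomial that
  vanishes at all but one of the nodes isolates one coefficient.
\<close>

lemma psum_joint_injective:
  assumes "finite V" "finite M" and keys: "\<And>m. m \<in> M \<Longrightarrow> Poly_Mapping.keys m \<subseteq> V"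
    and p: "p \<in> supported M" and z: "\<And>i. i < card M \<Longrightarrow> psum V i p = 0"
  shows "p = 0"
proof -
  obtain \<theta> :: "'a \<Rightarrow> rat" where inj: "inj_on (\<lambda>m. \<Sum>v\<in>V. of_nat (Poly_Mapping.lookup m v) * \<theta> v) M"
    using separating_point[OF assms(1,2) keys] by blast
  define lam where "lam m = (\<Sum>v\<in>V. of_nat (Poly_Mapping.lookup m v) * \<theta> v)" for m
  have eval_at: "eval_at \<theta> (lin_form V m) = lam m" for m
    by (simp add: lin_form_def lam_def eval_at_simps mscale_def)
  have mom: "(\<Sum>m\<in>M. Poly_Mapping.lookup p m * lam m ^ i) = 0" if "i < card M" for i
  proof -
    have "eval_at \<theta> (psum V i p) = (\<Sum>m\<in>M. Poly_Mapping.lookup p m * lam m ^ i)"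
      unfolding psum_supported[OF assms(2) p] by (simp add: eval_at_simps eval_at)
    then show ?thesis unfolding z[OF that] by (simp add: eval_at_simps)
  qed
  have "Poly_Mapping.lookup p m0 = 0" if m0: "m0 \<in> M" for m0
  proof -
    let ?X = "lam ` (M - {m0})"
    define r where "r = (\<Prod>x\<in>?X. [:- x, 1:])"
    have fX: "finite ?X" using assms(2) by simp
    have "card ?X \<le> card (M - {m0})" using assms(2) by (intro card_image_le) simp
    also have "\<dots> < card M" using assms(2) m0 by (rule card_Diff1_less)
    finally have deg: "degree r < card M" unfolding r_def rat_poly_vanishing(1)[OF fX] .
    have "(\<Sum>m\<in>M. Poly_Mapping.lookup p m * poly r (lam m))
        = (\<Sum>m\<in>M. \<Sum>i\<le>degree r. coeff r i * (Poly_Mapping.lookup p m * lam m ^ i))"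
      by (simp add: poly_altdef sum_distrib_left mult.left_commute)
    also have "\<dots> = (\<Sum>i\<le>degree r. coeff r i * (\<Sum>m\<in>M. Poly_Mapping.lookup p m * lam m ^ i))"
      by (subst sum.swap) (simp add: sum_distrib_left)
    also have "\<dots> = 0" using deg mom by (intro sum.neutral) auto
    finally have "(\<Sum>m\<in>M. Poly_Mapping.lookup p m * poly r (lam m)) = 0" .
    moreover have "poly r (lam m) = 0" if "m \<in> M - {m0}" for m
      unfolding r_def using that by (intro rat_poly_vanishing(3)[OF fX]) auto
    ultimately have "Poly_Mapping.lookup p m0 * poly r (lam m0) = 0"
      using m0 assms(2) by (simp add: sum.remove)
    moreover have "lam m0 \<notin> ?X" using inj m0 unfolding lam_def inj_on_def by blast
    then have "poly r (lam m0) \<noteq> 0" unfolding r_def by (rule rat_poly_vanishing(4)[OF fX])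
    ultimately show ?thesis by simp
  qed
  moreover have "Poly_Mapping.lookup p m = 0" if "m \<notin> M" for m
    using p that by (auto simp: supported_def in_keys_iff)
  ultimately show ?thesis by (intro poly_mapping_eqI) (metis lookup_zero)
qed

text \<open>
  The three properties of the set of break divisors that matter for power sums: finiteness, constant
  total degree, and few values on each cut.
\<close>

locale bounded_width =
  fixes V :: "'v set" and E :: "'e set" and t h :: "'e \<Rightarrow> 'v" and M :: "('v \<Rightarrow>\<^sub>0 nat) set" and g :: nat
  assumes graph: "multigraph V E t h" and conn: "conn V E t h" and finM: "finite M"
    and keysM: "\<And>m. m \<in> M \<Longrightarrow> Poly_Mapping.keys m \<subseteq> V"
    and total: "\<And>m. m \<in> M \<Longrightarrow> (\<Sum>v\<in>V. Poly_Mapping.lookup m v) = g"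
    and width: "\<And>S. proper V S \<Longrightarrow> \<exists>l::int. \<forall>m\<in>M. l \<le> int (\<Sum>v\<in>S. Poly_Mapping.lookup m v)
      \<and> int (\<Sum>v\<in>S. Poly_Mapping.lookup m v) < l + int (card (cut_edges E t h S))"
begin

lemma finV: "finite V" and finE: "finite E"
  using graph by (simp_all add: multigraph_def)

text \<open>
  In the binomial expansion all power sums of lower order vanish.
\<close>

lemma psum_translate:
  assumes p: "p \<in> supported M" and z: "\<And>i. i < d \<Longrightarrow> psum V i p = 0"
  shows "(\<Sum>m\<in>M. Const (Poly_Mapping.lookup p m) * (lin_form V m + y) ^ d) = psum V d p"
proof -
  have "(\<Sum>m\<in>M. Const (Poly_Mapping.lookup p m) * (lin_form V m + y) ^ d)
      = (\<Sum>m\<in>M. \<Sum>k\<le>d. (of_nat (d choose k) * y ^ (d - k)) * (Const (Poly_Mapping.lookup p m) * lin_form V m ^ k))"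
    unfolding binomial_ring sum_distrib_left by (intro sum.cong refl) (simp only: mult_ac)
  also have "\<dots> = (\<Sum>k\<le>d. (of_nat (d choose k) * y ^ (d - k)) * psum V k p)"
    unfolding psum_supported[OF finM p] sum_distrib_left by (rule sum.swap)
  also have "\<dots> = (\<Sum>k\<in>{d}. (of_nat (d choose k) * y ^ (d - k)) * psum V k p)"
    using z by (intro sum.mono_neutral_right) auto
  finally show ?thesis by simp
qed

text \<open>
  Subtracting \<open>g x\<^sub>r\<close> from the linear form with coefficients \<open>m\<close> turns it into a combination of
  differences, because the coefficients sum to \<open>g\<close>.
\<close>

lemma psum_diffalg:
  assumes p: "p \<in> supported M" and z: "\<And>i. i < d \<Longrightarrow> psum V i p = 0"
  shows "psum V d p \<in> diffalg V"
proof -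
  obtain r where r: "r \<in> V" using conn by (auto simp: conn_def)
  define y where "y = - mscale (of_nat g) (Var r)"
  have "lin_form V m + y \<in> diffalg V" if "m \<in> M" for m
  proof -
    have "mscale (of_nat g) (Var r) = (\<Sum>v\<in>V. mscale (of_nat (Poly_Mapping.lookup m v)) (Var r))"
      unfolding total[OF that, symmetric] of_nat_sum by (rule mpoly.scale_sum_left)
    then have "lin_form V m + y = (\<Sum>v\<in>V. mscale (of_nat (Poly_Mapping.lookup m v)) (Var v - Var r))"
      by (simp add: lin_form_def y_def sum_subtractf mpoly.scale_right_diff_distrib)
    moreover have "(\<Sum>v\<in>V. mscale (of_nat (Poly_Mapping.lookup m v)) (Var v - Var r)) \<in> diffalg V"
      by (intro mpoly.subspace_sum[OF diffalg_subspace] diffalg_scale diffalg_Var_diff r)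
    ultimately show ?thesis by (simp only:)
  qed
  then have "(\<Sum>m\<in>M. mscale (Poly_Mapping.lookup p m) ((lin_form V m + y) ^ d)) \<in> diffalg V"
    by (intro mpoly.subspace_sum[OF diffalg_subspace] diffalg_scale diffalg_power)
  then show ?thesis by (simp only: mscale_def psum_translate[OF p z])
qed

definition weight :: "'v set \<Rightarrow> ('v \<Rightarrow>\<^sub>0 nat) \<Rightarrow> rat" where
  "weight S m = of_nat (\<Sum>v\<in>S. Poly_Mapping.lookup m v)"

definition moment :: "'v set \<Rightarrow> 'v mpoly \<Rightarrow> nat \<Rightarrow> nat \<Rightarrow> 'v mpoly" where
  "moment S p i j = (\<Sum>m\<in>M. Const (Poly_Mapping.lookup p m * weight S m ^ i) * lin_form V m ^ j)"

lemma shift_lin_form: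
  assumes "S \<subseteq> V"
  shows "shift S (lin_form V m) = [:lin_form V m, Const (weight S m):]"
proof -
  have sum_pCons: "(\<Sum>v\<in>X. [:a v, b v:]) = [:sum a X, sum b X:]" for X and a b :: "'v \<Rightarrow> 'v mpoly"
    by (induction X rule: infinite_finite_induct) simp_all
  have "shift S (lin_form V m) = (\<Sum>v\<in>V. [:mscale (of_nat (Poly_Mapping.lookup m v)) (Var v),
      if v \<in> S then Const (of_nat (Poly_Mapping.lookup m v)) else 0:])"
    unfolding lin_form_def hom_sum[OF is_hom_shift]
    by (intro sum.cong refl) (simp add: mscale_def shift_simps)
  also have "\<dots> = [:lin_form V m, \<Sum>v\<in>V. if v \<in> S then Const (of_nat (Poly_Mapping.lookup m v)) else 0:]"
    unfolding sum_pCons lin_form_def ..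
  also have "(\<Sum>v\<in>V. if v \<in> S then Const (of_nat (Poly_Mapping.lookup m v)) else 0)
      = (\<Sum>v\<in>S. Const (of_nat (Poly_Mapping.lookup m v)) :: 'v mpoly)"
    using assms finV by (simp add: sum.inter_restrict[symmetric] Int_absorb1)
  also have "\<dots> = Const (weight S m)"
    by (simp only: weight_def Const_of_nat) (simp only: of_nat_sum)
  finally show ?thesis .
qed

lemma coeff_shift_psum:
  assumes p: "p \<in> supported M" and S: "S \<subseteq> V" and i: "i \<le> d"
  shows "coeff (shift S (psum V d p)) i = of_nat (d choose i) * moment S p i (d - i)"
proof -
  have "coeff (shift S (psum V d p)) i
      = (\<Sum>m\<in>M. coeff ([:Const (Poly_Mapping.lookup p m):] * [:lin_form V m, Const (weight S m):] ^ d) i)"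
    unfolding psum_supported[OF finM p] by (simp only: shift_simps shift_lin_form[OF S] coeff_sum)
  also have "\<dots> = (\<Sum>m\<in>M. of_nat (d choose i) * (Const (Poly_Mapping.lookup p m * weight S m ^ i) * lin_form V m ^ (d - i)))"
  proof (intro sum.cong refl)
    fix m
    have "coeff ([:Const (Poly_Mapping.lookup p m):] * [:lin_form V m, Const (weight S m):] ^ d) i
        = Const (Poly_Mapping.lookup p m) * coeff ([:lin_form V m, Const (weight S m):] ^ d) i"
      by simp
    also have "\<dots> = Const (Poly_Mapping.lookup p m) * (of_nat (d choose i) * Const (weight S m) ^ i * lin_form V m ^ (d - i))"
      by (simp only: coeff_linear_poly_power[OF i])
    also have "\<dots> = of_nat (d choose i) * (Const (Poly_Mapping.lookup p m * weight S m ^ i) * lin_form V m ^ (d - i))"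
      by (simp only: Const_mult Const_power mult_ac)
    finally show "coeff ([:Const (Poly_Mapping.lookup p m):] * [:lin_form V m, Const (weight S m):] ^ d) i
        = of_nat (d choose i) * (Const (Poly_Mapping.lookup p m * weight S m ^ i) * lin_form V m ^ (d - i))" .
  qed
  finally show ?thesis unfolding moment_def sum_distrib_left .
qed

lemma of_nat_mult_eq_0: "of_nat n * (x :: 'v mpoly) = 0 \<Longrightarrow> n \<noteq> 0 \<Longrightarrow> x = 0"
  using mpoly.scale_eq_0_iff[of "of_nat n" x] by (simp add: mscale_def Const_of_nat)

lemma moment_eq_0:
  assumes p: "p \<in> supported M" and S: "S \<subseteq> V" and z: "psum V (i + j) p = 0"
  shows "moment S p i j = 0"
proof -
  have "of_nat (i + j choose i) * moment S p i j = 0"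
    using coeff_shift_psum[OF p S, of i "i + j"] z by (simp add: shift_simps)
  then show ?thesis by (rule of_nat_mult_eq_0) simp
qed

text \<open>
  On the exponents in \<open>M\<close> the weight \<open>w\<close> of \<open>S\<close> takes at most as many values as \<open>S\<close> has leaving edges. So
  \<open>w\<^sup>i\<close> agrees there with a polynomial in \<open>w\<close> of degree less than \<open>i\<close>, and the moment is a combination of
  moments of lower total order.
\<close>

lemma moment_top_eq_0:
  assumes p: "p \<in> supported M" and z: "\<And>i. i < d \<Longrightarrow> psum V i p = 0"
    and S: "proper V S" and i: "card (cut_edges E t h S) \<le> i" "i \<le> d"
  shows "moment S p i (d - i) = 0"
proof -
  obtain l :: int where l: "\<And>m. m \<in> M \<Longrightarrow> l \<le> int (\<Sum>v\<in>S. Poly_Mapping.lookup m v)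
      \<and> int (\<Sum>v\<in>S. Poly_Mapping.lookup m v) < l + int (card (cut_edges E t h S))"
    using width[OF S] by blast
  define X :: "rat set" where "X = of_int ` {l..<l + int (card (cut_edges E t h S))}"
  have fX: "finite X" by (simp add: X_def)
  have cX: "card X = card (cut_edges E t h S)" unfolding X_def by (subst card_image) (auto simp: inj_on_def)
  \<comment> \<open>Monic of degree \<open>i\<close>, and zero at all weights that occur.\<close>
  define r where "r = monom 1 (i - card X) * (\<Prod>x\<in>X. [:- x, 1:])"
  have dr: "degree r = i"
    unfolding r_def using i fX cX rat_poly_vanishing(1,2)[OF fX]
    by (subst degree_mult_eq) (auto simp: degree_monom_eq)
  have "lead_coeff r = 1"
    unfolding r_def lead_coeff_mult rat_poly_vanishing(2)[OF fX] by (simp add: degree_monom_eq)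
  then have lr: "coeff r i = 1" unfolding dr .
  have pr: "poly r (weight S m) = 0" if "m \<in> M" for m
  proof -
    have "weight S m = of_int (int (\<Sum>v\<in>S. Poly_Mapping.lookup m v))" by (simp add: weight_def)
    then have "weight S m \<in> X" unfolding X_def using l[OF that] by (intro image_eqI) auto
    then show ?thesis unfolding r_def poly_mult using rat_poly_vanishing(3)[OF fX] by simp
  qed
  have SV: "S \<subseteq> V" using S by (simp add: proper_def)
  have "(\<Sum>n\<le>i. Const (coeff r n) * moment S p n (d - i))
      = (\<Sum>n\<le>i. \<Sum>m\<in>M. Const (coeff r n * (Poly_Mapping.lookup p m * weight S m ^ n)) * lin_form V m ^ (d - i))"
    unfolding moment_def sum_distrib_left Const_mult by (intro sum.cong refl) (simp only: mult_ac)
  also have "\<dots> = (\<Sum>m\<in>M. \<Sum>n\<le>i. Const (coeff r n * (Poly_Mapping.lookup p m * weight S m ^ n)) * lin_form V m ^ (d - i))"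
    by (rule sum.swap)
  also have "\<dots> = (\<Sum>m\<in>M. Const (Poly_Mapping.lookup p m * poly r (weight S m)) * lin_form V m ^ (d - i))"
  proof (intro sum.cong refl)
    fix m
    have Const_sum: "Const (sum f A) = (\<Sum>x\<in>A. Const (f x) :: 'v mpoly)" for f and A :: "nat set"
      by (induction A rule: infinite_finite_induct) (simp_all add: Const_0 Const_add)
    have "Poly_Mapping.lookup p m * poly r (weight S m) = (\<Sum>n\<le>i. coeff r n * (Poly_Mapping.lookup p m * weight S m ^ n))"
      unfolding poly_altdef dr sum_distrib_left by (intro sum.cong refl) (simp only: mult_ac)
    then show "(\<Sum>n\<le>i. Const (coeff r n * (Poly_Mapping.lookup p m * weight S m ^ n)) * lin_form V m ^ (d - i))
        = Const (Poly_Mapping.lookup p m * poly r (weight S m)) * lin_form V m ^ (d - i)"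
      by (simp only: Const_sum sum_distrib_right)
  qed
  also have "\<dots> = 0" using pr by (intro sum.neutral) (simp add: Const_0)
  finally have "(\<Sum>n\<le>i. Const (coeff r n) * moment S p n (d - i)) = 0" .
  moreover have "(\<Sum>n\<le>i. Const (coeff r n) * moment S p n (d - i))
      = (\<Sum>n\<in>{i}. Const (coeff r n) * moment S p n (d - i))"
  proof (intro sum.mono_neutral_right)
    show "\<forall>n\<in>{..i} - {i}. Const (coeff r n) * moment S p n (d - i) = 0"
    proof
      fix n assume "n \<in> {..i} - {i}"
      then have "n + (d - i) < d" using i by auto
      then have "moment S p n (d - i) = 0" by (intro moment_eq_0 p SV z)
      then show "Const (coeff r n) * moment S p n (d - i) = 0" by simp
    qed
  qed auto
  ultimately show ?thesis by (simp add: lr Const_1)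
qed

lemma homogeneous_psum: "homogeneous d (psum V d p)"
proof -
  have hs: "homogeneous k (mscale c x)" if "homogeneous k x" for k c and x :: "'v mpoly"
    using mpoly.subspace_scale[OF homogeneous_subspace[of k], of x c] that unfolding mem_Collect_eq .
  have hsum: "homogeneous k (sum f X)" if "\<And>x. x \<in> X \<Longrightarrow> homogeneous k (f x)" for k X and f :: "'x \<Rightarrow> 'v mpoly"
    using mpoly.subspace_sum[OF homogeneous_subspace[of k], of X f] that unfolding mem_Collect_eq .
  have "homogeneous 1 (lin_form V m)" for m
    unfolding lin_form_def
    using mpoly.subspace_sum[OF homogeneous_subspace[of 1], of V "\<lambda>v. mscale (of_nat (Poly_Mapping.lookup m v)) (Var v)"]
      hs[OF homogeneous_Var] unfolding mem_Collect_eq by blast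
  then have "homogeneous d (lin_form V m ^ d)" for m
  proof (induction d)
    case 0 then show ?case by (simp add: homogeneous_1)
  next
    case (Suc d)
    from homogeneous_mult[OF Suc(2) Suc(1)[OF Suc(2)]] show ?case by simp
  qed
  then have "homogeneous d (mscale (Poly_Mapping.lookup p m) (lin_form V m ^ d))" for m by (rule hs)
  then show ?thesis
    unfolding psum_def lext_def
    using mpoly.subspace_sum[OF homogeneous_subspace[of d], of "Poly_Mapping.keys p"
        "\<lambda>m. mscale (Poly_Mapping.lookup p m) (lin_form V m ^ d)"]
    unfolding mem_Collect_eq mscale_def by blast
qed

text \<open>
  The coefficients of the shifted power sum in the variable \<open>T\<close> are moments, so \<open>moment_top_eq_0\<close>
  bounds its degree by the size of the cut.
\<close>

lemma psum_slims:
  assumes p: "p \<in> supported M" and z: "\<And>i. i < d \<Longrightarrow> psum V i p = 0"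
  shows "psum V d p \<in> slims V E t h"
proof -
  have "coeff (shift S (psum V d p)) i = 0" if S: "proper V S" and i: "card (cut_edges E t h S) \<le> i" for S i
  proof (cases "i \<le> d")
    case True
    have "S \<subseteq> V" using S by (simp add: proper_def)
    from coeff_shift_psum[OF p this True] moment_top_eq_0[OF p z S i True]
    show ?thesis by simp
  next
    case False
    have "degree (shift S (psum V d p)) \<le> d"
    proof -
      have "S \<subseteq> V" using S by (simp add: proper_def)
      then have "shift S (psum V d p) = (\<Sum>m\<in>M. [:Const (Poly_Mapping.lookup p m):] * [:lin_form V m, Const (weight S m):] ^ d)"
        unfolding psum_supported[OF finM p] by (simp only: shift_simps shift_lin_form)
      moreover have "degree ([:Const (Poly_Mapping.lookup p m):] * [:lin_form V m, Const (weight S m):] ^ d) \<le> d" for m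
      proof -
        have "degree ([:lin_form V m, Const (weight S m):] ^ d) \<le> degree [:lin_form V m, Const (weight S m):] * d"
          by (rule degree_power_le)
        also have "\<dots> \<le> 1 * d" by (intro mult_right_mono) auto
        finally have "degree ([:lin_form V m, Const (weight S m):] ^ d) \<le> d" by simp
        then show ?thesis by (simp add: degree_smult_le order_trans[OF degree_smult_le])
      qed
      ultimately show ?thesis by (simp only:) (rule degree_sum_le[OF finM])
    qed
    then show ?thesis using False by (intro coeff_eq_0) simp
  qed
  then have "psum V d p \<in> cutker V E t h"
    using psum_diffalg[OF p z] unfolding cutker_def by simp
  then show ?thesis unfolding slims_eq_cutker[OF graph conn] .
qed

end

section \<open>Group actions\<close>

definition perm_group :: "'v set \<Rightarrow> ('v \<Rightarrow> 'v) set \<Rightarrow> bool" where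
  "perm_group V S \<longleftrightarrow> id \<in> S \<and> (\<forall>\<pi>\<in>S. \<pi> permutes V) \<and> (\<forall>\<pi>\<in>S. inv \<pi> \<in> S) \<and> (\<forall>\<pi>\<in>S. \<forall>\<rho>\<in>S. \<pi> \<circ> \<rho> \<in> S)"

lemma perm_group_finite: "finite V \<Longrightarrow> perm_group V S \<Longrightarrow> finite S"
  by (rule finite_subset[OF _ finite_permutations[of V]]) (auto simp: perm_group_def)

definition act :: "('v \<Rightarrow> 'v) \<Rightarrow> ('v \<Rightarrow>\<^sub>0 nat) \<Rightarrow> ('v \<Rightarrow>\<^sub>0 nat)" where
  "act \<pi> m = Abs_poly_mapping (Poly_Mapping.lookup m \<circ> inv \<pi>)"

lemma lookup_act:
  assumes "bij \<pi>"
  shows "Poly_Mapping.lookup (act \<pi> m) v = Poly_Mapping.lookup m (inv \<pi> v)"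
proof -
  have "{v. (Poly_Mapping.lookup m \<circ> inv \<pi>) v \<noteq> 0} \<subseteq> \<pi> ` Poly_Mapping.keys m"
  proof
    fix v assume "v \<in> {v. (Poly_Mapping.lookup m \<circ> inv \<pi>) v \<noteq> 0}"
    then have "inv \<pi> v \<in> Poly_Mapping.keys m" by (simp add: in_keys_iff)
    moreover have "v = \<pi> (inv \<pi> v)" using assms by (simp add: bij_is_surj surj_f_inv_f)
    ultimately show "v \<in> \<pi> ` Poly_Mapping.keys m" by blast
  qed
  then have "finite {v. (Poly_Mapping.lookup m \<circ> inv \<pi>) v \<noteq> 0}" by (rule finite_subset) simp
  then show ?thesis unfolding act_def by (subst lookup_Abs_poly_mapping) simp_all
qed

lemma act_compose: "bij \<pi> \<Longrightarrow> bij \<rho> \<Longrightarrow> act (\<pi> \<circ> \<rho>) m = act \<pi> (act \<rho> m)"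
  by (rule poly_mapping_eqI) (simp add: lookup_act bij_comp o_inv_distrib)

lemma act_id: "act id m = m"
  by (rule poly_mapping_eqI) (simp add: lookup_act)

lemma act_inj: "bij \<pi> \<Longrightarrow> act \<pi> m = act \<pi> n \<longleftrightarrow> m = n"
proof
  assume b: "bij \<pi>" and eq: "act \<pi> m = act \<pi> n"
  show "m = n"
  proof (rule poly_mapping_eqI)
    fix v
    have "Poly_Mapping.lookup (act \<pi> m) (\<pi> v) = Poly_Mapping.lookup (act \<pi> n) (\<pi> v)" using eq by simp
    then show "Poly_Mapping.lookup m v = Poly_Mapping.lookup n v"
      using b by (simp add: lookup_act bij_is_inj)
  qed
qed simp

lemma keys_act: "bij \<pi> \<Longrightarrow> Poly_Mapping.keys (act \<pi> m) = \<pi> ` Poly_Mapping.keys m"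
proof -
  assume b: "bij \<pi>"
  have "v \<in> \<pi> ` Poly_Mapping.keys m \<longleftrightarrow> inv \<pi> v \<in> Poly_Mapping.keys m" for v
  proof
    assume "v \<in> \<pi> ` Poly_Mapping.keys m"
    then show "inv \<pi> v \<in> Poly_Mapping.keys m" using b by (auto simp: bij_is_inj)
  next
    assume "inv \<pi> v \<in> Poly_Mapping.keys m"
    moreover have "\<pi> (inv \<pi> v) = v" using b by (simp add: bij_is_surj surj_f_inv_f)
    ultimately show "v \<in> \<pi> ` Poly_Mapping.keys m" by (metis imageI)
  qed
  note im = this
  show ?thesis
    by (rule set_eqI) (simp only: im, simp only: in_keys_iff lookup_act[OF b])
qed

lemma rename_single:
  assumes b: "bij \<pi>"
  shows "rename \<pi> (Poly_Mapping.single m c) = Poly_Mapping.single (act \<pi> m) c"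
proof -
  have "rename \<pi> (mon Var m) = (\<Prod>v\<in>Poly_Mapping.keys m. Var (\<pi> v) ^ Poly_Mapping.lookup m v)"
    unfolding mon_def by (simp only: rename_simps)
  also have "\<dots> = mon Var (act \<pi> m)"
    unfolding mon_def keys_act[OF b] using b
    by (subst prod.reindex[OF inj_on_subset[OF bij_is_inj[OF b] subset_UNIV]])
      (simp add: lookup_act bij_is_inj)
  finally show ?thesis unfolding single_eq_mon by (simp only: rename_simps)
qed

lemma lookup_rename:
  assumes b: "bij \<pi>"
  shows "Poly_Mapping.lookup (rename \<pi> p) (act \<pi> m) = Poly_Mapping.lookup p m"
proof -
  have "rename \<pi> p = (\<Sum>n\<in>Poly_Mapping.keys p. Poly_Mapping.single (act \<pi> n) (Poly_Mapping.lookup p n))"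
  proof -
    have "rename \<pi> p = rename \<pi> (\<Sum>n\<in>Poly_Mapping.keys p. Poly_Mapping.single n (Poly_Mapping.lookup p n))"
      by (simp only: mpoly_eq_sum_single[symmetric])
    then show ?thesis by (simp only: hom_sum[OF is_hom_rename] rename_single[OF b])
  qed
  then have "Poly_Mapping.lookup (rename \<pi> p) (act \<pi> m)
      = (\<Sum>n\<in>Poly_Mapping.keys p. if n = m then Poly_Mapping.lookup p n else 0)"
    by (simp add: lookup_sum lookup_single when_def act_inj[OF b])
  then show ?thesis by (simp add: in_keys_iff)
qed

lemma rename_compose: "rename \<pi> (rename \<rho> p) = rename (\<pi> \<circ> \<rho>) p"
proof -
  have "is_hom (\<lambda>p. rename \<pi> (rename \<rho> p))" by (rule is_hom_compose[OF is_hom_rename is_hom_rename])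
  then show ?thesis by (rule hom_eqI[OF _ is_hom_rename]) (simp_all add: rename_simps)
qed

lemma homogeneous_rename:
  assumes b: "bij \<pi>" and p: "homogeneous d p"
  shows "homogeneous d (rename \<pi> p)"
  unfolding homogeneous_iff
proof
  fix m assume m: "m \<in> Poly_Mapping.keys (rename \<pi> p)"
  have inv: "bij (inv \<pi>)" "\<pi> \<circ> inv \<pi> = id" using b by (simp_all add: bij_imp_bij_inv surj_iff[symmetric] bij_is_surj)
  define n where "n = act (inv \<pi>) m"
  have mn: "m = act \<pi> n" unfolding n_def act_compose[OF b inv(1), symmetric] inv(2) act_id ..
  have "n \<in> Poly_Mapping.keys p" using m unfolding mn in_keys_iff lookup_rename[OF b] .
  then have "mdeg n = d" using p by (simp add: homogeneous_iff)
  moreover have "mdeg m = mdeg n"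
    unfolding mdeg_def mn keys_act[OF b] using b
    by (subst sum.reindex[OF inj_on_subset[OF bij_is_inj[OF b] subset_UNIV]])
      (simp add: lookup_act bij_is_inj)
  ultimately show "mdeg m = d" by simp
qed

lemma hcomp_rename:
  assumes b: "bij \<pi>"
  shows "hcomp d (rename \<pi> p) = rename \<pi> (hcomp d p)"
proof -
  obtain N where "\<forall>n\<ge>N. p = (\<Sum>e<n. hcomp e p)" using mpoly_eq_sum_hcomp by blast
  then have "p = (\<Sum>e<max N (Suc d). hcomp e p)" by (rule allE[of _ "max N (Suc d)"]) simp
  then have "rename \<pi> p = rename \<pi> (\<Sum>e<max N (Suc d). hcomp e p)" by simp
  then have "hcomp d (rename \<pi> p) = (\<Sum>e<max N (Suc d). hcomp d (rename \<pi> (hcomp e p)))"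
    by (simp only: hom_sum[OF is_hom_rename] hcomp.sum)
  also have "\<dots> = (\<Sum>e<max N (Suc d). if e = d then rename \<pi> (hcomp e p) else 0)"
    by (intro sum.cong refl) (simp add: hcomp_homogeneous[OF homogeneous_rename[OF b homogeneous_hcomp]])
  finally show ?thesis by simp
qed

lemma rename_lin_form:
  assumes "finite V" "\<pi> permutes V"
  shows "rename \<pi> (lin_form V m) = lin_form V (act \<pi> m)"
proof -
  have b: "bij \<pi>" using assms(2) by (rule permutes_bij)
  have "lin_form V (act \<pi> m) = (\<Sum>v\<in>V. mscale (of_nat (Poly_Mapping.lookup (act \<pi> m) (\<pi> v))) (Var (\<pi> v)))"
    unfolding lin_form_def by (subst sum.permute[OF assms(2)]) (simp add: o_def)
  then show ?thesis
    unfolding lin_form_def using b by (simp add: rename_simps mscale_def lookup_act bij_is_inj)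
qed

lemma psum_rename:
  assumes "finite V" "\<pi> permutes V"
  shows "psum V d (rename \<pi> p) = rename \<pi> (psum V d p)"
proof -
  have b: "bij \<pi>" using assms(2) by (rule permutes_bij)
  let ?s = "\<lambda>n. Poly_Mapping.single n (Poly_Mapping.lookup p n)"
  have s: "psum V d (rename \<pi> (Poly_Mapping.single n c)) = rename \<pi> (psum V d (Poly_Mapping.single n c))" for n c
    unfolding rename_single[OF b] psum_def coeff_hom.lext_single[OF coeff_hom_Const]
    by (simp only: rename_simps rename_lin_form[OF assms])
  have "psum V d (rename \<pi> (sum ?s (Poly_Mapping.keys p))) = rename \<pi> (psum V d (sum ?s (Poly_Mapping.keys p)))"
    by (simp only: hom_sum[OF is_hom_rename] psum.sum s)
  then show ?thesis by (simp only: mpoly_eq_sum_single[symmetric])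
qed

definition monomial_orbits :: "('v \<Rightarrow> 'v) set \<Rightarrow> ('v \<Rightarrow>\<^sub>0 nat) set \<Rightarrow> ('v \<Rightarrow>\<^sub>0 nat) set set" where
  "monomial_orbits S M = (\<lambda>m. (\<lambda>\<pi>. act \<pi> m) ` S) ` M"

lemma invariants_subspace:
  assumes "mpoly.subspace W"
  shows "mpoly.subspace (invariants S W)"
  using assms unfolding mpoly.subspace_def invariants_def
  by (simp add: rename_simps mscale_def)

text \<open>
  The orbit sums of monomials form a basis.
\<close>

lemma dim_invariants_supported:
  assumes G: "finite V" "perm_group V S" and M: "finite M" "\<And>\<pi> m. \<pi> \<in> S \<Longrightarrow> m \<in> M \<Longrightarrow> act \<pi> m \<in> M"
  shows "mpoly.dim (invariants S (supported M)) = card (monomial_orbits S M)"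
proof -
  have bij: "bij \<pi>" if "\<pi> \<in> S" for \<pi> using G(2) that permutes_bij by (auto simp: perm_group_def)
  have grp: "id \<in> S" "\<And>\<pi>. \<pi> \<in> S \<Longrightarrow> inv \<pi> \<in> S" "\<And>\<pi> \<rho>. \<pi> \<in> S \<Longrightarrow> \<rho> \<in> S \<Longrightarrow> \<pi> \<circ> \<rho> \<in> S"
    using G(2) by (auto simp: perm_group_def)
  define orb where "orb m = (\<lambda>\<pi>. act \<pi> m) ` S" for m
  let ?O = "monomial_orbits S M"
  have O: "?O = orb ` M" by (simp add: monomial_orbits_def orb_def)
  have self: "m \<in> orb m" for m unfolding orb_def by (rule image_eqI[of _ _ id]) (simp_all add: act_id grp)
  have act_inv: "act (inv \<pi>) (act \<pi> m) = m" "act \<pi> (act (inv \<pi>) m) = m" if "\<pi> \<in> S" for \<pi> m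
  proof -
    have "inv \<pi> \<circ> \<pi> = id" "\<pi> \<circ> inv \<pi> = id" using bij[OF that] by (simp_all add: bij_is_inj bij_is_surj surj_iff[symmetric])
    then show "act (inv \<pi>) (act \<pi> m) = m" "act \<pi> (act (inv \<pi>) m) = m"
      using act_compose[OF bij[OF grp(2)[OF that]] bij[OF that], of m]
        act_compose[OF bij[OF that] bij[OF grp(2)[OF that]], of m] act_id[of m] by simp_all
  qed
  have orb_act: "orb (act \<pi> m) = orb m" if \<pi>: "\<pi> \<in> S" for \<pi> m
  proof -
    have "orb (act \<pi> n) \<subseteq> orb n" if "\<pi> \<in> S" for \<pi> n
      unfolding orb_def
    proof clarify
      fix \<rho> assume r: "\<rho> \<in> S"
      have "act \<rho> (act \<pi> n) = act (\<rho> \<circ> \<pi>) n" using act_compose[OF bij[OF r] bij[OF that]] by simp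
      then show "act \<rho> (act \<pi> n) \<in> (\<lambda>\<pi>. act \<pi> n) ` S" using grp(3)[OF r that] by blast
    qed
    from this[OF \<pi>, of m] this[OF grp(2)[OF \<pi>], of "act \<pi> m"] show ?thesis
      unfolding act_inv[OF \<pi>] by blast
  qed
  have orb_eq: "orb n = orb m" if n: "n \<in> orb m" for n m
  proof -
    obtain \<pi> where "\<pi> \<in> S" "n = act \<pi> m" using n unfolding orb_def by blast
    then show ?thesis by (simp only: orb_act)
  qed
  have orb_eq2: "o1 = orb m" if "o1 \<in> ?O" "m \<in> o1" for o1 m
    using that orb_eq unfolding O by auto
  have orbM: "orb m \<subseteq> M" if "m \<in> M" for m using M(2) that unfolding orb_def by auto
  have finO: "finite ?O" unfolding O using M(1) by simp
  have fin_orb: "finite o1" if "o1 \<in> ?O" for o1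
    using that orbM M(1) finite_subset unfolding O by blast
  define osum where "osum o1 = (\<Sum>m\<in>o1. Poly_Mapping.single m (1::rat))" for o1 :: "('a \<Rightarrow>\<^sub>0 nat) set"
  have lk: "Poly_Mapping.lookup (osum o1) m = (if m \<in> o1 then 1 else 0)" if "o1 \<in> ?O" for o1 m
    unfolding osum_def using fin_orb[OF that] by (simp add: lookup_sum lookup_single when_def)
  have lksum: "Poly_Mapping.lookup (\<Sum>o1\<in>?O. mscale (f o1) (osum o1)) m = (if m \<in> M then f (orb m) else 0)" for f m
  proof -
    have "Poly_Mapping.lookup (\<Sum>o1\<in>?O. mscale (f o1) (osum o1)) m = (\<Sum>o1\<in>?O. if m \<in> o1 then f o1 else 0)"
      unfolding lookup_sum lookup_mscale by (intro sum.cong refl) (simp add: lk)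
    also have "\<dots> = (\<Sum>o1\<in>?O. if o1 = orb m \<and> m \<in> M then f o1 else 0)"
    proof (intro sum.cong refl if_cong)
      fix o1 assume o1: "o1 \<in> ?O"
      show "m \<in> o1 \<longleftrightarrow> o1 = orb m \<and> m \<in> M"
        using orb_eq2[OF o1] self o1 orbM unfolding O by blast
    qed
    also have "\<dots> = (if m \<in> M then f (orb m) else 0)"
      using finO by (cases "m \<in> M") (simp_all add: O)
    finally show ?thesis .
  qed
  have inj: "inj_on osum ?O"
  proof (rule inj_onI)
    fix o1 o2 assume o: "o1 \<in> ?O" "o2 \<in> ?O" "osum o1 = osum o2"
    show "o1 = o2"
    proof (rule set_eqI)
      fix m show "m \<in> o1 \<longleftrightarrow> m \<in> o2"
        using lk[OF o(1), of m] lk[OF o(2), of m] unfolding o(3) by (auto split: if_splits)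
    qed
  qed
  have inv_osum: "osum o1 \<in> invariants S (supported M)" if o1: "o1 \<in> ?O" for o1
  proof -
    have "o1 \<subseteq> M" using o1 orbM unfolding O by blast
    then have "Poly_Mapping.keys (osum o1) \<subseteq> M" using lk[OF o1] by (auto simp: in_keys_iff split: if_splits)
    moreover have "rename \<pi> (osum o1) = osum o1" if \<pi>: "\<pi> \<in> S" for \<pi>
    proof (rule poly_mapping_eqI)
      fix m
      have "Poly_Mapping.lookup (rename \<pi> (osum o1)) m = Poly_Mapping.lookup (osum o1) (act (inv \<pi>) m)"
        using lookup_rename[OF bij[OF \<pi>], of "osum o1" "act (inv \<pi>) m"] unfolding act_inv[OF \<pi>] .
      also have "act (inv \<pi>) m \<in> o1 \<longleftrightarrow> m \<in> o1"
      proof -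
        have "orb (act (inv \<pi>) m) = orb m" by (rule orb_act[OF grp(2)[OF \<pi>]])
        then show ?thesis using orb_eq2[OF o1] self by metis
      qed
      then have "Poly_Mapping.lookup (osum o1) (act (inv \<pi>) m) = Poly_Mapping.lookup (osum o1) m"
        by (simp add: lk[OF o1])
      finally show "Poly_Mapping.lookup (rename \<pi> (osum o1)) m = Poly_Mapping.lookup (osum o1) m" .
    qed
    ultimately show ?thesis unfolding invariants_def supported_def by simp
  qed
  have span: "p \<in> mpoly.span (osum ` ?O)" if p: "p \<in> invariants S (supported M)" for p
  proof -
    define f where "f o1 = Poly_Mapping.lookup p (SOME m. m \<in> o1)" for o1
    have inv: "Poly_Mapping.lookup p (act \<pi> m) = Poly_Mapping.lookup p m" if "\<pi> \<in> S" for \<pi> m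
      using lookup_rename[OF bij[OF that], of p m] p that by (simp add: invariants_def)
    have f: "f (orb m) = Poly_Mapping.lookup p m" for m
    proof -
      have "(SOME n. n \<in> orb m) \<in> orb m" using self by (rule someI)
      then show ?thesis using inv unfolding f_def orb_def by auto
    qed
    have "p = (\<Sum>o1\<in>?O. mscale (f o1) (osum o1))"
    proof (rule poly_mapping_eqI)
      fix m
      have "m \<notin> M \<Longrightarrow> Poly_Mapping.lookup p m = 0" using p by (auto simp: invariants_def supported_def in_keys_iff)
      then show "Poly_Mapping.lookup p m = Poly_Mapping.lookup (\<Sum>o1\<in>?O. mscale (f o1) (osum o1)) m"
        unfolding lksum f by simp
    qed
    moreover have "(\<Sum>o1\<in>?O. mscale (f o1) (osum o1)) \<in> mpoly.span (osum ` ?O)"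
      by (intro mpoly.span_sum mpoly.span_scale mpoly.span_base imageI)
    ultimately show ?thesis by simp
  qed
  have "mpoly.independent (osum ` ?O)"
  proof (rule mpoly.independent_if_scalars_zero)
    show "finite (osum ` ?O)" using finO by simp
    fix f x assume "(\<Sum>x\<in>osum ` ?O. mscale (f x) x) = 0" and x: "x \<in> osum ` ?O"
    then have z: "(\<Sum>o1\<in>?O. mscale (f (osum o1)) (osum o1)) = 0" by (simp add: sum.reindex[OF inj])
    obtain m where m: "m \<in> M" "x = osum (orb m)" using x unfolding O by blast
    show "f x = 0" using lksum[of "\<lambda>o1. f (osum o1)" m] m unfolding z by simp
  qed
  then show ?thesis
    using card_image[OF inj] inv_osum span
    by (intro mpoly.dim_unique[of "osum ` ?O"]) auto
qed

lemma invariants_average: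
  assumes G: "finite V" "perm_group V S" and W: "mpoly.subspace W" "\<And>\<pi> p. \<pi> \<in> S \<Longrightarrow> p \<in> W \<Longrightarrow> rename \<pi> p \<in> W"
    and p: "p \<in> W"
  shows "mscale (1 / of_nat (card S)) (\<Sum>\<pi>\<in>S. rename \<pi> p) \<in> invariants S W"
proof -
  have bij: "bij \<pi>" if "\<pi> \<in> S" for \<pi> using G(2) that permutes_bij by (auto simp: perm_group_def)
  have grp: "\<And>\<pi>. \<pi> \<in> S \<Longrightarrow> inv \<pi> \<in> S" "\<And>\<pi> \<rho>. \<pi> \<in> S \<Longrightarrow> \<rho> \<in> S \<Longrightarrow> \<pi> \<circ> \<rho> \<in> S"
    using G(2) by (auto simp: perm_group_def)
  have "rename \<rho> (\<Sum>\<pi>\<in>S. rename \<pi> p) = (\<Sum>\<pi>\<in>S. rename \<pi> p)" if r: "\<rho> \<in> S" for \<rho>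
  proof -
    have i: "inv \<rho> \<circ> \<rho> = id" "\<rho> \<circ> inv \<rho> = id"
      using bij[OF r] by (simp_all add: bij_is_inj bij_is_surj surj_iff[symmetric])
    have "rename \<rho> (\<Sum>\<pi>\<in>S. rename \<pi> p) = (\<Sum>\<pi>\<in>S. rename (\<rho> \<circ> \<pi>) p)"
      by (simp only: hom_sum[OF is_hom_rename] rename_compose)
    also have "\<dots> = (\<Sum>\<pi>\<in>S. rename \<pi> p)"
    proof (rule sum.reindex_bij_witness[of S "\<lambda>\<pi>. inv \<rho> \<circ> \<pi>" "\<lambda>\<pi>. \<rho> \<circ> \<pi>"])
      fix \<pi> assume "\<pi> \<in> S"
      show "inv \<rho> \<circ> (\<rho> \<circ> \<pi>) = \<pi>" "\<rho> \<circ> (inv \<rho> \<circ> \<pi>) = \<pi>" by (simp_all add: o_assoc i)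
      show "\<rho> \<circ> \<pi> \<in> S" "inv \<rho> \<circ> \<pi> \<in> S" using grp r \<open>\<pi> \<in> S\<close> by auto
    qed (rule refl)
    finally show ?thesis .
  qed
  then have "rename \<rho> (mscale c (\<Sum>\<pi>\<in>S. rename \<pi> p)) = mscale c (\<Sum>\<pi>\<in>S. rename \<pi> p)" if "\<rho> \<in> S" for \<rho> c
    using that unfolding mscale_def by (simp only: hom_mult[OF is_hom_rename] rename_Const)
  moreover have "mscale c (\<Sum>\<pi>\<in>S. rename \<pi> p) \<in> W" for c
    using W p by (intro mpoly.subspace_scale[OF W(1)] mpoly.subspace_sum[OF W(1)])
  ultimately show ?thesis unfolding invariants_def by simp
qed

lemma average_fixed:
  assumes "finite S" "S \<noteq> {}" "\<And>\<pi>. \<pi> \<in> S \<Longrightarrow> rename \<pi> p = p"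
  shows "mscale (1 / of_nat (card S)) (\<Sum>\<pi>\<in>S. rename \<pi> p) = p"
proof -
  have "(\<Sum>\<pi>\<in>S. rename \<pi> p) = (\<Sum>\<pi>\<in>S. mscale 1 p)"
    using assms(3) by (intro sum.cong refl) simp
  also have "\<dots> = mscale (\<Sum>\<pi>\<in>S. 1) p" by (rule mpoly.scale_sum_left[symmetric])
  finally have "(\<Sum>\<pi>\<in>S. rename \<pi> p) = mscale (of_nat (card S)) p" by simp
  then show ?thesis using assms(1,2) by simp
qed

section \<open>Graded dimensions of the invariant slim polynomials\<close>

lemma slims_finite_span:
  assumes "finite E"
  shows "\<exists>F. finite F \<and> slims V E t h \<subseteq> mpoly.span F"
proof -
  have "{eprod t h Y | Y. Y \<subseteq> E \<and> conn V (E - Y) t h} \<subseteq> eprod t h ` Pow E" by blast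
  then have "finite {eprod t h Y | Y. Y \<subseteq> E \<and> conn V (E - Y) t h}"
    by (rule finite_subset) (use assms in simp)
  then show ?thesis unfolding slims_def by blast
qed

lemma hcomp_slims_zero:
  assumes "finite E" "p \<in> slims V E t h" "card E < d"
  shows "hcomp d p = 0"
  using assms(2) unfolding slims_def
proof (induction rule: mpoly.span_induct_alt)
  case base then show ?case by (rule hcomp.zero)
next
  case (step c b y)
  then obtain Y where Y: "Y \<subseteq> E" "b = eprod t h Y" by blast
  have "finite Y" "card Y \<le> card E" using Y assms(1) finite_subset card_mono by blast+
  then have "hcomp d b = 0"
    unfolding Y(2) using assms(3) hcomp_homogeneous[OF homogeneous_eprod, of Y d t h] by simp
  then show ?case using step by (simp add: hcomp.add hcomp.scale)
qed

lemma dim_slims_graded: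
  assumes "finite E" "card E < D"
  shows "mpoly.dim (slims V E t h) = (\<Sum>d<D. mpoly.dim {p \<in> slims V E t h. homogeneous d p})"
proof -
  obtain F where F: "finite F" "slims V E t h \<subseteq> mpoly.span F" using slims_finite_span[OF assms(1)] by blast
  have sub: "mpoly.subspace (slims V E t h)" by (simp add: slims_def)
  have "mpoly.dim (slims V E t h) = (\<Sum>d<D. mpoly.dim (hcomp d ` {p \<in> slims V E t h. \<forall>i<d. hcomp i p = 0}))"
  proof (rule mpoly.dim_filtration[OF sub F(2,1) linear_hcomp])
    fix p assume p: "p \<in> slims V E t h" and z: "\<And>i. i < D \<Longrightarrow> hcomp i p = 0"
    show "p = 0"
    proof (rule hcomp_all_zero)
      fix d show "hcomp d p = 0"
        using z[of d] hcomp_slims_zero[OF assms(1) p, of d] assms(2) by (cases "d < D") auto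
    qed
  qed
  moreover have "hcomp d ` {p \<in> slims V E t h. \<forall>i<d. hcomp i p = 0} = {p \<in> slims V E t h. homogeneous d p}" for d
  proof (intro equalityI subsetI)
    fix x assume "x \<in> hcomp d ` {p \<in> slims V E t h. \<forall>i<d. hcomp i p = 0}"
    then show "x \<in> {p \<in> slims V E t h. homogeneous d p}"
      using graded_slims[OF assms(1), of V t h] homogeneous_hcomp by (auto simp: graded_def)
  next
    fix x assume x: "x \<in> {p \<in> slims V E t h. homogeneous d p}"
    then have hx: "homogeneous d x" by simp
    have "hcomp d x = x" "\<forall>i<d. hcomp i x = 0" by (simp_all add: hcomp_homogeneous[OF hx])
    then show "x \<in> hcomp d ` {p \<in> slims V E t h. \<forall>i<d. hcomp i p = 0}" using x by (intro image_eqI[of _ _ x]) simp_all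
  qed
  ultimately show ?thesis by simp
qed

context bounded_width
begin

lemma psum_image_slims:
  "psum V d ` {p \<in> supported M. \<forall>i<d. psum V i p = 0} \<subseteq> {p \<in> slims V E t h. homogeneous d p}"
proof clarify
  fix p assume p: "p \<in> supported M" "\<forall>i<d. psum V i p = 0"
  then show "psum V d p \<in> slims V E t h \<and> homogeneous d (psum V d p)"
    using psum_slims[of p d] homogeneous_psum by blast
qed

text \<open>
  The graded dimensions of the filtration by power sums add up to \<open>card M\<close>, are bounded by those of the
  slim space, and the latter add up to at most \<open>card M\<close>. So equality holds in each degree.
\<close>

lemma psum_image_eq:
  assumes small: "mpoly.dim (slims V E t h) \<le> card M"
  shows "d < card M \<Longrightarrow> psum V d ` {p \<in> supported M. \<forall>i<d. psum V i p = 0} = {p \<in> slims V E t h. homogeneous d p}"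
    and "card M \<le> d \<Longrightarrow> {p \<in> slims V E t h. homogeneous d p} = {0}"
proof -
  let ?K = "\<lambda>d. psum V d ` {p \<in> supported M. \<forall>i<d. psum V i p = 0}"
  let ?P = "\<lambda>d. {p \<in> slims V E t h. homogeneous d p}"
  obtain F where F: "finite F" "slims V E t h \<subseteq> mpoly.span F" using slims_finite_span[OF finE] by blast
  have PF: "?P d \<subseteq> mpoly.span F" for d using F by blast
  have subP: "mpoly.subspace (?P d)" for d
  proof -
    have "?P d = slims V E t h \<inter> {p. homogeneous d p}" by blast
    then show ?thesis
      unfolding slims_def by (simp only:) (rule mpoly.subspace_inter[OF mpoly.subspace_span homogeneous_subspace])
  qed
  have subK0: "mpoly.subspace {p \<in> supported M. \<forall>i<d. psum V i p = 0}" for d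
    using supported_subspace[of M] by (auto simp: mpoly.subspace_def psum.zero psum.add psum.scale)
  have subK: "mpoly.subspace (?K d)" for d by (rule psum.subspace_image[OF subK0])
  have dimle: "mpoly.dim (?K d) \<le> mpoly.dim (?P d)" for d
  proof -
    obtain X where X: "X \<subseteq> ?K d" "mpoly.independent X" "?K d \<subseteq> mpoly.span X" "card X = mpoly.dim (?K d)"
      by (rule mpoly.basis_exists)
    obtain Y where Y: "Y \<subseteq> ?P d" "mpoly.independent Y" "?P d \<subseteq> mpoly.span Y" "card Y = mpoly.dim (?P d)"
      by (rule mpoly.basis_exists)
    have "finite Y" using mpoly.independent_span_bound[OF F(1) Y(2)] Y(1) PF by blast
    moreover have "X \<subseteq> mpoly.span Y" using X(1) psum_image_slims Y(3) by blast
    ultimately have "card X \<le> card Y" using mpoly.independent_span_bound[OF _ X(2)] by blast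
    then show ?thesis using X(4) Y(4) by simp
  qed
  have N: "card M = (\<Sum>d<card M. mpoly.dim (?K d))"
    unfolding dim_supported[OF finM, symmetric]
  proof (rule mpoly.dim_filtration[OF supported_subspace supported_span _ linear_psum])
    show "finite ((\<lambda>m. Poly_Mapping.single m 1) ` M)" using finM by simp
    fix x assume x: "x \<in> supported M" and z: "\<And>i. i < mpoly.dim (supported M) \<Longrightarrow> psum V i x = 0"
    show "x = 0"
    proof (rule psum_joint_injective[OF finV finM keysM x])
      show "psum V i x = 0" if "i < card M" for i
        using that by (intro z) (simp only: dim_supported[OF finM])
    qed
  qed
  define D where "D = max (card M) (Suc (card E))"
  have "(\<Sum>d<D. mpoly.dim (?P d)) \<le> (\<Sum>d<card M. mpoly.dim (?K d))"
    using dim_slims_graded[OF finE, of D V t h] small N by (simp add: D_def)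
  moreover have "(\<Sum>d<D. mpoly.dim (?P d)) = (\<Sum>d<card M. mpoly.dim (?P d)) + (\<Sum>d\<in>{card M..<D}. mpoly.dim (?P d))"
  proof -
    have "{..<D} = {..<card M} \<union> {card M..<D}" by (auto simp: D_def)
    moreover have "{..<card M} \<inter> {card M..<D} = {}" by auto
    ultimately show ?thesis
      using sum.union_disjoint[of "{..<card M}" "{card M..<D}" "\<lambda>d. mpoly.dim (?P d)"] by (simp only: finite_lessThan finite_atLeastLessThan)
  qed
  moreover have le: "(\<Sum>d<card M. mpoly.dim (?K d)) \<le> (\<Sum>d<card M. mpoly.dim (?P d))"
    using dimle by (rule sum_mono)
  ultimately have eq: "(\<Sum>d<card M. mpoly.dim (?K d)) = (\<Sum>d<card M. mpoly.dim (?P d))"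
    and zero: "(\<Sum>d\<in>{card M..<D}. mpoly.dim (?P d)) = 0" by linarith+
  show "?K d = ?P d" if d: "d < card M" for d
  proof (rule mpoly.subspace_eq_of_dim[OF subK psum_image_slims PF F(1)])
    have "mpoly.dim (?K d) = mpoly.dim (?P d)"
      using sum_mono_inv[OF eq dimle, of d] d by simp
    then show "mpoly.dim (?P d) \<le> mpoly.dim (?K d)" by simp
  qed
  show "?P d = {0}" if d: "card M \<le> d" for d
  proof (cases "d < D")
    case True
    then have "mpoly.dim (?P d) = 0" using zero d by simp
    moreover have "{0} \<subseteq> ?P d" using subP[of d] by (simp add: mpoly.subspace_0[OF subP, simplified])
    ultimately show ?thesis
      using mpoly.subspace_eq_of_dim[OF mpoly.subspace_single_0 _ PF F(1), of d] by simp
  next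
    case False
    have "p = 0" if "p \<in> ?P d" for p
      using hcomp_slims_zero[OF finE, of p V t h d] hcomp_homogeneous[of d p d] that False by (simp add: D_def)
    moreover have "0 \<in> ?P d" by (rule mpoly.subspace_0[OF subP])
    ultimately show ?thesis by blast
  qed
qed

text \<open>
  Power sums commute with renaming, so averaging turns \<open>psum_image_eq\<close> into the corresponding
  statement for invariants.
\<close>

theorem dim_invariant_slims:
  assumes small: "mpoly.dim (slims V E t h) \<le> card M" and S: "perm_group V S"
    and stable: "\<And>\<pi> m. \<pi> \<in> S \<Longrightarrow> m \<in> M \<Longrightarrow> act \<pi> m \<in> M"
  shows "(\<Sum>d<card M. mpoly.dim {p \<in> invariants S (slims V E t h). homogeneous d p}) = card (monomial_orbits S M)"
    and "card M \<le> d \<Longrightarrow> mpoly.dim {p \<in> invariants S (slims V E t h). homogeneous d p} = 0"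
proof -
  let ?U = "invariants S (supported M)"
  have perm: "\<pi> permutes V" if "\<pi> \<in> S" for \<pi> using S that by (simp add: perm_group_def)
  have bij: "bij \<pi>" if "\<pi> \<in> S" for \<pi> using perm[OF that] by (rule permutes_bij)
  have finS: "finite S" by (rule perm_group_finite[OF finV S])
  have neS: "S \<noteq> {}" using S by (auto simp: perm_group_def)
  have supp: "rename \<pi> p \<in> supported M" if "\<pi> \<in> S" "p \<in> supported M" for \<pi> p
  proof -
    have "rename \<pi> p = rename \<pi> (\<Sum>n\<in>Poly_Mapping.keys p. Poly_Mapping.single n (Poly_Mapping.lookup p n))"
      by (simp only: mpoly_eq_sum_single[symmetric])
    also have "\<dots> = (\<Sum>n\<in>Poly_Mapping.keys p. Poly_Mapping.single (act \<pi> n) (Poly_Mapping.lookup p n))"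
      by (simp only: hom_sum[OF is_hom_rename] rename_single[OF bij[OF that(1)]])
    also have "\<dots> \<in> supported M"
      using that stable by (intro mpoly.subspace_sum[OF supported_subspace]) (auto simp: supported_def)
    finally show ?thesis .
  qed
  have "mpoly.dim ?U = (\<Sum>d<card M. mpoly.dim (psum V d ` {p \<in> ?U. \<forall>i<d. psum V i p = 0}))"
  proof (rule mpoly.dim_filtration[OF invariants_subspace[OF supported_subspace] _ _ linear_psum])
    show "?U \<subseteq> mpoly.span ((\<lambda>m. Poly_Mapping.single m 1) ` M)"
      using supported_span by (auto simp: invariants_def)
    show "finite ((\<lambda>m. Poly_Mapping.single m 1) ` M)" using finM by simp
    fix x assume x: "x \<in> ?U" and z: "\<And>i. i < card M \<Longrightarrow> psum V i x = 0"
    have "x \<in> supported M" using x by (simp add: invariants_def)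
    from psum_joint_injective[OF finV finM keysM this z] show "x = 0" .
  qed
  moreover have "psum V d ` {p \<in> ?U. \<forall>i<d. psum V i p = 0} = {p \<in> invariants S (slims V E t h). homogeneous d p}"
    if d: "d < card M" for d
  proof (intro equalityI subsetI)
    fix x assume "x \<in> psum V d ` {p \<in> ?U. \<forall>i<d. psum V i p = 0}"
    then obtain p where p: "p \<in> supported M" "\<And>\<pi>. \<pi> \<in> S \<Longrightarrow> rename \<pi> p = p" "\<forall>i<d. psum V i p = 0" "x = psum V d p"
      by (auto simp: invariants_def)
    have "rename \<pi> x = x" if "\<pi> \<in> S" for \<pi>
      unfolding p(4) psum_rename[OF finV perm[OF that], symmetric] p(2)[OF that] ..
    moreover have "x \<in> {p \<in> slims V E t h. homogeneous d p}" using psum_image_slims p by blast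
    ultimately show "x \<in> {p \<in> invariants S (slims V E t h). homogeneous d p}" by (simp add: invariants_def)
  next
    fix x assume x: "x \<in> {p \<in> invariants S (slims V E t h). homogeneous d p}"
    then have fixed: "\<And>\<pi>. \<pi> \<in> S \<Longrightarrow> rename \<pi> x = x" by (simp add: invariants_def)
    have "x \<in> {p \<in> slims V E t h. homogeneous d p}" using x by (simp add: invariants_def)
    then obtain p where p: "p \<in> supported M" "\<forall>i<d. psum V i p = 0" "x = psum V d p"
      unfolding psum_image_eq(1)[OF small d, symmetric] by blast
    let ?q = "mscale (1 / of_nat (card S)) (\<Sum>\<pi>\<in>S. rename \<pi> p)"
    have q: "?q \<in> ?U" using invariants_average[OF finV S supported_subspace supp p(1)] .
    have pq: "psum V i ?q = mscale (1 / of_nat (card S)) (\<Sum>\<pi>\<in>S. rename \<pi> (psum V i p))" for i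
      unfolding psum.scale psum.sum by (intro arg_cong[of _ _ "mscale _"] sum.cong refl psum_rename[OF finV] perm)
    have "\<forall>i<d. psum V i ?q = 0" using p(2) unfolding pq by (simp add: rename_simps)
    moreover have "psum V d ?q = x"
      unfolding pq p(3)[symmetric] by (rule average_fixed[OF finS neS fixed])
    ultimately show "x \<in> psum V d ` {p \<in> ?U. \<forall>i<d. psum V i p = 0}"
      using q by (intro image_eqI[of _ _ ?q]) simp_all
  qed
  ultimately show "(\<Sum>d<card M. mpoly.dim {p \<in> invariants S (slims V E t h). homogeneous d p}) = card (monomial_orbits S M)"
    using dim_invariants_supported[OF finV S finM stable] by simp
  show "mpoly.dim {p \<in> invariants S (slims V E t h). homogeneous d p} = 0" if "card M \<le> d"
  proof -
    have "{p \<in> invariants S (slims V E t h). homogeneous d p} \<subseteq> {p \<in> slims V E t h. homogeneous d p}"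
      by (auto simp: invariants_def)
    then have "{p \<in> invariants S (slims V E t h). homogeneous d p} \<subseteq> mpoly.span {}"
      unfolding psum_image_eq(2)[OF small that] by simp
    from mpoly.dim_le_card[OF this] show ?thesis by simp
  qed
qed

end

section \<open>Directed graphs as multigraphs\<close>

lemma connected_iff_conn:
  assumes "wf_digraph G"
  shows "connected G \<longleftrightarrow> conn (verts G) (arcs G) (tail G) (head G)"
proof -
  let ?r = "\<Union>e\<in>arcs G. {(tail G e, head G e), (head G e, tail G e)}"
  let ?R = "rtrancl_on (verts G) ?r"
  have reach: "connected G \<longleftrightarrow> verts G \<noteq> {} \<and> (\<forall>u\<in>verts G. \<forall>v\<in>verts G. (u, v) \<in> ?R)"
    unfolding connected_def strongly_connected_def reachable_def
    by (simp add: mk_symmetric_def with_proj_def arcs_ends_def arc_to_ends_def)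
  show ?thesis
  proof
    assume c: "connected G"
    have "cut_edges (arcs G) (tail G) (head G) S \<noteq> {}" if S: "proper (verts G) S" for S
    proof
      assume z: "cut_edges (arcs G) (tail G) (head G) S = {}"
      obtain u v where uv: "u \<in> S" "u \<in> verts G" "v \<in> verts G" "v \<notin> S"
        using S by (auto simp: proper_def)
      then have "(u, v) \<in> ?R" using c reach by blast
      then have "v \<in> S"
      proof (induction rule: rtrancl_on_induct)
        case base then show ?case using uv by simp
      next
        case (step y w)
        then show ?case using z by (auto simp: cut_edges_def crosses_def)
      qed
      then show False using uv by simp
    qed
    then show "conn (verts G) (arcs G) (tail G) (head G)" using c reach by (auto simp: conn_def)
  next
    assume c: "conn (verts G) (arcs G) (tail G) (head G)"
    have "(u, v) \<in> ?R" if u: "u \<in> verts G" and v: "v \<in> verts G" for u v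
    proof (rule ccontr)
      assume nv: "(u, v) \<notin> ?R"
      let ?S = "{w \<in> verts G. (u, w) \<in> ?R}"
      have "u \<in> ?S" using u by simp
      then have "proper (verts G) ?S" using nv v by (auto simp: proper_def)
      then have "cut_edges (arcs G) (tail G) (head G) ?S \<noteq> {}" using c by (auto simp: conn_def)
      then obtain e where e: "e \<in> arcs G" "crosses (tail G) (head G) ?S e" by (auto simp: cut_edges_def)
      have ends: "tail G e \<in> verts G" "head G e \<in> verts G"
        using assms e(1) by (auto simp: wf_digraph_def)
      have r: "(tail G e, head G e) \<in> ?r" "(head G e, tail G e) \<in> ?r" using e(1) by blast+
      show False
      proof (cases "(u, tail G e) \<in> ?R")
        case True
        then have "(u, head G e) \<in> ?R" using r(1) ends(2) by (rule rtrancl_on_into_rtrancl_on)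
        then show False using True e(2) ends by (simp add: crosses_def)
      next
        case False
        then have "(u, head G e) \<in> ?R" using e(2) ends by (simp add: crosses_def)
        then have "(u, tail G e) \<in> ?R" using r(2) ends(1) by (rule rtrancl_on_into_rtrancl_on)
        then show False using False by simp
      qed
    qed
    moreover have "verts G \<noteq> {}" using c by (simp add: conn_def)
    ultimately show "connected G" using reach by blast
  qed
qed

lemma slim_space_eq_slims:
  assumes "wf_digraph G"
  shows "slim_space G = slims (verts G) (arcs G) (tail G) (head G)"
proof -
  have "slim G Y \<longleftrightarrow> Y \<subseteq> arcs G \<and> conn (verts G) (arcs G - Y) (tail G) (head G)" for Y
  proof -
    have "wf_digraph (G\<lparr>arcs := arcs G - Y\<rparr>)" using assms by (auto simp: wf_digraph_def)
    from connected_iff_conn[OF this] show ?thesis by (simp add: slim_def)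
  qed
  then show ?thesis by (simp add: slim_space_def slims_def edge_product_def eprod_def)
qed

text \<open>
  The inequality for break divisors is superadditive over connected components, hence its validity for
  connected vertex sets implies it for all.
\<close>

lemma sum_disjoint_ge_inside:
  assumes "multigraph V E t h" and D: "\<And>S. S \<subseteq> V \<Longrightarrow> conn S (inside E t h S) t h \<Longrightarrow>
      int (card (inside E t h S)) - int (card S) + 1 \<le> int (sum D S)"
  shows "S \<subseteq> V \<Longrightarrow> S \<noteq> {} \<Longrightarrow> int (card (inside E t h S)) - int (card S) + 1 \<le> int (sum D S)"
proof (induction "card S" arbitrary: S rule: less_induct)
  case less
  have finS: "finite S" using less.prems assms(1) finite_subset by (auto simp: multigraph_def)
  have finI: "finite (inside E t h X)" for X using assms(1) by (simp add: inside_def multigraph_def)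
  show ?case
  proof (cases "conn S (inside E t h S) t h")
    case True then show ?thesis using D less.prems by blast
  next
    case False
    then obtain X where X: "proper S X" "cut_edges (inside E t h S) t h X = {}"
      using less.prems by (auto simp: conn_def)
    let ?Y = "S - X"
    have X': "X \<subseteq> S" "X \<noteq> {}" "?Y \<noteq> {}" "?Y \<subseteq> S" using X(1) by (auto simp: proper_def)
    have fX: "finite X" "finite ?Y" using X' finS finite_subset by auto
    have cX: "card X < card S" using X(1) finS by (intro psubset_card_mono) (auto simp: proper_def)
    have cY: "card ?Y < card S" using X' finS by (intro psubset_card_mono) auto
    have split: "inside E t h S = inside E t h X \<union> inside E t h ?Y"
      using X(2) X' by (auto simp: inside_def cut_edges_def crosses_def)
    have "inside E t h X \<inter> inside E t h ?Y = {}" by (auto simp: inside_def)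
    then have "card (inside E t h S) = card (inside E t h X) + card (inside E t h ?Y)"
      unfolding split by (intro card_Un_disjoint finI)
    moreover have "card S = card X + card ?Y"
      using X' fX by (metis card_Un_disjoint Diff_disjoint Un_Diff_cancel Un_absorb1)
    moreover have "sum D S = sum D X + sum D ?Y"
      using sum.subset_diff[OF X'(1) finS, of D] by simp
    moreover have "int (card (inside E t h X)) - int (card X) + 1 \<le> int (sum D X)"
      using less.hyps[OF cX] X' less.prems by blast
    moreover have "int (card (inside E t h ?Y)) - int (card ?Y) + 1 \<le> int (sum D ?Y)"
      using less.hyps[OF cY] X' less.prems by blast
    ultimately show ?thesis by linarith
  qed
qed

text \<open>
  Among the subgraphs with a given vertex set the induced one has the largest genus.
\<close>

lemma break_divisors_iff:
  assumes fin: "fin_digraph G"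
  shows "D \<in> break_divisors G \<longleftrightarrow> (\<forall>v. v \<notin> verts G \<longrightarrow> D v = 0)
    \<and> int (sum D (verts G)) = int (card (arcs G)) - int (card (verts G)) + 1
    \<and> (\<forall>S\<subseteq>verts G. S \<noteq> {} \<longrightarrow> int (card (inside (arcs G) (tail G) (head G) S)) - int (card S) + 1 \<le> int (sum D S))"
    (is "_ \<longleftrightarrow> ?A \<and> ?B \<and> ?C")
proof -
  interpret fin_digraph G by (rule fin)
  have mg: "multigraph (verts G) (arcs G) (tail G) (head G)"
    by (auto simp: multigraph_def)
  have finI: "finite (inside (arcs G) (tail G) (head G) S)" for S by (simp add: inside_def)
  let ?H = "\<lambda>S. \<lparr>verts = S, arcs = inside (arcs G) (tail G) (head G) S, tail = tail G, head = head G\<rparr>"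
  have "(\<forall>H. subgraph H G \<and> connected H \<longrightarrow> genus H \<le> int (sum D (verts H))) \<longleftrightarrow> ?C"
  proof
    assume H: "\<forall>H. subgraph H G \<and> connected H \<longrightarrow> genus H \<le> int (sum D (verts H))"
    have "int (card (inside (arcs G) (tail G) (head G) S)) - int (card S) + 1 \<le> int (sum D S)"
      if S: "S \<subseteq> verts G" "conn S (inside (arcs G) (tail G) (head G) S) (tail G) (head G)" for S
    proof -
      have wf: "wf_digraph (?H S)" by (auto simp: wf_digraph_def inside_def)
      have "subgraph (?H S) G"
        using S wf wf_digraph_axioms by (auto simp: subgraph_def compatible_def inside_def)
      moreover have "connected (?H S)" using connected_iff_conn[OF wf] S by simp
      ultimately have "genus (?H S) \<le> int (sum D (verts (?H S)))" using H by blast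
      then show ?thesis by (simp add: genus_def)
    qed
    then show ?C using sum_disjoint_ge_inside[OF mg, of D] by blast
  next
    assume C: ?C
    show "\<forall>H. subgraph H G \<and> connected H \<longrightarrow> genus H \<le> int (sum D (verts H))"
    proof clarify
      fix H assume H: "subgraph H G" "connected H"
      have v: "verts H \<subseteq> verts G" using H(1) by (simp add: subgraph_def)
      have wf: "wf_digraph H" using H(1) by (simp add: subgraph_def)
      have "verts H \<noteq> {}" using H(2) connected_iff_conn[OF wf] by (simp add: conn_def)
      then have "int (card (inside (arcs G) (tail G) (head G) (verts H))) - int (card (verts H)) + 1 \<le> int (sum D (verts H))"
        using C v by blast
      moreover have "arcs H \<subseteq> inside (arcs G) (tail G) (head G) (verts H)"
        using H(1) wf unfolding subgraph_def compatible_def wf_digraph_def inside_def by auto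
      then have "card (arcs H) \<le> card (inside (arcs G) (tail G) (head G) (verts H))"
        by (intro card_mono finI)
      ultimately show "genus H \<le> int (sum D (verts H))" by (simp add: genus_def)
    qed
  qed
  then show ?thesis unfolding break_divisors_def genus_def by simp
qed

lemma inside_cut_card:
  assumes "multigraph V E t h" "S \<subseteq> V"
  shows "card E = card (inside E t h S) + card (inside E t h (V - S)) + card (cut_edges E t h S)"
proof -
  have fin: "finite E" using assms by (simp add: multigraph_def)
  have "E = (inside E t h S \<union> inside E t h (V - S)) \<union> cut_edges E t h S"
    using assms by (auto simp: multigraph_def inside_def cut_edges_def crosses_def)
  moreover have "card ((inside E t h S \<union> inside E t h (V - S)) \<union> cut_edges E t h S)
      = card (inside E t h S \<union> inside E t h (V - S)) + card (cut_edges E t h S)"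
    using fin by (intro card_Un_disjoint) (auto simp: inside_def cut_edges_def crosses_def)
  moreover have "card (inside E t h S \<union> inside E t h (V - S)) = card (inside E t h S) + card (inside E t h (V - S))"
    using fin by (intro card_Un_disjoint) (auto simp: inside_def)
  ultimately show ?thesis by simp
qed

definition break_monomials :: "('v, 'e) pre_digraph \<Rightarrow> ('v \<Rightarrow>\<^sub>0 nat) set" where
  "break_monomials G = {m. Poly_Mapping.lookup m \<in> break_divisors G}"

lemma finite_break_divisors:
  assumes fin: "fin_digraph G"
  shows "finite (break_divisors G)"
proof -
  interpret fin_digraph G by (rule fin)
  define g where "g = nat (int (card (arcs G)) - int (card (verts G)) + 1)"
  have "break_divisors G \<subseteq> {D. \<forall>v. (v \<in> verts G \<longrightarrow> D v \<in> {..g}) \<and> (v \<notin> verts G \<longrightarrow> D v = 0)}"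
  proof
    fix D assume D: "D \<in> break_divisors G"
    have "int (sum D (verts G)) = int (card (arcs G)) - int (card (verts G)) + 1"
      using D unfolding break_divisors_iff[OF fin] by (elim conjE)
    then have "sum D (verts G) = g" unfolding g_def by linarith
    then have "D v \<le> g" if "v \<in> verts G" for v
      using that member_le_sum[of v "verts G" D] by simp
    then show "D \<in> {D. \<forall>v. (v \<in> verts G \<longrightarrow> D v \<in> {..g}) \<and> (v \<notin> verts G \<longrightarrow> D v = 0)}"
      using D unfolding break_divisors_iff[OF fin] by simp
  qed
  moreover have "finite {D. \<forall>v. (v \<in> verts G \<longrightarrow> D v \<in> {..g}) \<and> (v \<notin> verts G \<longrightarrow> D v = 0)}"
    by (rule finite_set_of_finite_funs) simp_all
  ultimately show ?thesis by (rule finite_subset)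
qed

lemma lookup_break_monomials:
  assumes fin: "fin_digraph G"
  shows "Poly_Mapping.lookup ` break_monomials G = break_divisors G"
proof -
  interpret fin_digraph G by (rule fin)
  have "D \<in> Poly_Mapping.lookup ` break_monomials G" if D: "D \<in> break_divisors G" for D
  proof -
    have "{v. D v \<noteq> 0} \<subseteq> verts G" using D unfolding break_divisors_iff[OF fin] by auto
    then have "finite {v. D v \<noteq> 0}" by (rule finite_subset) simp
    then have l: "Poly_Mapping.lookup (Abs_poly_mapping D) = D" by (rule lookup_Abs_poly_mapping)
    then show ?thesis using D unfolding break_monomials_def by (intro image_eqI[of _ _ "Abs_poly_mapping D"]) simp_all
  qed
  then show ?thesis by (auto simp: break_monomials_def)
qed

lemma inj_lookup: "inj_on Poly_Mapping.lookup M"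
proof (rule inj_onI, rule poly_mapping_eqI)
  fix x y :: "'a \<Rightarrow>\<^sub>0 'b" and k
  assume "Poly_Mapping.lookup x = Poly_Mapping.lookup y"
  then show "Poly_Mapping.lookup x k = Poly_Mapping.lookup y k" by (rule fun_cong)
qed

lemma finite_break_monomials:
  assumes fin: "fin_digraph G"
  shows "finite (break_monomials G)"
  using finite_break_divisors[OF fin] unfolding lookup_break_monomials[OF fin, symmetric]
  by (rule finite_imageD[OF _ inj_lookup])

text \<open>
  With \<open>\<tau>\<close> constant \<open>1/n\<close>, subtracting \<open>1\<close> from all coordinates turns lattice points into break
  divisors: for proper \<open>S\<close> the number \<open>|S|/n\<close> lies strictly between \<open>0\<close> and \<open>1\<close>, so adding it to the
  bound for an integer is the same as adding \<open>1\<close>.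
\<close>

lemma dim_slims_le_break:
  assumes fin: "fin_digraph G" and c: "connected G"
  shows "mpoly.dim (slims (verts G) (arcs G) (tail G) (head G)) \<le> card (break_monomials G)"
proof -
  interpret fin_digraph G by (rule fin)
  let ?V = "verts G" and ?E = "arcs G" and ?t = "tail G" and ?h = "head G"
  have mg: "multigraph ?V ?E ?t ?h" by (auto simp: multigraph_def)
  have cn: "conn ?V ?E ?t ?h" using c connected_iff_conn[OF wf_digraph_axioms] by simp
  have ne: "?V \<noteq> {}" using cn by (simp add: conn_def)
  have n: "card ?V > 0" using ne by (simp add: card_gt_0_iff)
  define \<tau> where "\<tau> = (\<lambda>v::'a. 1 / rat_of_nat (card ?V))"
  have sum\<tau>: "sum \<tau> S = rat_of_nat (card S) / rat_of_nat (card ?V)" for S by (simp add: \<tau>_def)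
  have "sum \<tau> ?V = of_int 1" using ne by (simp add: sum\<tau>)
  then have "\<exists>n::int. sum \<tau> ?V = of_int n" by blast
  then obtain B C where BC: "finite B" "finite C" "card B \<le> card C" "slims ?V ?E ?t ?h \<subseteq> mpoly.span B"
    "C \<subseteq> lattice_points ?V ?E ?t ?h \<tau>"
    using slims_dim_le_lattice_points[OF mg cn, rule_format, of \<tau>] by blast
  define D where "D z = (\<lambda>v. if v \<in> ?V then nat (z v - 1) else 0)" for z :: "'a \<Rightarrow> int"
  have zS: "int (card (inside ?E ?t ?h S)) + 1 \<le> sum z S" if "z \<in> C" "S \<subseteq> ?V" "S \<noteq> {}" for z S
  proof -
    have "finite S" by (rule finite_subset[OF that(2) finite_verts])
    then have "card S > 0" using that by (simp add: card_gt_0_iff)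
    then have "0 < sum \<tau> S" using n by (simp add: sum\<tau>)
    moreover have "of_nat (card (inside ?E ?t ?h S)) + sum \<tau> S \<le> of_int (sum z S)"
      using BC(5) that by (auto simp: lattice_points_def)
    ultimately have "rat_of_int (int (card (inside ?E ?t ?h S))) < of_int (sum z S)" by simp
    then have "int (card (inside ?E ?t ?h S)) < sum z S" unfolding of_int_less_iff .
    then show ?thesis by simp
  qed
  have zV: "sum z ?V = int (card (inside ?E ?t ?h ?V)) + 1" if "z \<in> C" for z
  proof -
    have "rat_of_int (sum z ?V) = of_int (int (card (inside ?E ?t ?h ?V)) + 1)"
      using BC(5) that \<open>sum \<tau> ?V = of_int 1\<close> by (auto simp: lattice_points_def)
    then show ?thesis unfolding of_int_eq_iff .
  qed
  have Dz: "int (D z v) = z v - 1" if "z \<in> C" "v \<in> ?V" for z v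
    using zS[OF that(1), of "{v}"] that by (simp add: D_def)
  have sumD: "int (sum (D z) S) = sum z S - int (card S)" if "z \<in> C" "S \<subseteq> ?V" for z S
  proof -
    have "int (sum (D z) S) = (\<Sum>v\<in>S. z v - 1)"
      unfolding of_nat_sum using that by (intro sum.cong refl Dz) auto
    then show ?thesis by (simp add: sum_subtractf)
  qed
  have Dbreak: "D z \<in> break_divisors G" if z: "z \<in> C" for z
    unfolding break_divisors_iff[OF fin]
  proof (intro conjI allI impI)
    show "D z v = 0" if "v \<notin> ?V" for v using that by (simp add: D_def)
    have "inside ?E ?t ?h ?V = ?E" by (auto simp: inside_def)
    then show "int (sum (D z) ?V) = int (card ?E) - int (card ?V) + 1"
      using sumD[OF z subset_refl] zV[OF z] by simp
    show "int (card (inside ?E ?t ?h S)) - int (card S) + 1 \<le> int (sum (D z) S)" if "S \<subseteq> ?V" "S \<noteq> {}" for S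
      using sumD[OF z that(1)] zS[OF z that] by simp
  qed
  have injD: "inj_on D C"
  proof (rule inj_onI, rule ext)
    fix z1 z2 v assume z: "z1 \<in> C" "z2 \<in> C" "D z1 = D z2"
    show "z1 v = z2 v"
    proof (cases "v \<in> ?V")
      case True then show ?thesis using Dz[OF z(1) True] Dz[OF z(2) True] z(3) by simp
    next
      case False
      have "z1 \<in> lattice_points ?V ?E ?t ?h \<tau>" "z2 \<in> lattice_points ?V ?E ?t ?h \<tau>"
        using BC(5) z by blast+
      then have "z1 v = 0" "z2 v = 0" using False unfolding lattice_points_def by blast+
      then show ?thesis by simp
    qed
  qed
  have "mpoly.dim (slims ?V ?E ?t ?h) \<le> card B" by (rule mpoly.dim_le_card[OF BC(4,1)])
  also have "\<dots> \<le> card C" by (rule BC(3))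
  also have "\<dots> \<le> card (break_divisors G)"
    using Dbreak by (intro card_inj_on_le[OF injD]) (auto intro: finite_break_divisors[OF fin])
  also have "\<dots> = card (break_monomials G)"
    unfolding lookup_break_monomials[OF fin, symmetric] by (rule card_image[OF inj_lookup])
  finally show ?thesis .
qed

text \<open>
  For a break divisor the inequality for \<open>V - S\<close> bounds the sum over \<open>S\<close> from above, and the distance of
  the two bounds is the number of edges between \<open>S\<close> and \<open>V - S\<close>.
\<close>

lemma bounded_width_break:
  assumes fin: "fin_digraph G" and c: "connected G"
  shows "bounded_width (verts G) (arcs G) (tail G) (head G) (break_monomials G)
    (nat (int (card (arcs G)) - int (card (verts G)) + 1))"
proof -
  interpret fin_digraph G by (rule fin)
  let ?V = "verts G" and ?E = "arcs G" and ?t = "tail G" and ?h = "head G"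
  have mg: "multigraph ?V ?E ?t ?h" by (auto simp: multigraph_def)
  have D: "(\<forall>v. v \<notin> ?V \<longrightarrow> Poly_Mapping.lookup m v = 0)
    \<and> int (sum (Poly_Mapping.lookup m) ?V) = int (card ?E) - int (card ?V) + 1
    \<and> (\<forall>S\<subseteq>?V. S \<noteq> {} \<longrightarrow> int (card (inside ?E ?t ?h S)) - int (card S) + 1 \<le> int (sum (Poly_Mapping.lookup m) S))"
    if "m \<in> break_monomials G" for m
    using that unfolding break_monomials_def break_divisors_iff[OF fin] by simp
  show ?thesis
  proof
    show "multigraph ?V ?E ?t ?h" by (rule mg)
    show "conn ?V ?E ?t ?h" using c connected_iff_conn[OF wf_digraph_axioms] by simp
    show "finite (break_monomials G)" by (rule finite_break_monomials[OF fin])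
    fix m assume m: "m \<in> break_monomials G"
    show "Poly_Mapping.keys m \<subseteq> ?V" using D[OF m] by (auto simp: in_keys_iff)
    show "(\<Sum>v\<in>?V. Poly_Mapping.lookup m v) = nat (int (card ?E) - int (card ?V) + 1)"
      using conjunct1[OF conjunct2[OF D[OF m]]] by linarith
  next
    fix S assume S: "proper ?V S"
    define l where "l = int (card (inside ?E ?t ?h S)) - int (card S) + 1"
    have S': "S \<subseteq> ?V" "S \<noteq> {}" "?V - S \<subseteq> ?V" "?V - S \<noteq> {}" using S by (auto simp: proper_def)
    have cardV: "card ?V = card (?V - S) + card S"
      using S'(1) by (metis card_Diff_subset card_mono finite_subset finite_verts le_add_diff_inverse2)
    have "l \<le> int (\<Sum>v\<in>S. Poly_Mapping.lookup m v) \<and> int (\<Sum>v\<in>S. Poly_Mapping.lookup m v) < l + int (card (cut_edges ?E ?t ?h S))"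
      if m: "m \<in> break_monomials G" for m
    proof -
      have "sum (Poly_Mapping.lookup m) ?V = sum (Poly_Mapping.lookup m) (?V - S) + sum (Poly_Mapping.lookup m) S"
        by (rule sum.subset_diff[OF S'(1)]) simp
      moreover have "int (card (inside ?E ?t ?h (?V - S))) - int (card (?V - S)) + 1 \<le> int (sum (Poly_Mapping.lookup m) (?V - S))"
        "l \<le> int (sum (Poly_Mapping.lookup m) S)"
        using D[OF m] S' unfolding l_def by blast+
      ultimately show ?thesis
        using inside_cut_card[OF mg S'(1)] cardV conjunct1[OF conjunct2[OF D[OF m]]] unfolding l_def by linarith
    qed
    then show "\<exists>l::int. \<forall>m\<in>break_monomials G. l \<le> int (\<Sum>v\<in>S. Poly_Mapping.lookup m v)
        \<and> int (\<Sum>v\<in>S. Poly_Mapping.lookup m v) < l + int (card (cut_edges ?E ?t ?h S))" by blast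
  qed
qed

lemma card_orbits_break:
  assumes fin: "fin_digraph G" and S: "\<And>\<pi>. \<pi> \<in> S \<Longrightarrow> bij \<pi>"
  shows "card (orbits S (break_divisors G)) = card (monomial_orbits S (break_monomials G))"
proof -
  have l: "Poly_Mapping.lookup (act \<pi> m) = Poly_Mapping.lookup m \<circ> inv \<pi>" if "\<pi> \<in> S" for \<pi> m
    using lookup_act[OF S[OF that]] by auto
  have "orbits S (break_divisors G) = image Poly_Mapping.lookup ` monomial_orbits S (break_monomials G)"
    unfolding orbits_def monomial_orbits_def lookup_break_monomials[OF fin, symmetric] image_image
    using l by (intro image_cong refl) simp
  moreover have "inj_on (image Poly_Mapping.lookup) (monomial_orbits S (break_monomials G))"
    by (rule inj_onI) (simp add: inj_image_eq_iff[OF inj_lookup])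
  ultimately show ?thesis by (simp add: card_image)
qed

section \<open>The covering graph\<close>

abbreviation vlex :: "((nat \<times> nat) \<times> (nat \<times> nat)) set" where
  "vlex \<equiv> less_than <*lex*> less_than"

lemma lex_iff: "(u, v) \<in> vlex \<longleftrightarrow> fst u < fst v \<or> fst u = fst v \<and> snd u < snd v"
  by (cases u; cases v) auto

lemma lex_asym: "(u, v) \<in> vlex \<Longrightarrow> (v, u) \<notin> vlex" and lex_total: "u \<noteq> v \<Longrightarrow> (u, v) \<notin> vlex \<Longrightarrow> (v, u) \<in> vlex"
  and lex_irrefl: "(u, u) \<notin> vlex"
  unfolding lex_iff by (auto simp: prod_eq_iff)

lemma prod_mscale: "(\<Prod>x\<in>X. mscale (c x) (f x)) = mscale (prod c X) (prod f X)"
  by (induction X rule: infinite_finite_induct) (simp_all add: mscale_def Const_1 Const_mult mult_ac)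

lemma mscale_power: "mscale c p ^ n = mscale (c ^ n) (p ^ n)"
  by (simp add: mscale_def Const_power power_mult_distrib)

lemma finite_cover_verts: "finite (cover_verts k \<gamma>)"
proof -
  have "cover_verts k \<gamma> = Sigma {1..k} (\<lambda>i. {1..\<gamma> i})" by (auto simp: cover_verts_def)
  then show ?thesis by simp
qed

locale cover =
  fixes k :: nat and a :: "nat \<Rightarrow> nat \<Rightarrow> nat" and \<gamma> :: "nat \<Rightarrow> nat"
  assumes mult_sym: "\<And>i j. i \<in> {1..k} \<Longrightarrow> j \<in> {1..k} \<Longrightarrow> a i j = a j i"
    and connected: "connected (covering_graph k a \<gamma>)"
begin

abbreviation V where "V \<equiv> cover_verts k \<gamma>"
abbreviation G where "G \<equiv> covering_graph k a \<gamma>"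
abbreviation E where "E \<equiv> arcs G"
abbreviation t where "t \<equiv> tail G"
abbreviation h where "h \<equiv> head G"
abbreviation S\<gamma> where "S\<gamma> \<equiv> sym_group k \<gamma>"

lemma finV: "finite V" by (rule finite_cover_verts)

lemma vertsG: "verts G = V" by (simp add: covering_graph_def)

lemma arc_iff: "e \<in> E \<longleftrightarrow> t e \<in> V \<and> h e \<in> V \<and> (t e, h e) \<in> vlex \<and> snd (snd e) < edge_mult a (t e) (h e)"
  by (cases e) (simp add: covering_graph_def)

lemma t_eq: "t (u, v, m) = u" and h_eq: "h (u, v, m) = v"
  by (simp_all add: covering_graph_def)

lemma finE: "finite E"
proof -
  let ?P = "{(u, v). u \<in> V \<and> v \<in> V}"
  have "?P = V \<times> V" by auto
  then have "finite ?P" using finV by simp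
  then have "finite ((\<lambda>((u, v), m). (u, v, m)) ` Sigma ?P (\<lambda>(u, v). {..<edge_mult a u v}))" by auto
  moreover have "E \<subseteq> (\<lambda>((u, v), m). (u, v, m)) ` Sigma ?P (\<lambda>(u, v). {..<edge_mult a u v})"
    by (auto simp: covering_graph_def image_iff)
  ultimately show ?thesis by (rule finite_subset[rotated])
qed

lemma fin_G: "fin_digraph G"
proof
  show "tail G e \<in> verts G" "head G e \<in> verts G" if "e \<in> E" for e
    using that unfolding vertsG arc_iff by simp_all
  show "finite (verts G)" unfolding vertsG by (rule finV)
  show "finite E" by (rule finE)
qed

lemma wf_G: "wf_digraph G" using fin_G by (simp add: fin_digraph_def)

lemma multigraph_G: "multigraph V E t h"
  using finV finE by (simp add: multigraph_def arc_iff)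

lemma conn_G: "conn V E t h"
  using connected_iff_conn[OF wf_G] connected unfolding vertsG by simp

lemma edge_mult_sym: "u \<in> V \<Longrightarrow> v \<in> V \<Longrightarrow> edge_mult a u v = edge_mult a v u"
  using mult_sym by (auto simp: edge_mult_def cover_verts_def)

text \<open>
  The edges of a cut, grouped by their pairs of ends. Stated for an arbitrary symmetric function so that
  it serves both for the cut products and, with a constant function, for the sizes of cuts.
\<close>

lemma prod_cut:
  fixes f :: "nat \<times> nat \<Rightarrow> nat \<times> nat \<Rightarrow> 'b::comm_monoid_mult"
  assumes f: "\<And>u v. f u v = f v u" and S: "S \<subseteq> V"
  shows "(\<Prod>e\<in>cut_edges E t h S. f (t e) (h e)) = (\<Prod>s\<in>S. \<Prod>s'\<in>V - S. f s s' ^ edge_mult a s s')"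
proof -
  define P where "P = {p \<in> V \<times> V. p \<in> vlex \<and> (fst p \<in> S) \<noteq> (snd p \<in> S)}"
  have finP: "finite P" using finV by (simp add: P_def)
  let ?g = "\<lambda>(p, m :: nat). (fst p, snd p, m)"
  have cut_edges: "cut_edges E t h S = ?g ` Sigma P (\<lambda>p. {..<edge_mult a (fst p) (snd p)})"
  proof (intro equalityI subsetI)
    fix e assume e: "e \<in> cut_edges E t h S"
    then have "((t e, h e), snd (snd e)) \<in> Sigma P (\<lambda>p. {..<edge_mult a (fst p) (snd p)})"
      by (auto simp: cut_edges_def crosses_def P_def arc_iff)
    moreover have "e = ?g ((t e, h e), snd (snd e))" by (cases e) (simp add: t_eq h_eq)
    ultimately show "e \<in> ?g ` Sigma P (\<lambda>p. {..<edge_mult a (fst p) (snd p)})" by blast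
  next
    fix e assume "e \<in> ?g ` Sigma P (\<lambda>p. {..<edge_mult a (fst p) (snd p)})"
    then show "e \<in> cut_edges E t h S" by (auto simp: cut_edges_def crosses_def P_def arc_iff t_eq h_eq)
  qed
  have inj: "inj_on ?g (Sigma P (\<lambda>p. {..<edge_mult a (fst p) (snd p)}))"
    by (rule inj_onI) (auto simp: prod_eq_iff)
  have "(\<Prod>e\<in>cut_edges E t h S. f (t e) (h e))
      = (\<Prod>(p, m)\<in>Sigma P (\<lambda>p. {..<edge_mult a (fst p) (snd p)}). f (fst p) (snd p))"
    unfolding cut_edges prod.reindex[OF inj] by (intro prod.cong refl) (auto simp: t_eq h_eq)
  also have "\<dots> = (\<Prod>p\<in>P. \<Prod>m<edge_mult a (fst p) (snd p). f (fst p) (snd p))"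
    using finP by (subst prod.Sigma) simp_all
  also have "\<dots> = (\<Prod>p\<in>P. f (fst p) (snd p) ^ edge_mult a (fst p) (snd p))" by simp
  also have "\<dots> = (\<Prod>p\<in>S \<times> (V - S). f (fst p) (snd p) ^ edge_mult a (fst p) (snd p))"
  proof (rule prod.reindex_bij_witness[of P "\<lambda>p. if p \<in> vlex then p else (snd p, fst p)"
        "\<lambda>p. if fst p \<in> S then p else (snd p, fst p)"])
    fix p assume p: "p \<in> P"
    show "(if (if fst p \<in> S then p else (snd p, fst p)) \<in> vlex then (if fst p \<in> S then p else (snd p, fst p))
        else (snd (if fst p \<in> S then p else (snd p, fst p)), fst (if fst p \<in> S then p else (snd p, fst p)))) = p"
      using p lex_asym[of "fst p" "snd p"] by (auto simp: P_def)
    show "(if fst p \<in> S then p else (snd p, fst p)) \<in> S \<times> (V - S)"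
      using p by (auto simp: P_def)
    show "f (fst (if fst p \<in> S then p else (snd p, fst p))) (snd (if fst p \<in> S then p else (snd p, fst p)))
        ^ edge_mult a (fst (if fst p \<in> S then p else (snd p, fst p))) (snd (if fst p \<in> S then p else (snd p, fst p)))
        = f (fst p) (snd p) ^ edge_mult a (fst p) (snd p)"
      using p f edge_mult_sym[of "fst p" "snd p"] by (auto simp: P_def)
  next
    fix p assume p: "p \<in> S \<times> (V - S)"
    then have ne: "fst p \<noteq> snd p" by auto
    show "(if p \<in> vlex then p else (snd p, fst p)) \<in> P"
      using p S lex_total[OF ne] by (auto simp: P_def)
    show "(if fst (if p \<in> vlex then p else (snd p, fst p)) \<in> S then (if p \<in> vlex then p else (snd p, fst p))
        else (snd (if p \<in> vlex then p else (snd p, fst p)), fst (if p \<in> vlex then p else (snd p, fst p)))) = p"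
      using p by auto
  qed
  also have "\<dots> = (\<Prod>s\<in>S. \<Prod>s'\<in>V - S. f s s' ^ edge_mult a s s')"
    by (simp add: prod.cartesian_product case_prod_unfold)
  finally show ?thesis .
qed

lemma sym_group_conv:
  "\<pi> \<in> S\<gamma> \<longleftrightarrow> (\<exists>\<sigma>. \<pi> = (\<lambda>(i, \<alpha>). (i, \<sigma> i \<alpha>)) \<and> (\<forall>i. \<sigma> i permutes {1..\<gamma> i}) \<and> (\<forall>i. i \<notin> {1..k} \<longrightarrow> \<sigma> i = id))"
proof -
  have "(\<forall>i\<in>{1..k}. \<sigma> i permutes {1..\<gamma> i}) \<and> (\<forall>i. i \<notin> {1..k} \<longrightarrow> \<sigma> i = id)
    \<longleftrightarrow> (\<forall>i. \<sigma> i permutes {1..\<gamma> i}) \<and> (\<forall>i. i \<notin> {1..k} \<longrightarrow> \<sigma> i = id)" for \<sigma> :: "nat \<Rightarrow> nat \<Rightarrow> nat"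
    using permutes_id by metis
  then show ?thesis unfolding sym_group_def by (simp only: mem_Collect_eq)
qed

lemma sym_group_fst: "\<pi> \<in> S\<gamma> \<Longrightarrow> fst (\<pi> u) = fst u"
  unfolding sym_group_conv by (cases u) auto

lemma sym_group_inv:
  assumes \<sigma>: "\<And>i. (\<sigma> :: nat \<Rightarrow> nat \<Rightarrow> nat) i permutes {1..\<gamma> i}"
  shows "inv (\<lambda>(i, \<alpha>). (i, \<sigma> i \<alpha>)) = (\<lambda>(i :: nat, \<alpha>). (i, inv (\<sigma> i) \<alpha>))"
  by (rule inv_unique_comp) (auto simp: fun_eq_iff permutes_inverses[OF \<sigma>])

lemma perm_group_sym: "perm_group V S\<gamma>"
  unfolding perm_group_def
proof (intro conjI ballI)
  show "id \<in> S\<gamma>"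
    unfolding sym_group_conv by (rule exI[of _ "\<lambda>_. id"]) (auto simp: permutes_id)
next
  fix \<pi> assume "\<pi> \<in> S\<gamma>"
  then obtain \<sigma> where \<sigma>: "\<pi> = (\<lambda>(i, \<alpha>). (i, \<sigma> i \<alpha>))" "\<And>i. \<sigma> i permutes {1..\<gamma> i}" "\<And>i. i \<notin> {1..k} \<Longrightarrow> \<sigma> i = id"
    unfolding sym_group_conv by blast
  show "inv \<pi> \<in> S\<gamma>"
    unfolding sym_group_conv
  proof (intro exI[of _ "\<lambda>i. inv (\<sigma> i)"] conjI allI impI)
    show "inv \<pi> = (\<lambda>(i, \<alpha>). (i, inv (\<sigma> i) \<alpha>))" unfolding \<sigma>(1) by (rule sym_group_inv[OF \<sigma>(2)])
    show "inv (\<sigma> i) permutes {1..\<gamma> i}" for i by (rule permutes_inv[OF \<sigma>(2)])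
    show "inv (\<sigma> i) = id" if "i \<notin> {1..k}" for i using \<sigma>(3)[OF that] by simp
  qed
  have fixed: "\<sigma> i \<alpha> = \<alpha>" if "(i, \<alpha>) \<notin> V" for i \<alpha>
  proof (cases "i \<in> {1..k}")
    case True
    then have "\<alpha> \<notin> {1..\<gamma> i}" using that by (auto simp: cover_verts_def)
    then show ?thesis by (rule permutes_not_in[OF \<sigma>(2)])
  next
    case False then show ?thesis using \<sigma>(3) by simp
  qed
  show "\<pi> permutes V"
    unfolding permutes_def
  proof (intro conjI allI impI)
    show "\<pi> u = u" if "u \<notin> V" for u using that fixed by (cases u) (simp add: \<sigma>(1))
    show "\<exists>!x. \<pi> x = y" for y
    proof (cases y)
      case (Pair i \<beta>)
      show ?thesis
      proof (rule ex1I[of _ "(i, inv (\<sigma> i) \<beta>)"])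
        show "\<pi> (i, inv (\<sigma> i) \<beta>) = y" by (simp add: \<sigma>(1) Pair permutes_inverses[OF \<sigma>(2)])
        show "x = (i, inv (\<sigma> i) \<beta>)" if "\<pi> x = y" for x
          using that by (cases x) (auto simp: \<sigma>(1) Pair permutes_inverses[OF \<sigma>(2)])
      qed
    qed
  qed
  fix \<rho> assume "\<rho> \<in> S\<gamma>"
  then obtain \<tau> where \<tau>: "\<rho> = (\<lambda>(i, \<alpha>). (i, \<tau> i \<alpha>))" "\<And>i. \<tau> i permutes {1..\<gamma> i}" "\<And>i. i \<notin> {1..k} \<Longrightarrow> \<tau> i = id"
    unfolding sym_group_conv by blast
  show "\<pi> \<circ> \<rho> \<in> S\<gamma>"
    unfolding sym_group_conv
  proof (intro exI[of _ "\<lambda>i. \<sigma> i \<circ> \<tau> i"] conjI allI impI)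
    show "\<pi> \<circ> \<rho> = (\<lambda>(i, \<alpha>). (i, (\<sigma> i \<circ> \<tau> i) \<alpha>))" by (auto simp: fun_eq_iff \<sigma>(1) \<tau>(1))
    show "\<sigma> i \<circ> \<tau> i permutes {1..\<gamma> i}" for i by (rule permutes_compose[OF \<tau>(2) \<sigma>(2)])
    show "\<sigma> i \<circ> \<tau> i = id" if "i \<notin> {1..k}" for i using \<sigma>(3)[OF that] \<tau>(3)[OF that] by simp
  qed
qed

lemma sym_permutes: "\<pi> \<in> S\<gamma> \<Longrightarrow> \<pi> permutes V" and sym_inv: "\<pi> \<in> S\<gamma> \<Longrightarrow> inv \<pi> \<in> S\<gamma>"
  using perm_group_sym by (simp_all add: perm_group_def)

lemma sym_bij: "\<pi> \<in> S\<gamma> \<Longrightarrow> bij \<pi>"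
  using sym_permutes permutes_bij by blast

lemma edge_mult_perm: "\<pi> \<in> S\<gamma> \<Longrightarrow> edge_mult a (\<pi> u) (\<pi> v) = edge_mult a u v"
  by (simp add: edge_mult_def sym_group_fst)

lemma prod_perm:
  fixes f :: "nat \<times> nat \<Rightarrow> nat \<times> nat \<Rightarrow> 'b::comm_monoid_mult"
  assumes \<pi>: "\<pi> \<in> S\<gamma>"
  shows "(\<Prod>s\<in>\<pi> ` S. \<Prod>s'\<in>V - \<pi> ` S. f s s' ^ edge_mult a s s')
    = (\<Prod>s\<in>S. \<Prod>s'\<in>V - S. f (\<pi> s) (\<pi> s') ^ edge_mult a s s')"
proof -
  have inj: "inj_on \<pi> X" for X by (rule inj_on_subset[OF bij_is_inj[OF sym_bij[OF \<pi>]] subset_UNIV])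
  have "V - \<pi> ` S = \<pi> ` V - \<pi> ` S" using permutes_image[OF sym_permutes[OF \<pi>]] by simp
  also have "\<dots> = \<pi> ` (V - S)" using image_set_diff[OF bij_is_inj[OF sym_bij[OF \<pi>]], of V S] by simp
  finally have "V - \<pi> ` S = \<pi> ` (V - S)" .
  then show ?thesis by (simp add: prod.reindex[OF inj] edge_mult_perm[OF \<pi>])
qed

lemma image_subset_V: "\<pi> \<in> S\<gamma> \<Longrightarrow> S \<subseteq> V \<Longrightarrow> \<pi> ` S \<subseteq> V"
  using permutes_image[OF sym_permutes] by blast

lemma proper_image:
  assumes \<pi>: "\<pi> \<in> S\<gamma>" and S: "proper V S"
  shows "proper V (\<pi> ` S)"
proof -
  have "\<pi> ` S \<noteq> \<pi> ` V"
    using S inj_image_eq_iff[OF bij_is_inj[OF sym_bij[OF \<pi>]], of S V] by (simp add: proper_def)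
  then show ?thesis
    using S image_subset_V[OF \<pi>, of S] permutes_image[OF sym_permutes[OF \<pi>]] by (auto simp: proper_def)
qed

lemma card_cut_image:
  assumes \<pi>: "\<pi> \<in> S\<gamma>" and S: "S \<subseteq> V"
  shows "card (cut_edges E t h (\<pi> ` S)) = card (cut_edges E t h S)"
proof -
  \<comment> \<open>The product over a cut of the constant function \<open>2\<close> determines its size.\<close>
  have "(2 :: nat) ^ card (cut_edges E t h (\<pi> ` S)) = 2 ^ card (cut_edges E t h S)"
    using prod_cut[of "\<lambda>_ _. 2 :: nat", OF refl S]
      prod_cut[of "\<lambda>_ _. 2 :: nat", OF refl image_subset_V[OF \<pi> S]]
      prod_perm[OF \<pi>, of "\<lambda>_ _. 2 :: nat" S] by simp
  then show ?thesis by simp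
qed

text \<open>
  It expresses the number of inner edges by sizes of cuts, and so its invariance is inherited from
  theirs.
\<close>

lemma handshake:
  assumes S: "S \<subseteq> V"
  shows "(\<Sum>v\<in>S. card (cut_edges E t h {v})) = 2 * card (inside E t h S) + card (cut_edges E t h S)"
proof -
  have finS: "finite S" using S finV by (rule finite_subset)
  have "(\<Sum>v\<in>S. card (cut_edges E t h {v})) = (\<Sum>v\<in>S. \<Sum>e\<in>E. if crosses t h {v} e then 1 else 0)"
    using finE by (intro sum.cong refl) (simp add: cut_edges_def sum.If_cases Int_def)
  also have "\<dots> = (\<Sum>e\<in>E. \<Sum>v\<in>S. if crosses t h {v} e then 1 else 0)" by (rule sum.swap)
  also have "\<dots> = (\<Sum>e\<in>E. (if t e \<in> S \<and> h e \<in> S then 2 else 0) + (if crosses t h S e then 1 else 0))"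
  proof (intro sum.cong refl)
    fix e assume "e \<in> E"
    then have ne: "t e \<noteq> h e" using lex_irrefl unfolding arc_iff by metis
    have "(\<Sum>v\<in>S. if crosses t h {v} e then 1 else 0 :: nat)
        = (\<Sum>v\<in>S. (if v = t e then 1 else 0) + (if v = h e then 1 else 0))"
      using ne by (intro sum.cong refl) (auto simp: crosses_def)
    also have "\<dots> = (if t e \<in> S then 1 else 0) + (if h e \<in> S then 1 else 0)"
      using finS by (simp add: sum.distrib)
    also have "\<dots> = (if t e \<in> S \<and> h e \<in> S then 2 else 0) + (if crosses t h S e then 1 else 0)"
      by (auto simp: crosses_def)
    finally show "(\<Sum>v\<in>S. if crosses t h {v} e then 1 else 0 :: nat)
        = (if t e \<in> S \<and> h e \<in> S then 2 else 0) + (if crosses t h S e then 1 else 0)" .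
  qed
  also have "\<dots> = (\<Sum>e\<in>E. if t e \<in> S \<and> h e \<in> S then 2 else 0) + (\<Sum>e\<in>E. if crosses t h S e then 1 else 0)"
    by (rule sum.distrib)
  also have "\<dots> = 2 * card (inside E t h S) + card (cut_edges E t h S)"
    using finE by (simp add: inside_def cut_edges_def sum.If_cases Int_def)
  finally show ?thesis .
qed

lemma card_inside_image:
  assumes \<pi>: "\<pi> \<in> S\<gamma>" and S: "S \<subseteq> V"
  shows "card (inside E t h (\<pi> ` S)) = card (inside E t h S)"
proof -
  have inj: "inj_on \<pi> S" by (rule inj_on_subset[OF bij_is_inj[OF sym_bij[OF \<pi>]] subset_UNIV])
  have "(\<Sum>v\<in>\<pi> ` S. card (cut_edges E t h {v})) = (\<Sum>v\<in>S. card (cut_edges E t h (\<pi> ` {v})))"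
    by (simp add: sum.reindex[OF inj])
  also have "\<dots> = (\<Sum>v\<in>S. card (cut_edges E t h {v}))"
    using S by (intro sum.cong refl card_cut_image[OF \<pi>]) blast
  finally show ?thesis
    using handshake[OF S] handshake[OF image_subset_V[OF \<pi> S]] card_cut_image[OF \<pi> S] by simp
qed

lemma act_break:
  assumes \<pi>: "\<pi> \<in> S\<gamma>" and m: "m \<in> break_monomials G"
  shows "act \<pi> m \<in> break_monomials G"
proof -
  let ?D = "Poly_Mapping.lookup m" and ?p = "inv \<pi>"
  have p: "?p \<in> S\<gamma>" by (rule sym_inv[OF \<pi>])
  have inj: "inj_on ?p X" for X by (rule inj_on_subset[OF bij_is_inj[OF sym_bij[OF p]] subset_UNIV])
  have L: "Poly_Mapping.lookup (act \<pi> m) v = ?D (?p v)" for v by (rule lookup_act[OF sym_bij[OF \<pi>]])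
  have sumL: "sum (Poly_Mapping.lookup (act \<pi> m)) S = sum ?D (?p ` S)" for S
    by (simp add: sum.reindex[OF inj] L)
  have D: "\<And>v. v \<notin> V \<Longrightarrow> ?D v = 0" "int (sum ?D V) = int (card E) - int (card V) + 1"
    "\<And>S. S \<subseteq> V \<Longrightarrow> S \<noteq> {} \<Longrightarrow> int (card (inside E t h S)) - int (card S) + 1 \<le> int (sum ?D S)"
    using m unfolding break_monomials_def mem_Collect_eq break_divisors_iff[OF fin_G] vertsG by blast+
  show ?thesis
    unfolding break_monomials_def mem_Collect_eq break_divisors_iff[OF fin_G] vertsG
  proof (intro conjI allI impI)
    show "Poly_Mapping.lookup (act \<pi> m) v = 0" if "v \<notin> V" for v
      unfolding L using that permutes_in_image[OF sym_permutes[OF p], of v] D(1) by simp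
    show "int (sum (Poly_Mapping.lookup (act \<pi> m)) V) = int (card E) - int (card V) + 1"
      unfolding sumL permutes_image[OF sym_permutes[OF p]] by (rule D(2))
    show "int (card (inside E t h S)) - int (card S) + 1 \<le> int (sum (Poly_Mapping.lookup (act \<pi> m)) S)"
      if S: "S \<subseteq> V" "S \<noteq> {}" for S
      using D(3)[OF image_subset_V[OF p S(1)]] S(2)
      unfolding sumL card_inside_image[OF p S(1)] card_image[OF inj] by simp
  qed
qed

section \<open>Stability under the symmetric group\<close>

lemma shift_rename:
  assumes "bij \<pi>"
  shows "shift T (rename \<pi> p) = map_poly (rename \<pi>) (shift (inv \<pi> ` T) p)"
proof (rule hom_eqI)
  show "is_hom (\<lambda>p. shift T (rename \<pi> p))" by (rule is_hom_compose[OF is_hom_shift is_hom_rename])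
  show "is_hom (\<lambda>p. map_poly (rename \<pi>) (shift (inv \<pi> ` T) p))"
    by (simp add: is_hom_def shift_simps map_poly_is_hom[OF is_hom_rename])
  show "shift T (rename \<pi> (Const d)) = map_poly (rename \<pi>) (shift (inv \<pi> ` T) (Const d))" for d
    by (rule poly_eqI) (simp add: shift_simps rename_simps coeff_map_poly coeff_pCons split: nat.split)
  have "w \<in> inv \<pi> ` T \<longleftrightarrow> \<pi> w \<in> T" for w
  proof
    assume "w \<in> inv \<pi> ` T"
    then show "\<pi> w \<in> T" using assms by (auto simp: bij_is_surj surj_f_inv_f)
  next
    assume "\<pi> w \<in> T"
    moreover have "w = inv \<pi> (\<pi> w)" using assms by (simp add: bij_is_inj)
    ultimately show "w \<in> inv \<pi> ` T" by blast
  qed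
  then show "shift T (rename \<pi> (Var w)) = map_poly (rename \<pi>) (shift (inv \<pi> ` T) (Var w))" for w
    by (intro poly_eqI) (simp add: shift_simps rename_simps coeff_map_poly coeff_pCons split: nat.split)
qed

lemma rename_dprods: "q \<in> dprods V \<Longrightarrow> \<pi> \<in> S\<gamma> \<Longrightarrow> rename \<pi> q \<in> dprods V"
proof (induction rule: dprods.induct)
  case one then show ?case by (simp add: rename_simps dprods.one)
next
  case (times q u v)
  then have "\<pi> u \<in> V" "\<pi> v \<in> V" using permutes_in_image[OF sym_permutes] by simp_all
  then show ?case using dprods.times[of "rename \<pi> q" V "\<pi> u" "\<pi> v"] times by (simp add: rename_simps)
qed

lemma rename_diffalg:
  assumes "\<pi> \<in> S\<gamma>" "p \<in> diffalg V"
  shows "rename \<pi> p \<in> diffalg V"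
proof -
  interpret r: Vector_Spaces.linear mscale mscale "rename \<pi>" by (rule linear_rename)
  have "rename \<pi> ` mpoly.span (dprods V) \<subseteq> mpoly.span (dprods V)"
    unfolding r.span_image[symmetric] using assms(1) rename_dprods by (intro mpoly.span_mono) blast
  then show ?thesis using assms(2) unfolding diffalg_eq_span by blast
qed

text \<open>
  Renaming permutes slim products only up to sign and up to a choice of edges. In the description by
  cuts stability is immediate, since the sizes of cuts are invariant.
\<close>

lemma rename_slims:
  assumes \<pi>: "\<pi> \<in> S\<gamma>" and p: "p \<in> slims V E t h"
  shows "rename \<pi> p \<in> slims V E t h"
proof -
  have pc: "p \<in> cutker V E t h" using p slims_eq_cutker[OF multigraph_G conn_G] by simp
  have "coeff (shift T (rename \<pi> p)) i = 0" if T: "proper V T" and i: "card (cut_edges E t h T) \<le> i" for T i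
  proof -
    have "card (cut_edges E t h (inv \<pi> ` T)) = card (cut_edges E t h T)"
      using T by (intro card_cut_image[OF sym_inv[OF \<pi>]]) (simp add: proper_def)
    then have "coeff (shift (inv \<pi> ` T) p) i = 0"
      using pc proper_image[OF sym_inv[OF \<pi>] T] i unfolding cutker_def by simp
    then show ?thesis
      unfolding shift_rename[OF sym_bij[OF \<pi>]] by (simp add: coeff_map_poly rename_simps)
  qed
  moreover have "rename \<pi> p \<in> diffalg V" using pc by (intro rename_diffalg[OF \<pi>]) (simp add: cutker_def)
  ultimately show ?thesis
    unfolding slims_eq_cutker[OF multigraph_G conn_G] cutker_def by blast
qed

text \<open>
  The cut product with all differences directed from \<open>S\<close> to its complement, as in the shuffle kernels.
  The symmetric group permutes these products without signs.
\<close>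

definition pairprod :: "(nat \<times> nat) set \<Rightarrow> (nat \<times> nat) mpoly" where
  "pairprod S = (\<Prod>s\<in>S. \<Prod>s'\<in>V - S. (Var s' - Var s) ^ edge_mult a s s')"

lemma eprod_cut:
  assumes S: "S \<subseteq> V"
  shows "\<exists>c. c * c = 1 \<and> eprod t h (cut_edges E t h S) = mscale c (pairprod S)"
proof -
  \<comment> \<open>The form of an edge is directed by the order of its ends; \<open>F\<close> makes it symmetric.\<close>
  define F :: "nat \<times> nat \<Rightarrow> nat \<times> nat \<Rightarrow> (nat \<times> nat) mpoly" where
    "F u v = (if (u, v) \<in> vlex then Var u - Var v else Var v - Var u)" for u v
  have F: "F u v = F v u" for u v
    using lex_asym[of u v] lex_total[of u v] by (cases "u = v") (auto simp: F_def)
  define sg :: "nat \<times> nat \<Rightarrow> nat \<times> nat \<Rightarrow> rat" where "sg u v = (if (u, v) \<in> vlex then - 1 else 1)" for u v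
  have Fsg: "F u v = mscale (sg u v) (Var v - Var u)" for u v
    by (simp add: F_def sg_def)
  define c where "c = (\<Prod>s\<in>S. \<Prod>s'\<in>V - S. sg s s' ^ edge_mult a s s')"
  have "sg u v * sg u v = 1" for u v by (simp add: sg_def)
  then have "c * c = 1"
    unfolding c_def prod.distrib[symmetric] power_mult_distrib[symmetric] by simp
  moreover have "eprod t h (cut_edges E t h S) = (\<Prod>e\<in>cut_edges E t h S. F (t e) (h e))"
    unfolding eprod_def by (intro prod.cong refl) (simp add: cut_edges_def arc_iff F_def)
  then have "eprod t h (cut_edges E t h S) = mscale c (pairprod S)"
    unfolding prod_cut[of F, OF F S] unfolding Fsg mscale_power prod_mscale c_def pairprod_def .
  ultimately show ?thesis by blast
qed

lemma pairprod_eprod: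
  assumes S: "S \<subseteq> V"
  shows "\<exists>c. pairprod S = mscale c (eprod t h (cut_edges E t h S))"
proof -
  obtain c where "c * c = 1" "eprod t h (cut_edges E t h S) = mscale c (pairprod S)" using eprod_cut[OF S] by blast
  then have "mscale c (eprod t h (cut_edges E t h S)) = pairprod S" by simp
  then show ?thesis by (intro exI[of _ c]) simp
qed

lemma rename_pairprod: "\<pi> \<in> S\<gamma> \<Longrightarrow> rename \<pi> (pairprod S) = pairprod (\<pi> ` S)"
  unfolding pairprod_def by (simp add: prod_perm[of \<pi> "\<lambda>s s'. Var s' - Var s"] rename_simps)

lemma pairprod_cutideal:
  assumes S: "proper V S"
  shows "pairprod S \<in> cutideal V E t h"
proof -
  have "S \<subseteq> V" using S by (simp add: proper_def)
  then obtain c where c: "pairprod S = mscale c (eprod t h (cut_edges E t h S))" using pairprod_eprod by blast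
  show ?thesis
    unfolding c using cutideal_gen[OF S, of t h E] unfolding cutideal_def by (rule mpoly.span_scale)
qed

lemma rename_cutideal:
  assumes \<pi>: "\<pi> \<in> S\<gamma>" and j: "j \<in> cutideal V E t h"
  shows "rename \<pi> j \<in> cutideal V E t h"
proof -
  interpret r: Vector_Spaces.linear mscale mscale "rename \<pi>" by (rule linear_rename)
  have sub: "mpoly.subspace (cutideal V E t h)" by (simp add: cutideal_def)
  have "rename \<pi> x \<in> cutideal V E t h" if x: "x \<in> cutgens V E t h" for x
  proof -
    obtain q S where q: "q \<in> dprods V" "proper V S" "x = q * eprod t h (cut_edges E t h S)"
      using x unfolding cutgens_def by blast
    have "S \<subseteq> V" using q by (simp add: proper_def)
    then obtain c where c: "eprod t h (cut_edges E t h S) = mscale c (pairprod S)" using eprod_cut by blast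
    have "rename \<pi> x = rename \<pi> q * mscale c (pairprod (\<pi> ` S))"
      unfolding q(3) c hom_mult[OF is_hom_rename] r.scale rename_pairprod[OF \<pi>] ..
    moreover have "mscale c (pairprod (\<pi> ` S)) \<in> cutideal V E t h"
      by (intro mpoly.subspace_scale[OF sub] pairprod_cutideal proper_image[OF \<pi> q(2)])
    moreover have "rename \<pi> q \<in> diffalg V" using rename_dprods[OF q(1) \<pi>] dprods_subset_diffalg by blast
    ultimately show ?thesis by (simp only: cutideal_times)
  qed
  then have "rename \<pi> ` cutideal V E t h \<subseteq> cutideal V E t h"
    unfolding cutideal_def r.span_image[symmetric] by (intro mpoly.span_minimal) auto
  then show ?thesis using j by blast
qed

section \<open>Shuffle kernels and the cut ideal\<close>

definition initial :: "(nat \<Rightarrow> nat) \<Rightarrow> (nat \<times> nat) set" where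
  "initial \<delta> = Sigma {1..k} (\<lambda>i. {1..\<delta> i})"

lemma shuffle_kernel_eq:
  assumes \<delta>: "\<And>i. i \<in> {1..k} \<Longrightarrow> \<delta> i \<le> \<gamma> i"
  shows "shuffle_kernel k a \<gamma> \<delta> = pairprod (initial \<delta>)"
proof -
  let ?K = "{1..k}"
  have compl: "V - initial \<delta> = Sigma ?K (\<lambda>j. {\<delta> j + 1..\<gamma> j})"
    using \<delta> by (auto simp: cover_verts_def initial_def not_le Suc_le_eq)
  define X where "X i j = (\<Prod>\<alpha>\<^sub>1\<in>{1..\<delta> i}. \<Prod>\<alpha>\<^sub>2\<in>{\<delta> j + 1..\<gamma> j}.
    (Var (j, \<alpha>\<^sub>2) - Var (i, \<alpha>\<^sub>1) :: (nat \<times> nat) mpoly) ^ (if i = j then a i i - 1 else a i j))" for i j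
  have "pairprod (initial \<delta>) = (\<Prod>i\<in>?K. \<Prod>\<alpha>\<^sub>1\<in>{1..\<delta> i}. \<Prod>j\<in>?K. \<Prod>\<alpha>\<^sub>2\<in>{\<delta> j + 1..\<gamma> j}.
      (Var (j, \<alpha>\<^sub>2) - Var (i, \<alpha>\<^sub>1)) ^ (if i = j then a i i - 1 else a i j))"
  proof -
    have "(\<Prod>s'\<in>V - initial \<delta>. (Var s' - Var (i, \<alpha>\<^sub>1)) ^ edge_mult a (i, \<alpha>\<^sub>1) s')
        = (\<Prod>j\<in>?K. \<Prod>\<alpha>\<^sub>2\<in>{\<delta> j + 1..\<gamma> j}. (Var (j, \<alpha>\<^sub>2) - Var (i, \<alpha>\<^sub>1)) ^ (if i = j then a i i - 1 else a i j))"
      for i \<alpha>\<^sub>1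
      unfolding compl by (subst prod.Sigma) (simp_all add: edge_mult_def case_prod_unfold cong: if_cong)
    note inner = this
    define g where "g i \<alpha>\<^sub>1 = (\<Prod>j\<in>?K. \<Prod>\<alpha>\<^sub>2\<in>{\<delta> j + 1..\<gamma> j}.
      (Var (j, \<alpha>\<^sub>2) - Var (i, \<alpha>\<^sub>1) :: (nat \<times> nat) mpoly) ^ (if i = j then a i i - 1 else a i j))" for i \<alpha>\<^sub>1
    have "pairprod (initial \<delta>) = (\<Prod>s\<in>initial \<delta>. g (fst s) (snd s))"
      unfolding pairprod_def
    proof (intro prod.cong refl)
      fix s
      show "(\<Prod>s'\<in>V - initial \<delta>. (Var s' - Var s) ^ edge_mult a s s') = g (fst s) (snd s)"
        using inner[of "fst s" "snd s"] unfolding g_def prod.collapse .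
    qed
    also have "\<dots> = (\<Prod>i\<in>?K. \<Prod>\<alpha>\<^sub>1\<in>{1..\<delta> i}. g i \<alpha>\<^sub>1)"
      unfolding initial_def by (subst prod.Sigma) (simp_all add: case_prod_unfold)
    finally show ?thesis unfolding g_def .
  qed
  also have "\<dots> = (\<Prod>i\<in>?K. \<Prod>j\<in>?K. X i j)"
    unfolding X_def by (rule prod.cong[OF refl]) (rule prod.swap)
  also have "\<dots> = (\<Prod>i\<in>?K. X i i * (\<Prod>j\<in>?K - {i}. X i j))"
    by (rule prod.cong[OF refl]) (rule prod.remove; simp)
  also have "\<dots> = (\<Prod>i\<in>?K. X i i) * (\<Prod>i\<in>?K. \<Prod>j\<in>?K - {i}. X i j)" by (rule prod.distrib)
  also have "(\<Prod>i\<in>?K. \<Prod>j\<in>?K - {i}. X i j) = (\<Prod>i\<in>?K. \<Prod>j\<in>?K - {i}. \<Prod>\<alpha>\<^sub>1\<in>{1..\<delta> i}. \<Prod>\<alpha>\<^sub>2\<in>{\<delta> j + 1..\<gamma> j}.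
      (Var (j, \<alpha>\<^sub>2) - Var (i, \<alpha>\<^sub>1)) ^ a i j)"
    unfolding X_def by (intro prod.cong refl) auto
  also have "(\<Prod>i\<in>?K. X i i) = (\<Prod>i\<in>?K. \<Prod>\<alpha>\<^sub>1\<in>{1..\<delta> i}. \<Prod>\<alpha>\<^sub>2\<in>{\<delta> i + 1..\<gamma> i}.
      (Var (i, \<alpha>\<^sub>2) - Var (i, \<alpha>\<^sub>1)) ^ (a i i - 1))"
    unfolding X_def by simp
  finally show ?thesis unfolding shuffle_kernel_def by (simp only: mult.commute)
qed

lemma permutes_onto:
  assumes "finite A" "B \<subseteq> A" "C \<subseteq> A" "card B = card C"
  shows "\<exists>p. p permutes A \<and> p ` B = C"
proof -
  have fin: "finite B" "finite C" using assms finite_subset by blast+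
  obtain f where f: "bij_betw f B C" using finite_same_card_bij[OF fin assms(4)] by blast
  have "card (A - B) = card (A - C)" using assms fin by (simp add: card_Diff_subset)
  then obtain g where g: "bij_betw g (A - B) (A - C)" using finite_same_card_bij[of "A - B" "A - C"] assms(1) by auto
  define p where "p x = (if x \<in> B then f x else if x \<in> A then g x else x)" for x
  have "bij_betw p B C" using f by (rule bij_betw_cong[THEN iffD1, rotated]) (simp add: p_def)
  moreover have "bij_betw p (A - B) (A - C)" using g by (rule bij_betw_cong[THEN iffD1, rotated]) (simp add: p_def)
  ultimately have "bij_betw p (B \<union> (A - B)) (C \<union> (A - C))" by (rule bij_betw_combine) blast
  then have "bij_betw p A A" using assms by (simp add: Un_absorb1)
  moreover have "p x = x" if "x \<notin> A" for x using that assms(2) by (auto simp: p_def)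
  ultimately have "p permutes A" by (rule bij_imp_permutes)
  moreover have "p ` B = C" using \<open>bij_betw p B C\<close> by (simp add: bij_betw_def)
  ultimately show ?thesis by blast
qed

text \<open>
  The vertex sets with \<open>\<delta>\<^sub>i\<close> elements over each \<open>i\<close> form one orbit of the symmetric group, represented by
  the set that occurs in the shuffle kernel of \<open>\<delta>\<close>.
\<close>

lemma initial_transitive:
  assumes S: "S \<subseteq> V"
  shows "\<exists>\<pi>\<in>S\<gamma>. \<pi> ` initial (\<lambda>i. card {\<alpha>. (i, \<alpha>) \<in> S}) = S"
proof -
  let ?R = "\<lambda>i. {\<alpha>. (i, \<alpha>) \<in> S}"
  have R: "?R i \<subseteq> {1..\<gamma> i}" for i using S by (auto simp: cover_verts_def)
  have "\<exists>p. p permutes {1..\<gamma> i} \<and> p ` {1..card (?R i)} = ?R i" for i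
  proof (rule permutes_onto)
    have "card (?R i) \<le> \<gamma> i" using card_mono[OF _ R, of i] by simp
    then show "{1..card (?R i)} \<subseteq> {1..\<gamma> i}" by simp
  qed (use R in auto)
  then obtain p where p: "\<And>i. p i permutes {1..\<gamma> i}" "\<And>i. p i ` {1..card (?R i)} = ?R i" by metis
  define \<sigma> where "\<sigma> i = (if i \<in> {1..k} then p i else id)" for i
  let ?\<pi> = "\<lambda>(i, \<alpha>). (i, \<sigma> i \<alpha>)"
  have "?\<pi> \<in> S\<gamma>" unfolding sym_group_conv
    by (rule exI[of _ \<sigma>]) (use p(1) in \<open>auto simp: \<sigma>_def permutes_id\<close>)
  moreover have "?\<pi> ` initial (\<lambda>i. card (?R i)) = S"
  proof -
    have "?\<pi> ` initial (\<lambda>i. card (?R i)) = Sigma {1..k} (\<lambda>i. p i ` {1..card (?R i)})"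
      unfolding initial_def by (force simp: \<sigma>_def image_iff)
    also have "\<dots> = Sigma {1..k} ?R" by (simp only: p(2))
    also have "\<dots> = S" using S by (auto simp: cover_verts_def)
    finally show ?thesis .
  qed
  ultimately show ?thesis by blast
qed

text \<open>
  The signs that relate shuffle kernels and cut products are absorbed by constants, and by
  \<open>initial_transitive\<close> renaming reaches the cuts of all vertex sets.
\<close>

lemma J_module_eq: "J_module k a \<gamma> = cutideal V E t h"
proof
  have sub: "mpoly.subspace (cutideal V E t h)" by (simp add: cutideal_def)
  have "stable_submodule k \<gamma> (cutideal V E t h)"
    unfolding stable_submodule_def A_prim_def
    using cutideal_subset_diffalg[OF multigraph_G] mpoly.subspace_0[OF sub] mpoly.subspace_add[OF sub]
      cutideal_times rename_cutideal by blast
  moreover have "shuffle_kernel k a \<gamma> \<delta> \<in> cutideal V E t h" if "(\<delta>, \<delta>') \<in> splittings k \<gamma>" for \<delta> \<delta>'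
  proof -
    have s: "\<And>i. i \<in> {1..k} \<Longrightarrow> \<gamma> i = \<delta> i + \<delta>' i" "\<exists>i\<in>{1..k}. \<delta> i \<noteq> 0" "\<exists>i\<in>{1..k}. \<delta>' i \<noteq> 0"
      using that by (auto simp: splittings_def)
    obtain i j where ij: "i \<in> {1..k}" "\<delta> i \<noteq> 0" "j \<in> {1..k}" "\<delta>' j \<noteq> 0" using s by blast
    have "initial \<delta> \<subseteq> V" using s(1) by (auto simp: initial_def cover_verts_def)
    moreover have "(i, 1) \<in> initial \<delta>" using ij by (auto simp: initial_def)
    moreover have "(j, \<gamma> j) \<in> V" "(j, \<gamma> j) \<notin> initial \<delta>"
      using ij s(1)[of j] by (auto simp: initial_def cover_verts_def)
    ultimately have "proper V (initial \<delta>)" unfolding proper_def by blast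
    then have "pairprod (initial \<delta>) \<in> cutideal V E t h" by (rule pairprod_cutideal)
    moreover have "\<delta> i \<le> \<gamma> i" if "i \<in> {1..k}" for i using s(1)[OF that] by simp
    ultimately show ?thesis using shuffle_kernel_eq[of \<delta>] by simp
  qed
  ultimately show "J_module k a \<gamma> \<subseteq> cutideal V E t h"
    unfolding J_module_def by (intro Inter_lower) auto
next
  show "cutideal V E t h \<subseteq> J_module k a \<gamma>"
    unfolding J_module_def
  proof (rule Inter_greatest, clarify)
    fix M x
    assume M: "stable_submodule k \<gamma> M" "\<forall>(\<delta>, \<delta>')\<in>splittings k \<gamma>. shuffle_kernel k a \<gamma> \<delta> \<in> M"
      and x: "x \<in> cutideal V E t h"
    have M0: "0 \<in> M" and Madd: "\<And>p q. p \<in> M \<Longrightarrow> q \<in> M \<Longrightarrow> p + q \<in> M"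
      and Mtimes: "\<And>r p. r \<in> diffalg V \<Longrightarrow> p \<in> M \<Longrightarrow> r * p \<in> M"
      and Mren: "\<And>\<pi> p. \<pi> \<in> S\<gamma> \<Longrightarrow> p \<in> M \<Longrightarrow> rename \<pi> p \<in> M"
      using M(1) unfolding stable_submodule_def A_prim_def by blast+
    have Mscale: "mscale c p \<in> M" if "p \<in> M" for c p
      unfolding mscale_def by (rule Mtimes[OF subalgebra_gen.const that])
    have Msub: "mpoly.subspace M" unfolding mpoly.subspace_def using M0 Madd Mscale by blast
    have "pairprod S \<in> M" if S: "proper V S" for S
    proof -
      have SV: "S \<subseteq> V" using S by (simp add: proper_def)
      let ?\<delta> = "\<lambda>i. card {\<alpha>. (i, \<alpha>) \<in> S}"
      have R: "{\<alpha>. (i, \<alpha>) \<in> S} \<subseteq> {1..\<gamma> i}" for i using SV by (auto simp: cover_verts_def)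
      have finR: "finite {\<alpha>. (i, \<alpha>) \<in> S}" for i using R finite_subset by blast
      have le: "?\<delta> i \<le> \<gamma> i" for i using card_mono[OF _ R, of i] by simp
      obtain \<pi> where \<pi>: "\<pi> \<in> S\<gamma>" "\<pi> ` initial ?\<delta> = S" using initial_transitive[OF SV] by blast
      have "(?\<delta>, \<lambda>i. \<gamma> i - ?\<delta> i) \<in> splittings k \<gamma>"
        unfolding splittings_def
      proof (intro CollectI case_prodI conjI ballI)
        show "\<gamma> i = ?\<delta> i + (\<gamma> i - ?\<delta> i)" for i using le by simp
        obtain i \<alpha> where i: "(i, \<alpha>) \<in> S" using S by (auto simp: proper_def)
        then have "i \<in> {1..k}" "?\<delta> i \<noteq> 0" using SV finR by (auto simp: cover_verts_def card_eq_0_iff)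
        then show "\<exists>i\<in>{1..k}. ?\<delta> i \<noteq> 0" by blast
        obtain j \<beta> where j: "(j, \<beta>) \<in> V" "(j, \<beta>) \<notin> S" using S by (auto simp: proper_def)
        then have jk: "j \<in> {1..k}" "\<beta> \<in> {1..\<gamma> j}" by (auto simp: cover_verts_def)
        then have "{\<alpha>. (j, \<alpha>) \<in> S} \<subset> {1..\<gamma> j}" using R[of j] j by blast
        then have "?\<delta> j < \<gamma> j" using psubset_card_mono[of "{1..\<gamma> j}"] by simp
        then show "\<exists>i\<in>{1..k}. \<gamma> i - ?\<delta> i \<noteq> 0" using jk by (intro bexI[of _ j]) auto
      qed
      then have "shuffle_kernel k a \<gamma> ?\<delta> \<in> M" using M(2) by blast
      then have "pairprod (initial ?\<delta>) \<in> M" using shuffle_kernel_eq[of ?\<delta>] le by simp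
      from Mren[OF \<pi>(1) this] show ?thesis unfolding rename_pairprod[OF \<pi>(1)] \<pi>(2) .
    qed
    note pp = this
    have "y \<in> M" if y: "y \<in> cutgens V E t h" for y
    proof -
      obtain q S where q: "q \<in> dprods V" "proper V S" "y = q * eprod t h (cut_edges E t h S)"
        using y unfolding cutgens_def by blast
      have "S \<subseteq> V" using q by (simp add: proper_def)
      then obtain c where c: "eprod t h (cut_edges E t h S) = mscale c (pairprod S)" using eprod_cut by blast
      have "q \<in> diffalg V" using q dprods_subset_diffalg by blast
      then show ?thesis unfolding q(3) c by (intro Mtimes Mscale pp q(2))
    qed
    then have "cutideal V E t h \<subseteq> M"
      unfolding cutideal_def by (intro mpoly.span_minimal[OF _ Msub]) blast
    then show "x \<in> M" using x by blast
  qed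
qed

section \<open>Complements of the invariant cut ideal\<close>

text \<open>
  Invariants of a direct sum of stable subspaces are the direct sum of the invariants, because the
  components of an invariant element are unique.
\<close>

lemma dim_complement:
  assumes V': "is_V_prim k a \<gamma> V'"
  shows "mpoly.dim {p \<in> invariants S\<gamma> (slims V E t h). homogeneous d p} = mpoly.dim {p \<in> V'. homogeneous d p}"
proof -
  let ?P = "slims V E t h" and ?J = "cutideal V E t h"
  have gV: "graded V'" and V'sub: "mpoly.subspace V'"
  proof -
    have "V' = mpoly.span {p \<in> V'. \<exists>d. homogeneous d p}" "mpoly.subspace V'"
      using V' unfolding is_V_prim_def graded_complement_def graded_subspace_def by blast+
    moreover have "graded (mpoly.span {p \<in> V'. \<exists>d. homogeneous d p})" by (rule graded_span) blast
    ultimately show "graded V'" "mpoly.subspace V'" by simp_all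
  qed
  have VJ: "V' \<inter> invariants S\<gamma> ?J = {0}" and VH: "{v + w | v w. v \<in> V' \<and> w \<in> invariants S\<gamma> ?J} = invariants S\<gamma> (diffalg V)"
    using V' unfolding is_V_prim_def graded_complement_def J_module_eq A_prim_def by blast+
  have gP: "graded ?P" by (rule graded_slims[OF finE])
  have gJ: "graded ?J" by (rule graded_cutideal[OF finE])
  have Psub: "mpoly.subspace ?P" "mpoly.subspace ?J" using gP gJ by (simp_all add: graded_def)
  have PA: "?P \<subseteq> diffalg V" by (rule slims_subset_diffalg[OF multigraph_G])
  have ginv: "graded (invariants S\<gamma> W)" if "graded W" for W
    using that invariants_subspace unfolding graded_def invariants_def
    by (auto simp: hcomp_rename[OF sym_bij, symmetric])
  have sub: "mpoly.subspace {p \<in> W. homogeneous d p}" if "mpoly.subspace W" for W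
  proof -
    have "{p \<in> W. homogeneous d p} = W \<inter> {p. homogeneous d p}" by blast
    then show ?thesis using mpoly.subspace_inter[OF that homogeneous_subspace] by simp
  qed
  obtain F where F: "finite F" "?P \<subseteq> mpoly.span F" using slims_finite_span[OF finE] by blast
  have hd: "hcomp d x = x" if "homogeneous d x" for x using that hcomp_homogeneous[OF that, of d] by simp
  show ?thesis
  proof (rule mpoly.dim_complements_eq[where W = "invariants S\<gamma> ?J" and F = F])
    show "mpoly.subspace {p \<in> invariants S\<gamma> ?P. homogeneous d p}"
      by (intro sub invariants_subspace Psub)
    show "mpoly.subspace {p \<in> V'. homogeneous d p}" by (intro sub V'sub)
    show "mpoly.subspace (invariants S\<gamma> ?J)" by (intro invariants_subspace Psub)
    show "{p \<in> invariants S\<gamma> ?P. homogeneous d p} \<subseteq> mpoly.span F" using F by (auto simp: invariants_def)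
    show "finite F" by (rule F(1))
    show "x = 0" if "x \<in> {p \<in> invariants S\<gamma> ?P. homogeneous d p}" "x \<in> invariants S\<gamma> ?J" for x
      using that slims_cutideal_Int[OF multigraph_G conn_G, of x] by (simp add: invariants_def)
    show "x = 0" if "x \<in> {p \<in> V'. homogeneous d p}" "x \<in> invariants S\<gamma> ?J" for x
      using that VJ by blast
  next
    fix x assume x: "x \<in> {p \<in> invariants S\<gamma> ?P. homogeneous d p}"
    then have "x \<in> invariants S\<gamma> (diffalg V)" using PA by (auto simp: invariants_def)
    then obtain v w where vw: "x = v + w" "v \<in> V'" "w \<in> invariants S\<gamma> ?J" unfolding VH[symmetric] by blast
    have "x = hcomp d v + hcomp d w" using hd[of x] x unfolding vw(1) by (simp add: hcomp.add)
    then have "x - hcomp d v = hcomp d w" by simp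
    moreover have "hcomp d w \<in> invariants S\<gamma> ?J" using ginv[OF gJ] vw(3) by (simp add: graded_def)
    moreover have "hcomp d v \<in> {p \<in> V'. homogeneous d p}"
      using gV vw(2) homogeneous_hcomp by (simp add: graded_def)
    ultimately show "\<exists>y\<in>{p \<in> V'. homogeneous d p}. x - y \<in> invariants S\<gamma> ?J"
      by (intro bexI[of _ "hcomp d v"]) (simp_all only:)
  next
    fix y assume y: "y \<in> {p \<in> V'. homogeneous d p}"
    have "y + 0 \<in> {v + w | v w. v \<in> V' \<and> w \<in> invariants S\<gamma> ?J}"
      using y mpoly.subspace_0[OF invariants_subspace[OF Psub(2), of S\<gamma>]] by blast
    then have yA: "y \<in> invariants S\<gamma> (diffalg V)" unfolding VH by simp
    then obtain p j where pj: "p \<in> ?P" "j \<in> ?J" "y = p + j"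
      using diffalg_decompose[OF multigraph_G conn_G] by (auto simp: invariants_def)
    have inv: "rename \<pi> p = p \<and> rename \<pi> j = j" if \<pi>: "\<pi> \<in> S\<gamma>" for \<pi>
    proof -
      have "rename \<pi> y = y" using yA \<pi> by (simp add: invariants_def)
      then have e: "rename \<pi> p - p = j - rename \<pi> j"
        unfolding pj(3) hom_add[OF is_hom_rename] by (simp add: algebra_simps)
      have "rename \<pi> p - p \<in> ?P"
        by (rule mpoly.subspace_diff[OF Psub(1) rename_slims[OF \<pi> pj(1)] pj(1)])
      moreover have "rename \<pi> p - p \<in> ?J"
        unfolding e by (rule mpoly.subspace_diff[OF Psub(2) pj(2) rename_cutideal[OF \<pi> pj(2)]])
      ultimately have "rename \<pi> p - p = 0" by (rule slims_cutideal_Int[OF multigraph_G conn_G])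
      then show ?thesis using e by simp
    qed
    have p: "p \<in> invariants S\<gamma> ?P" and j: "j \<in> invariants S\<gamma> ?J"
      using inv pj by (simp_all add: invariants_def)
    have "y = hcomp d p + hcomp d j" using hd[of y] y unfolding pj(3) by (simp add: hcomp.add)
    then have "hcomp d p - y = - hcomp d j" by simp
    moreover have "- hcomp d j \<in> invariants S\<gamma> ?J"
      using ginv[OF gJ] j by (intro mpoly.subspace_neg[OF invariants_subspace[OF Psub(2)]]) (simp add: graded_def)
    moreover have "hcomp d p \<in> {p \<in> invariants S\<gamma> ?P. homogeneous d p}"
      using ginv[OF gP] p homogeneous_hcomp by (simp add: graded_def)
    ultimately show "\<exists>x\<in>{p \<in> invariants S\<gamma> ?P. homogeneous d p}. x - y \<in> invariants S\<gamma> ?J"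
      by (intro bexI[of _ "hcomp d p"]) (simp_all only:)
  qed
qed

theorem quantum_DT_eq:
  assumes V': "is_V_prim k a \<gamma> V'"
  shows "hilbert_series (invariants S\<gamma> (slim_space G)) = quantum_DT k a \<gamma> V'"
proof (rule fps_ext)
  fix d
  have "{p \<in> V'. \<exists>e. homogeneous e p \<and> 2 * int e + chi k a \<gamma> = 2 * int d + chi k a \<gamma>}
      = {p \<in> V'. homogeneous d p}" by auto
  then show "fps_nth (hilbert_series (invariants S\<gamma> (slim_space G))) d = fps_nth (quantum_DT k a \<gamma> V') d"
    using dim_complement[OF V', of d]
    by (simp add: hilbert_series_def quantum_DT_def DT_coeff_def slim_space_eq_slims[OF wf_G] vertsG)
qed

text \<open>
  The graded pieces of the invariants vanish beyond the number of break divisors, so the series is a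
  polynomial, and its value at \<open>1\<close> is the sum of the graded dimensions.
\<close>

theorem numerical_DT_eq:
  assumes V': "is_V_prim k a \<gamma> V'"
  shows "\<exists>P. fps_of_poly P = quantum_DT k a \<gamma> V'"
    and "numerical_DT k a \<gamma> V' = int (card (orbits S\<gamma> (break_divisors G)))"
proof -
  let ?M = "break_monomials G"
  interpret bounded_width V E t h ?M "nat (int (card E) - int (card V) + 1)"
    using bounded_width_break[OF fin_G connected] unfolding vertsG .
  have small: "mpoly.dim (slims V E t h) \<le> card ?M"
    using dim_slims_le_break[OF fin_G connected] unfolding vertsG .
  note dims = dim_invariant_slims[OF small perm_group_sym act_break]
  let ?c = "\<lambda>d. int (mpoly.dim {p \<in> invariants S\<gamma> (slims V E t h). homogeneous d p})"
  have q: "fps_nth (quantum_DT k a \<gamma> V') d = ?c d" for d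
    unfolding quantum_DT_eq[OF V', symmetric] by (simp add: hilbert_series_def slim_space_eq_slims[OF wf_G] vertsG)
  define P where "P = (\<Sum>d<card ?M. monom (?c d) d)"
  have "fps_of_poly P = quantum_DT k a \<gamma> V'"
  proof (rule fps_ext)
    fix d
    have "coeff P d = (if d < card ?M then ?c d else 0)" by (simp add: P_def coeff_sum)
    also have "\<dots> = ?c d" using dims(2)[of d] by simp
    finally show "fps_nth (fps_of_poly P) d = fps_nth (quantum_DT k a \<gamma> V') d" unfolding q by simp
  qed
  note P = this
  show "\<exists>P. fps_of_poly P = quantum_DT k a \<gamma> V'" using P by blast
  have "(THE P. fps_of_poly P = quantum_DT k a \<gamma> V') = P"
    using P by (intro the_equality) (simp_all flip: fps_of_poly_eq_iff)
  then have "numerical_DT k a \<gamma> V' = poly P 1" by (simp add: numerical_DT_def)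
  also have "\<dots> = (\<Sum>d<card ?M. ?c d)" by (simp add: P_def poly_sum poly_monom)
  also have "\<dots> = int (card (monomial_orbits S\<gamma> ?M))" using dims(1) by (simp flip: of_nat_sum)
  also have "\<dots> = int (card (orbits S\<gamma> (break_divisors G)))"
    using card_orbits_break[OF fin_G sym_bij] by simp
  finally show "numerical_DT k a \<gamma> V' = int (card (orbits S\<gamma> (break_divisors G)))" .
qed

end

theorem theorem1p2:
  fixes Q :: "(nat, 'e) pre_digraph"
    and k :: nat
    and a :: "nat \<Rightarrow> nat \<Rightarrow> nat"
    and \<gamma> :: "nat \<Rightarrow> nat"
    and V :: "(nat \<times> nat) mpoly set"
  assumes "fin_digraph Q" and "verts Q = {1..k}"
    and "connected Q"
    and "\<And>i j. i \<in> {1..k} \<Longrightarrow> j \<in> {1..k} \<Longrightarrow> a i j = arrow_count Q i j"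
    and "\<And>i j. i \<in> {1..k} \<Longrightarrow> j \<in> {1..k} \<Longrightarrow> a i j = a j i"
    and "\<And>i. i \<in> {1..k} \<Longrightarrow> a i i \<ge> 1"
    and "connected (covering_graph k a \<gamma>)"
    and "is_V_prim k a \<gamma> V"
  shows "hilbert_series (invariants (sym_group k \<gamma>) (slim_space (covering_graph k a \<gamma>)))
           = quantum_DT k a \<gamma> V
       \<and> (\<exists>P. fps_of_poly P = quantum_DT k a \<gamma> V)
       \<and> numerical_DT k a \<gamma> V
           = int (card (orbits (sym_group k \<gamma>) (break_divisors (covering_graph k a \<gamma>))))"
proof -
  interpret cover k a \<gamma> by unfold_locales (rule assms(5), assumption+, rule assms(7))
  show ?thesis using quantum_DT_eq[OF assms(8)] numerical_DT_eq[OF assms(8)] by blast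
qed

end
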